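(* Let $T>0$, let $H\in W^{1,\infty}(\mathbb{R})$ with $H(0)=0$, let $\Omega\subseteq\mathbb{R}$ be open, let $u_0$ be a signed Radon measure on $\Omega$, and let $u$ be an entropy solution in $Q_T=\Omega\times(0,T]$ of the problem $u_t+[H(u)]_x=0$ with initial datum $u_0$. Then for a.e. $0<t_1<t_2<T$ there holds $$[u(\cdot,t_2)]_s^{\pm}\le[u(\cdot,t_1)]_s^{\pm}\le u_{0s}^{\pm}\quad\text{in }\mathcal{M}(\Omega).$$
   Context: Notation. $\mathcal{M}(\Omega)$ is the space of signed Radon measures on $\Omega$, $\mathcal{M}^+(\Omega)$ the cone of nonnegative ones; $\mu\le\nu$ in $\mathcal{M}(\Omega)$ means $\nu-\mu\in\mathcal{M}^+(\Omega)$; $\langle\cdot,\cdot\rangle_\Omega$ is the duality between $\mathcal{M}(\Omega)$ and $C_c(\Omega)$. Each $\mu\in\mathcal{M}(\Omega)$ is decomposed as $\mu=\mu_{ac}+\mu_s$ (absolutely continuous and singular parts with respect to Lebesgue measure), $\mu_r\in L^1_{loc}(\Omega)$ is the density of $\mu_{ac}$, $\mu_s^\pm$ are the positive and negative parts of $\mu_s$, and $|\mu|$ is the total variation. $\operatorname{sgn}(u)=1,0,-1$ for $u>0$, $u=0$, $u<0$ respectively. $L^\infty(0,T;\mathcal{M}^+(\Omega))$ is the set of nonnegative Radon measures $u$ on $\Omega\times(0,T)$ such that for a.e. $t\in(0,T)$ there is $u(\cdot,t)\in\mathcal{M}^+(\Omega)$ with: (i) for each $\zeta\in C([0,T];C_c(\Omega))$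 the map $t\mapsto\langle u(\cdot,t),\zeta(\cdot,t)\rangle_\Omega$ is in $L^1(0,T)$ and $\langle u,\zeta\rangle_{\Omega\times(0,T)}=\int_0^T\langle u(\cdot,t),\zeta(\cdot,t)\rangle_\Omega\,dt$; (ii) $t\mapsto|u(\cdot,t)|(K)$ is in $L^\infty(0,T)$ for every compact $K\subset\Omega$. A signed measure $u$ belongs to $L^\infty(0,T;\mathcal{M}(\Omega))$ if $u^+$ and $u^-$ belong to $L^\infty(0,T;\mathcal{M}^+(\Omega))$; then $u(\cdot,t)=u^+(\cdot,t)-u^-(\cdot,t)$, and for a.e. $t$ one has $u_s(\cdot,t)=[u(\cdot,t)]_s$, $u_r(\cdot,t)=[u(\cdot,t)]_r$, $u_s^\pm(\cdot,t)=[u(\cdot,t)]_s^\pm$. Solution. A measure $u\in L^\infty(0,T;\mathcal{M}(\Omega))$ is a solution in $Q_T$ if for all $\zeta\in C^1([0,T];C^1_c(\Omega))$ with $\zeta(\cdot,T)=0$ in $\Omega$, $$\iint_{Q_T}[u_r\zeta_t+H(u_r)\zeta_x]\,dxdt+\int_0^T\langle u_s(\cdot,t),\zeta_t(\cdot,t)\rangle_\Omega\,dt=-\langle u_0,\zeta(\cdot,0)\rangle_\Omega.$$ It is an entropy solution in $Q_T$ if in addition, for all such $\zeta$ with $\zeta\ge0$ and for all $k\in\mathbb{R}$, $$\iint_{Q_T}\{|u_r-k|\zeta_t+\operatorname{sgn}(u_r-k)[H(u_r)-H(k)]\zeta_x\}\,dxdt+\int_0^T\langle|u_s(\cdot,t)|,\zeta_t(\cdot,t)\rangle_\Omega\,dt\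 \ge\ -\int_\Omega|u_{0r}-k|\,\zeta(x,0)\,dx-\langle|u_{0s}|,\zeta(\cdot,0)\rangle_\Omega.$$ *)

theory Defs
  imports "HOL-Analysis.Analysis"
begin

section \<open>Radon measures on an open set\<close>

abbreviation borel_on :: "'a::euclidean_space set \<Rightarrow> 'a measure" where
  "borel_on S \<equiv> restrict_space borel S"

text \<open>Regularity is automatic for locally finite Borel measures on an open subset of a
  Euclidean space.\<close>

definition radon :: "'a::euclidean_space set \<Rightarrow> 'a measure set" where
  "radon S = {M. sets M = sets (borel_on S) \<and>
                 (\<forall>K. compact K \<longrightarrow> K \<subseteq> S \<longrightarrow> emeasure M K < \<infinity>)}"

text \<open>The positive and the negative part of a signed Radon measure on an open set may both have
  infinite mass. Such a measure is therefore a set function whose values are meaningful only on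
  the Borel sets that are relatively compact in \<open>S\<close>; all notions below look only at those sets.\<close>

definition rc_borel :: "'a::euclidean_space set \<Rightarrow> 'a set set" where
  "rc_borel S = {A \<in> sets borel. \<exists>K. compact K \<and> A \<subseteq> K \<and> K \<subseteq> S}"

definition signed_radon :: "'a::euclidean_space set \<Rightarrow> ('a set \<Rightarrow> real) set" where
  "signed_radon S = {\<mu>. \<exists>P\<in>radon S. \<exists>N\<in>radon S. \<forall>A\<in>rc_borel S. \<mu> A = measure P A - measure N A}"

definition radon_le :: "'a::euclidean_space set \<Rightarrow> ('a set \<Rightarrow> real) \<Rightarrow> ('a set \<Rightarrow> real) \<Rightarrow> bool" where
  "radon_le S \<mu> \<nu> \<longleftrightarrow> \<mu> \<in> signed_radon S \<and> \<nu> \<in> signed_radon S \<and>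
     (\<exists>R\<in>radon S. \<forall>A\<in>rc_borel S. \<nu> A - \<mu> A = measure R A)"

text \<open>Jordan decomposition: \<open>ennreal\<close> truncates negative values to 0, and the empty set
  belongs to the index set.\<close>

definition pos_part :: "'a::euclidean_space set \<Rightarrow> ('a set \<Rightarrow> real) \<Rightarrow> 'a measure" where
  "pos_part S \<mu> = measure_of S (sets (borel_on S))
     (\<lambda>A. SUP B\<in>{B \<in> rc_borel S. B \<subseteq> A}. ennreal (\<mu> B))"

definition neg_part :: "'a::euclidean_space set \<Rightarrow> ('a set \<Rightarrow> real) \<Rightarrow> 'a measure" where
  "neg_part S \<mu> = pos_part S (\<lambda>A. - \<mu> A)"

definition total_variation :: "'a::euclidean_space set \<Rightarrow> ('a set \<Rightarrow> real) \<Rightarrow> 'a measure" where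
  "total_variation S \<mu> = measure_of S (sets (borel_on S))
     (\<lambda>A. emeasure (pos_part S \<mu>) A + emeasure (neg_part S \<mu>) A)"

definition pairing :: "'a::euclidean_space set \<Rightarrow> ('a set \<Rightarrow> real) \<Rightarrow> ('a \<Rightarrow> real) \<Rightarrow> real" where
  "pairing S \<mu> f = (LINT x|pos_part S \<mu>. f x) - (LINT x|neg_part S \<mu>. f x)"

text \<open>\<open>is_lebesgue_decomp S \<mu> \<alpha> \<sigma>\<close>: \<open>\<mu> = \<alpha> + \<sigma>\<close> with \<open>\<alpha>\<close> absolutely continuous and \<open>\<sigma>\<close> singular
  with respect to Lebesgue measure. The decomposition is unique on relatively compact Borel
  sets, and the density is unique up to null sets, so the choices below are immaterial.\<close>

definition is_lebesgue_decomp ::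
    "'a::euclidean_space set \<Rightarrow> ('a set \<Rightarrow> real) \<Rightarrow> ('a set \<Rightarrow> real) \<Rightarrow> ('a set \<Rightarrow> real) \<Rightarrow> bool" where
  "is_lebesgue_decomp S \<mu> \<alpha> \<sigma> \<longleftrightarrow> \<alpha> \<in> signed_radon S \<and> \<sigma> \<in> signed_radon S \<and>
     (\<forall>A\<in>rc_borel S. \<mu> A = \<alpha> A + \<sigma> A) \<and>
     (\<forall>A\<in>rc_borel S. A \<in> null_sets lborel \<longrightarrow> \<alpha> A = 0) \<and>
     (\<exists>Z\<in>null_sets lborel. \<forall>A\<in>rc_borel S. \<sigma> A = \<sigma> (A \<inter> Z))"

definition ac_part :: "'a::euclidean_space set \<Rightarrow> ('a set \<Rightarrow> real) \<Rightarrow> 'a set \<Rightarrow> real" where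
  "ac_part S \<mu> = (SOME \<alpha>. \<exists>\<sigma>. is_lebesgue_decomp S \<mu> \<alpha> \<sigma>)"

definition sing_part :: "'a::euclidean_space set \<Rightarrow> ('a set \<Rightarrow> real) \<Rightarrow> 'a set \<Rightarrow> real" where
  "sing_part S \<mu> = (SOME \<sigma>. \<exists>\<alpha>. is_lebesgue_decomp S \<mu> \<alpha> \<sigma>)"

definition ac_density :: "'a::euclidean_space set \<Rightarrow> ('a set \<Rightarrow> real) \<Rightarrow> 'a \<Rightarrow> real" where
  "ac_density S \<mu> = (SOME f. f \<in> borel_measurable borel \<and>
     (\<forall>K. compact K \<longrightarrow> K \<subseteq> S \<longrightarrow> set_integrable lborel K f) \<and>
     (\<forall>A\<in>rc_borel S. ac_part S \<mu> A = (LINT x:A|lborel. f x)))"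


section \<open>Function spaces\<close>

definition Linf :: "'a measure \<Rightarrow> ('a \<Rightarrow> real) set" where
  "Linf M = {f \<in> borel_measurable M. \<exists>C. AE x in M. \<bar>f x\<bar> \<le> C}"

definition smooth_compact_support :: "(real \<Rightarrow> real) \<Rightarrow> bool" where
  "smooth_compact_support \<phi> \<longleftrightarrow>
     (\<forall>n x. (deriv ^^ n) \<phi> differentiable at x) \<and> (\<exists>K. compact K \<and> (\<forall>x. x \<notin> K \<longrightarrow> \<phi> x = 0))"

text \<open>The Sobolev space \<open>W\<^sup>1\<^sup>,\<^sup>\<infinity>(\<real>)\<close>; elements are identified with their continuous
  representatives, so that point values make sense.\<close>

definition W1inf :: "(real \<Rightarrow> real) set" where
  "W1inf = {H. continuous_on UNIV H \<and> H \<in> Linf lebesgue \<and>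
     (\<exists>g\<in>Linf lebesgue. \<forall>\<phi>. smooth_compact_support \<phi> \<longrightarrow>
        (LINT x|lebesgue. H x * deriv \<phi> x) = - (LINT x|lebesgue. g x * \<phi> x))}"

text \<open>Functions of \<open>(x,t)\<close> are written as curves \<open>\<zeta>\<close>, with \<open>\<zeta> t\<close> standing for \<open>\<zeta>(\<cdot>,t)\<close>.
  \<open>C\<^sub>c(\<Omega>)\<close> and \<open>C\<^sup>1\<^sub>c(\<Omega>)\<close> carry their inductive limit topologies. A continuous curve on the compact
  interval \<open>[0,T]\<close> therefore has its supports in one compact subset \<open>K\<close> of \<open>\<Omega>\<close>, and it is continuous
  in the sup norm, respectively the \<open>C\<^sup>1\<close> norm.\<close>

definition C_Cc :: "real set \<Rightarrow> real \<Rightarrow> (real \<Rightarrow> real \<Rightarrow> real) set" where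
  "C_Cc \<Omega> T = {\<zeta>. \<exists>K. compact K \<and> K \<subseteq> \<Omega> \<and>
     (\<forall>t\<in>{0..T}. continuous_on \<Omega> (\<zeta> t) \<and> (\<forall>x\<in>\<Omega> - K. \<zeta> t x = 0) \<and>
        uniform_limit \<Omega> \<zeta> (\<zeta> t) (at t within {0..T}))}"

definition C1_limit :: "real set \<Rightarrow> ('i \<Rightarrow> real \<Rightarrow> real) \<Rightarrow> (real \<Rightarrow> real) \<Rightarrow> 'i filter \<Rightarrow> bool" where
  "C1_limit \<Omega> f l F \<longleftrightarrow> uniform_limit \<Omega> f l F \<and> uniform_limit \<Omega> (\<lambda>i. deriv (f i)) (deriv l) F"

text \<open>Below, \<open>\<eta>\<close> is the derivative of the curve \<open>\<zeta>\<close> (one-sided at the endpoints).\<close>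

definition C1_C1c :: "real set \<Rightarrow> real \<Rightarrow> (real \<Rightarrow> real \<Rightarrow> real) set" where
  "C1_C1c \<Omega> T = {\<zeta>. \<exists>K \<eta>. compact K \<and> K \<subseteq> \<Omega> \<and>
     (\<forall>t\<in>{0..T}. \<zeta> t C1_differentiable_on \<Omega> \<and> (\<forall>x\<in>\<Omega> - K. \<zeta> t x = 0) \<and>
        \<eta> t C1_differentiable_on \<Omega> \<and> (\<forall>x\<in>\<Omega> - K. \<eta> t x = 0) \<and>
        C1_limit \<Omega> (\<lambda>s x. (\<zeta> s x - \<zeta> t x) / (s - t)) (\<eta> t) (at t within {0..T}) \<and>
        C1_limit \<Omega> \<eta> (\<eta> t) (at t within {0..T}))}"

abbreviation time_deriv :: "(real \<Rightarrow> real \<Rightarrow> real) \<Rightarrow> real \<Rightarrow> real \<Rightarrow> real" where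
  "time_deriv \<zeta> t x \<equiv> deriv (\<lambda>s. \<zeta> s x) t"

abbreviation space_deriv :: "(real \<Rightarrow> real \<Rightarrow> real) \<Rightarrow> real \<Rightarrow> real \<Rightarrow> real" where
  "space_deriv \<zeta> t x \<equiv> deriv (\<zeta> t) x"


section \<open>Measure-valued functions of time\<close>

abbreviation time_measure :: "real \<Rightarrow> real measure" where
  "time_measure T \<equiv> lebesgue_on {0<..<T}"

abbreviation cylinder :: "real set \<Rightarrow> real \<Rightarrow> (real \<times> real) set" where
  "cylinder \<Omega> T \<equiv> \<Omega> \<times> {0<..<T}"

definition is_slicing ::
    "real set \<Rightarrow> real \<Rightarrow> (real \<times> real) measure \<Rightarrow> (real \<Rightarrow> real measure) \<Rightarrow> bool" where
  "is_slicing \<Omega> T u v \<longleftrightarrow>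
     (AE t in time_measure T. v t \<in> radon \<Omega>) \<and>
     (\<forall>\<zeta>\<in>C_Cc \<Omega> T.
        integrable u (\<lambda>(x, t). \<zeta> t x) \<and>
        integrable (time_measure T) (\<lambda>t. LINT x|v t. \<zeta> t x) \<and>
        (LINT (x, t)|u. \<zeta> t x) = (LINT t|time_measure T. LINT x|v t. \<zeta> t x)) \<and>
     (\<forall>K. compact K \<longrightarrow> K \<subseteq> \<Omega> \<longrightarrow> (\<lambda>t. measure (v t) K) \<in> Linf (time_measure T))"

definition Linf_radon :: "real set \<Rightarrow> real \<Rightarrow> (real \<times> real) measure set" where
  "Linf_radon \<Omega> T = {u \<in> radon (cylinder \<Omega> T). \<exists>v. is_slicing \<Omega> T u v}"

text \<open>The slices are unique for almost every \<open>t\<close>.\<close>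

definition slice :: "real set \<Rightarrow> real \<Rightarrow> (real \<times> real) measure \<Rightarrow> real \<Rightarrow> real measure" where
  "slice \<Omega> T u = (SOME v. is_slicing \<Omega> T u v)"

definition Linf_signed_radon :: "real set \<Rightarrow> real \<Rightarrow> ((real \<times> real) set \<Rightarrow> real) set" where
  "Linf_signed_radon \<Omega> T = {u \<in> signed_radon (cylinder \<Omega> T).
     pos_part (cylinder \<Omega> T) u \<in> Linf_radon \<Omega> T \<and> neg_part (cylinder \<Omega> T) u \<in> Linf_radon \<Omega> T}"

definition signed_slice ::
    "real set \<Rightarrow> real \<Rightarrow> ((real \<times> real) set \<Rightarrow> real) \<Rightarrow> real \<Rightarrow> real set \<Rightarrow> real" where
  "signed_slice \<Omega> T u t A =
     measure (slice \<Omega> T (pos_part (cylinder \<Omega> T) u) t) A -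
     measure (slice \<Omega> T (neg_part (cylinder \<Omega> T) u) t) A"


section \<open>Solutions of the conservation law\<close>

definition is_solution ::
    "real set \<Rightarrow> real \<Rightarrow> (real \<Rightarrow> real) \<Rightarrow> (real set \<Rightarrow> real) \<Rightarrow> ((real \<times> real) set \<Rightarrow> real) \<Rightarrow> bool" where
  "is_solution \<Omega> T H u0 u \<longleftrightarrow> u \<in> Linf_signed_radon \<Omega> T \<and>
     (let ur = ac_density (cylinder \<Omega> T) u; us = sing_part (cylinder \<Omega> T) u in
      \<forall>\<zeta>\<in>C1_C1c \<Omega> T. (\<forall>x\<in>\<Omega>. \<zeta> T x = 0) \<longrightarrow>
        (LINT (x, t):cylinder \<Omega> T|lborel.
            ur (x, t) * time_deriv \<zeta> t x + H (ur (x, t)) * space_deriv \<zeta> t x) +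
        (LINT t|time_measure T. pairing \<Omega> (signed_slice \<Omega> T us t) (time_deriv \<zeta> t))
        = - pairing \<Omega> u0 (\<zeta> 0))"

definition is_entropy_solution ::
    "real set \<Rightarrow> real \<Rightarrow> (real \<Rightarrow> real) \<Rightarrow> (real set \<Rightarrow> real) \<Rightarrow> ((real \<times> real) set \<Rightarrow> real) \<Rightarrow> bool" where
  "is_entropy_solution \<Omega> T H u0 u \<longleftrightarrow> is_solution \<Omega> T H u0 u \<and>
     (let ur = ac_density (cylinder \<Omega> T) u; us = sing_part (cylinder \<Omega> T) u;
          u0r = ac_density \<Omega> u0; u0s = sing_part \<Omega> u0 in
      \<forall>\<zeta>\<in>C1_C1c \<Omega> T. (\<forall>x\<in>\<Omega>. \<zeta> T x = 0) \<longrightarrow> (\<forall>t\<in>{0..T}. \<forall>x\<in>\<Omega>. \<zeta> t x \<ge> 0) \<longrightarrow> (\<forall>k.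
        (LINT (x, t):cylinder \<Omega> T|lborel.
            \<bar>ur (x, t) - k\<bar> * time_deriv \<zeta> t x +
            sgn (ur (x, t) - k) * (H (ur (x, t)) - H k) * space_deriv \<zeta> t x) +
        (LINT t|time_measure T.
            LINT x|total_variation \<Omega> (signed_slice \<Omega> T us t). time_deriv \<zeta> t x)
        \<ge> - (LINT x:\<Omega>|lborel. \<bar>u0r x - k\<bar> * \<zeta> 0 x)
           - (LINT x|total_variation \<Omega> u0s. \<zeta> 0 x)))"

end

theory Submission
  imports Defs
begin

text \<open>
  Adding \<open>\<plusminus>\<close> the weak formulation to the entropy inequality with constant \<open>k\<close> and letting
  \<open>k \<rightarrow> \<plusminus>\<infinity>\<close> removes the regular part: \<open>H\<close> is bounded and \<open>(\<plusminus>u\<^sub>r - j)\<^sup>+ \<rightarrow> 0\<close> in \<open>L\<^sup>1\<close> on compact sets. What is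
  left, for test functions \<open>\<phi>(t) \<rho>(x)\<close> and \<open>m(t) = \<langle>u\<^sub>s\<^sup>\<plusminus>(t), \<rho>\<rangle>\<close>, is \<open>\<integral> \<phi>' m dt \<ge> - \<phi>(0) \<langle>u\<^sub>0\<^sub>s\<^sup>\<plusminus>, \<rho>\<rangle>\<close>.
  Decreasing \<open>\<phi>\<close> give \<open>m \<le> \<langle>u\<^sub>0\<^sub>s\<^sup>\<plusminus>, \<rho>\<rangle>\<close>, and functions \<open>\<phi>\<close> which increase before a rational time \<open>q\<close>
  and decrease back to 0 after it give a constant separating the values of \<open>m\<close> before \<open>q\<close> from
  those after \<open>q\<close>. A countable family of functions \<open>\<rho>\<close> determines the order of Radon measures on
  the line, which leaves a single null set of times. The identity \<open>u\<^sub>s(t) = [u(t)]\<^sub>s\<close> for almost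
  every \<open>t\<close> comes from the uniqueness of disintegrations.
\<close>

section \<open>Radon measures and their restrictions\<close>

text \<open>Time slices, densities and singular parts are all chosen by \<open>SOME\<close>, so each
  is known only up to null sets. Every such object is therefore replaced by an explicit one: the
  singular part by restriction to one null set \<open>Z\<close>, the slices by a family of Radon
  measures that satisfies the disintegration identity for all Borel integrands. Sections of
  \<open>Z\<close> and of a Hahn set of \<open>u\<close> then decompose almost every slice. Signed
  Radon measures have meaningful values only on relatively compact Borel sets, hence the frequent
  compact exhaustions. For the limit in \<open>k\<close>, the constant \<open>k\<close> is itself a
  solution with explicit boundary terms; subtracting it turns the regular integrand into
  \<open>2 (\<plusminus>u_r - j)^+\<close> plus a flux term that vanishes where
  \<open>\<plusminus>u_r < j\<close>, and the terms linear in \<open>j\<close> cancel. In time,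
  \<open>m\<close> is used only as an integrable function, so comparisons go through averages: the
  test function around \<open>q\<close> is a difference of two primitives, weighted so that it
  vanishes both at 0 and at \<open>T\<close>, and the initial datum drops out.\<close>

lemma sets_borel_on: "open S \<Longrightarrow> A \<in> sets (borel_on S) \<longleftrightarrow> A \<subseteq> S \<and> A \<in> sets borel"
  by (subst sets_restrict_space_iff) auto

lemma radon_sets: "M \<in> radon S \<Longrightarrow> sets M = sets (borel_on S)"
  by (simp add: radon_def)

lemma radon_space: "M \<in> radon S \<Longrightarrow> space M = S"
  using sets_eq_imp_space_eq[OF radon_sets] by (simp add: space_restrict_space)

lemma radon_sets_iff:
  "M \<in> radon S \<Longrightarrow> open S \<Longrightarrow> A \<in> sets M \<longleftrightarrow> A \<subseteq> S \<and> A \<in> sets borel"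
  by (simp add: radon_sets sets_borel_on)

lemma radonI:
  assumes "sets M = sets (borel_on S)" "\<And>K. compact K \<Longrightarrow> K \<subseteq> S \<Longrightarrow> emeasure M K < \<infinity>"
  shows "M \<in> radon S"
  using assms by (simp add: radon_def)

lemma rc_borel_sets: "A \<in> rc_borel S \<Longrightarrow> A \<in> sets borel \<and> A \<subseteq> S"
  by (auto simp: rc_borel_def)

lemma rc_borel_subset: "A \<in> rc_borel S \<Longrightarrow> B \<subseteq> A \<Longrightarrow> B \<in> sets borel \<Longrightarrow> B \<in> rc_borel S"
  unfolding rc_borel_def by blast

lemma rc_borel_Int: "A \<in> rc_borel S \<Longrightarrow> B \<in> sets borel \<Longrightarrow> A \<inter> B \<in> rc_borel S"
  by (rule rc_borel_subset[of A]) (auto simp: rc_borel_def)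

lemma rc_borel_Diff: "A \<in> rc_borel S \<Longrightarrow> B \<in> sets borel \<Longrightarrow> A - B \<in> rc_borel S"
  by (rule rc_borel_subset[of A]) (auto simp: rc_borel_def)

lemma compact_rc_borel: "compact K \<Longrightarrow> K \<subseteq> S \<Longrightarrow> K \<in> rc_borel S"
  by (auto simp: rc_borel_def intro: borel_compact)

lemma radon_rc_borel_finite:
  assumes "M \<in> radon S" "open S" "A \<in> rc_borel S"
  shows "A \<in> sets M" "emeasure M A < \<infinity>"
proof -
  obtain K where K: "compact K" "A \<subseteq> K" "K \<subseteq> S" and A: "A \<in> sets borel"
    using assms(3) by (auto simp: rc_borel_def)
  show "A \<in> sets M" using assms K A by (auto simp: radon_sets_iff)
  have "K \<in> sets M" using assms K by (auto simp: radon_sets_iff intro: borel_compact)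
  then have "emeasure M A \<le> emeasure M K" by (rule emeasure_mono[OF K(2)])
  also have "\<dots> < \<infinity>" using assms(1) K by (simp add: radon_def)
  finally show "emeasure M A < \<infinity>" .
qed

lemma radon_emeasure_eq:
  assumes "M \<in> radon S" "open S" "A \<in> rc_borel S"
  shows "emeasure M A = ennreal (measure M A)"
  using radon_rc_borel_finite[OF assms] by (simp add: emeasure_eq_ennreal_measure less_top)

lemma compact_exhaustion:
  fixes S :: "'a::euclidean_space set"
  assumes "open S"
  obtains C where "\<And>n. compact (C n)" "\<And>n. C n \<subseteq> S" "incseq C" "(\<Union>n. C n) = S"
    "\<And>K. compact K \<Longrightarrow> K \<subseteq> S \<Longrightarrow> \<exists>n. K \<subseteq> C n"
proof -
  obtain C where C: "\<And>n. compact (C n)" "\<And>n. C n \<subseteq> S" "\<And>n. C n \<subseteq> interior (C (Suc n))"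
    "\<Union>(range C) = S" "\<And>K. \<lbrakk>compact K; K \<subseteq> S\<rbrakk> \<Longrightarrow> \<exists>N. \<forall>n\<ge>N. K \<subseteq> (C n)"
    using open_Union_compact_subsets[OF assms] by metis
  have "incseq C"
    by (rule incseq_SucI) (rule subset_trans[OF C(3) interior_subset])
  show thesis
  proof (rule that[OF C(1,2) \<open>incseq C\<close> C(4)])
    show "\<exists>n. K \<subseteq> C n" if "compact K" "K \<subseteq> S" for K
      using C(5)[OF that] order_refl by metis
  qed
qed

lemma radon_sigma_finite:
  fixes S :: "'a::euclidean_space set"
  assumes "M \<in> radon S" "open S"
  shows "sigma_finite_measure M"
proof -
  obtain C where C: "\<And>n. compact (C n)" "\<And>n. C n \<subseteq> S" "incseq C" "(\<Union>n. C n) = S"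
    using compact_exhaustion[OF assms(2)] by metis
  have "C n \<in> sets M \<and> emeasure M (C n) < \<infinity>" for n
    using radon_rc_borel_finite[OF assms compact_rc_borel] C by blast
  then show ?thesis
    using C(4) radon_space[OF assms(1)]
    by (intro sigma_finite_measure.intro exI[of _ "range C"]) (auto simp: less_top)
qed

text \<open>Both measures are continuous from below along a compact exhaustion of \<open>S\<close>,
  so the relatively compact sets determine them.\<close>

lemma radon_measure_eqI:
  fixes S :: "'a::euclidean_space set"
  assumes "M \<in> radon S" "N \<in> radon S" "open S"
    and eq: "\<And>A. A \<in> rc_borel S \<Longrightarrow> emeasure M A = emeasure N A"
  shows "M = N"
proof (rule measure_eqI)
  show "sets M = sets N" using assms by (simp add: radon_sets)
  fix A assume A: "A \<in> sets M"
  obtain C where C: "\<And>n. compact (C n)" "\<And>n. C n \<subseteq> S" "incseq C" "(\<Union>n. C n) = S"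
    using compact_exhaustion[OF assms(3)] by metis
  have A': "A \<subseteq> S" "A \<in> sets borel" using A assms by (auto simp: radon_sets_iff)
  have rc: "A \<inter> C n \<in> rc_borel S" for n
    using A' C by (auto simp: rc_borel_def intro: borel_compact)
  have inc: "incseq (\<lambda>n. A \<inter> C n)" using C(3) by (auto simp: incseq_def)
  have U: "(\<Union>n. A \<inter> C n) = A" using C(4) A' by auto
  have "(SUP n. emeasure M (A \<inter> C n)) = emeasure M (\<Union>n. A \<inter> C n)"
    using rc radon_rc_borel_finite(1)[OF assms(1,3)] by (intro SUP_emeasure_incseq inc) auto
  moreover have "(SUP n. emeasure N (A \<inter> C n)) = emeasure N (\<Union>n. A \<inter> C n)"
    using rc radon_rc_borel_finite(1)[OF assms(2,3)] by (intro SUP_emeasure_incseq inc) auto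
  ultimately show "emeasure M A = emeasure N A" using eq[OF rc] U by simp
qed

text \<open>Written as a density on the old sigma-algebra and not with
  \<open>restrict_space\<close>: the underlying space stays \<open>S\<close>, so the result lies
  again in \<open>radon S\<close> and can be compared with \<open>M\<close>.\<close>

definition restr :: "'a::euclidean_space measure \<Rightarrow> 'a set \<Rightarrow> 'a measure" where
  "restr M Z = density M (indicator Z)"

lemma borel_imp_measurable_on:
  assumes "f \<in> borel_measurable borel" "sets M = sets (borel_on S)"
  shows "f \<in> borel_measurable M"
  unfolding measurable_cong_sets[OF assms(2) refl]
  by (rule measurable_restrict_space1[OF assms(1)])

lemma radon_measurable:
  "f \<in> borel_measurable borel \<Longrightarrow> M \<in> radon S \<Longrightarrow> f \<in> borel_measurable M"
  by (rule borel_imp_measurable_on[OF _ radon_sets])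

lemma sets_restr [simp]: "sets (restr M Z) = sets M"
  by (simp add: restr_def)

lemma space_restr [simp]: "space (restr M Z) = space M"
  by (simp add: restr_def)

lemma emeasure_restr:
  assumes "M \<in> radon S" "open S" "Z \<in> sets borel" "A \<in> sets M"
  shows "emeasure (restr M Z) A = emeasure M (A \<inter> Z)"
proof -
  have "(indicator Z :: _ \<Rightarrow> ennreal) \<in> borel_measurable M"
    using assms(3) by (intro radon_measurable[OF _ assms(1)]) auto
  then have "emeasure (restr M Z) A = (\<integral>\<^sup>+x. indicator Z x * indicator A x \<partial>M)"
    unfolding restr_def using assms by (subst emeasure_density) auto
  also have "\<dots> = (\<integral>\<^sup>+x. indicator (A \<inter> Z) x \<partial>M)"
    by (intro nn_integral_cong) (auto simp: indicator_def)
  also have "\<dots> = emeasure M (A \<inter> Z)"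
    using assms by (intro nn_integral_indicator) (auto simp: radon_sets_iff)
  finally show ?thesis .
qed

lemma restr_radon:
  assumes "M \<in> radon S" "open S" "Z \<in> sets borel"
  shows "restr M Z \<in> radon S"
proof (rule radonI)
  show "sets (restr M Z) = sets (borel_on S)" using assms by (simp add: radon_sets)
  fix K assume K: "compact K" "K \<subseteq> S"
  have "K \<in> sets M" using assms K by (auto simp: radon_sets_iff intro: borel_compact)
  then have "emeasure (restr M Z) K \<le> emeasure M K"
    using assms by (simp add: emeasure_restr emeasure_mono)
  also have "\<dots> < \<infinity>" using assms K by (simp add: radon_def)
  finally show "emeasure (restr M Z) K < \<infinity>" .
qed

lemma measure_restr:
  assumes "M \<in> radon S" "open S" "Z \<in> sets borel" "A \<in> sets M"
  shows "measure (restr M Z) A = measure M (A \<inter> Z)"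
  using emeasure_restr[OF assms] by (simp add: measure_def)

lemma nn_integral_restr:
  assumes "M \<in> radon S" "Z \<in> sets borel" "f \<in> borel_measurable M"
  shows "(\<integral>\<^sup>+x. f x \<partial>restr M Z) = (\<integral>\<^sup>+x. indicator Z x * f x \<partial>M)"
  unfolding restr_def using assms
  by (subst nn_integral_density) (auto intro!: radon_measurable[OF _ assms(1)])

section \<open>Signed Radon measures on relatively compact sets\<close>

lemma null_measure_radon: "null_measure (borel_on S) \<in> radon S"
  by (auto intro: radonI)

lemma measure_signed_radon: "M \<in> radon S \<Longrightarrow> measure M \<in> signed_radon S"
  unfolding signed_radon_def mem_Collect_eq
  by (rule bexI[of _ M], rule bexI[OF _ null_measure_radon[of S]]) auto

lemma signed_radon_diff:
  "P \<in> radon S \<Longrightarrow> N \<in> radon S \<Longrightarrow> (\<lambda>A. measure P A - measure N A) \<in> signed_radon S"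
  unfolding signed_radon_def by auto

lemma signed_radon_restr:
  assumes "\<mu> \<in> signed_radon S" "open S" "Z \<in> sets borel"
  shows "(\<lambda>A. \<mu> (A \<inter> Z)) \<in> signed_radon S"
proof -
  obtain P N where PN: "P \<in> radon S" "N \<in> radon S"
    and \<mu>: "\<forall>A\<in>rc_borel S. \<mu> A = measure P A - measure N A"
    using assms(1) by (auto simp: signed_radon_def)
  have "\<mu> (A \<inter> Z) = measure (restr P Z) A - measure (restr N Z) A" if A: "A \<in> rc_borel S" for A
    using \<mu> rc_borel_Int[OF A assms(3)] measure_restr[OF PN(1) assms(2,3) radon_rc_borel_finite(1)[OF PN(1) assms(2) A]]
      measure_restr[OF PN(2) assms(2,3) radon_rc_borel_finite(1)[OF PN(2) assms(2) A]] by metis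
  then show ?thesis
    unfolding signed_radon_def using restr_radon[OF PN(1) assms(2,3)] restr_radon[OF PN(2) assms(2,3)]
    by blast
qed

lemma signed_radon_cong:
  "\<mu> \<in> signed_radon S \<Longrightarrow> (\<And>A. A \<in> rc_borel S \<Longrightarrow> \<nu> A = \<mu> A) \<Longrightarrow> \<nu> \<in> signed_radon S"
  unfolding signed_radon_def by simp

lemma signed_radon_Un:
  assumes "\<mu> \<in> signed_radon S" "open S" "A \<in> rc_borel S" "B \<in> rc_borel S" "A \<inter> B = {}" "A \<union> B \<in> rc_borel S"
  shows "\<mu> (A \<union> B) = \<mu> A + \<mu> B"
proof -
  obtain P N where PN: "P \<in> radon S" "N \<in> radon S"
    and \<mu>: "\<forall>A\<in>rc_borel S. \<mu> A = measure P A - measure N A"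
    using assms(1) by (auto simp: signed_radon_def)
  have "measure M (A \<union> B) = measure M A + measure M B" if M: "M \<in> radon S" for M
    using radon_rc_borel_finite[OF M assms(2) assms(3)] radon_rc_borel_finite[OF M assms(2) assms(4)]
      assms(5) by (intro measure_Union) (auto simp: less_top)
  then show ?thesis using \<mu> assms PN by simp
qed

lemma signed_radon_split:
  assumes "\<mu> \<in> signed_radon S" "open S" "A \<in> rc_borel S" "B \<in> sets borel"
  shows "\<mu> A = \<mu> (A \<inter> B) + \<mu> (A - B)"
proof -
  have e: "A \<inter> B \<union> (A - B) = A" by auto
  have "\<mu> (A \<inter> B \<union> (A - B)) = \<mu> (A \<inter> B) + \<mu> (A - B)"
    using assms by (intro signed_radon_Un[of _ S]) (auto simp: rc_borel_Int rc_borel_Diff e)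
  then show ?thesis unfolding e .
qed

lemma signed_radon_empty: "\<mu> \<in> signed_radon S \<Longrightarrow> \<mu> {} = 0"
  using compact_rc_borel[of "{}" S] by (auto simp: signed_radon_def)

text \<open>The shape copies that of \<open>total_variation\<close>, which becomes the sum of the
  two Jordan parts. The same sum also serves as a dominating measure for Radon-Nikodym
  densities.\<close>

definition add_measure :: "'a measure \<Rightarrow> 'a measure \<Rightarrow> 'a measure" where
  "add_measure M N = measure_of (space M) (sets M) (\<lambda>A. emeasure M A + emeasure N A)"

lemma sets_add_measure [simp]: "sets (add_measure M N) = sets M"
  by (simp add: add_measure_def sets.sigma_sets_eq)

lemma emeasure_add_measure:
  assumes "sets N = sets M" "A \<in> sets M"
  shows "emeasure (add_measure M N) A = emeasure M A + emeasure N A"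
proof (rule emeasure_measure_of[OF add_measure_def])
  show "countably_additive (sets (add_measure M N)) (\<lambda>A. emeasure M A + emeasure N A)"
  proof (rule countably_additiveI)
    fix B :: "nat \<Rightarrow> 'a set"
    assume B: "range B \<subseteq> sets (add_measure M N)" "disjoint_family B"
    then have "(\<Sum>i. emeasure M (B i)) = emeasure M (\<Union>i. B i)"
      "(\<Sum>i. emeasure N (B i)) = emeasure N (\<Union>i. B i)"
      using assms by (auto intro!: suminf_emeasure)
    then show "(\<Sum>i. emeasure M (B i) + emeasure N (B i)) = emeasure M (\<Union>i. B i) + emeasure N (\<Union>i. B i)"
      by (metis suminf_add summableI)
  qed
qed (use assms in \<open>auto simp: positive_def dest: sets.sets_into_space\<close>)

lemma add_measure_radon:
  assumes "M \<in> radon S" "N \<in> radon S" "open S"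
  shows "add_measure M N \<in> radon S"
proof (rule radonI)
  show "sets (add_measure M N) = sets (borel_on S)" using assms by (simp add: radon_sets)
  fix K assume "compact K" "K \<subseteq> S"
  then have K: "K \<in> rc_borel S" by (rule compact_rc_borel)
  have "sets N = sets M" using assms by (simp add: radon_sets)
  then show "emeasure (add_measure M N) K < \<infinity>"
    using radon_rc_borel_finite[OF assms(1,3) K] radon_rc_borel_finite[OF assms(2,3) K]
    by (simp add: emeasure_add_measure)
qed

lemma radon_mono:
  assumes "M \<in> radon S" "open S" "sets N = sets M" "\<And>A. A \<in> sets M \<Longrightarrow> emeasure N A \<le> emeasure M A"
  shows "N \<in> radon S"
proof (rule radonI)
  show "sets N = sets (borel_on S)" using assms by (simp add: radon_sets)
  fix K assume "compact K" "K \<subseteq> S"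
  then have "K \<in> rc_borel S" by (rule compact_rc_borel)
  then show "emeasure N K < \<infinity>"
    using radon_rc_borel_finite[OF assms(1,2)] assms(4) by (blast intro: le_less_trans)
qed

section \<open>Jordan decomposition\<close>

text \<open>Mutual singularity characterises the Jordan parts: the supremum defining
  \<open>pos_part\<close> never exceeds \<open>P\<close> because \<open>N\<close> is nonnegative,
  and it is approached on subsets of \<open>D\<close>, where \<open>N\<close> has no mass.\<close>

lemma pos_part_eqI:
  fixes S :: "'a::euclidean_space set"
  assumes P: "P \<in> radon S" and N: "N \<in> radon S" and S: "open S" and D: "D \<in> sets borel"
    and \<mu>: "\<And>A. A \<in> rc_borel S \<Longrightarrow> \<mu> A = measure P A - measure N A"
    and PD: "emeasure P (S - D) = 0" and ND: "emeasure N (S \<inter> D) = 0"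
  shows "pos_part S \<mu> = P"
proof -
  obtain C where C: "\<And>n. compact (C n)" "\<And>n. C n \<subseteq> S" "incseq C" "(\<Union>n. C n) = S"
    using compact_exhaustion[OF S] by metis
  have SUP: "(SUP B\<in>{B \<in> rc_borel S. B \<subseteq> A}. ennreal (\<mu> B)) = emeasure P A"
    if A: "A \<in> sets (borel_on S)" for A
  proof (rule antisym)
    have A': "A \<subseteq> S" "A \<in> sets borel" "A \<in> sets P"
      using A S P by (auto simp: sets_borel_on radon_sets)
    show "(SUP B\<in>{B \<in> rc_borel S. B \<subseteq> A}. ennreal (\<mu> B)) \<le> emeasure P A"
    proof (rule SUP_least)
      fix B assume B: "B \<in> {B \<in> rc_borel S. B \<subseteq> A}"
      then have "ennreal (\<mu> B) \<le> emeasure P B"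
        using \<mu> by (auto simp: radon_emeasure_eq[OF P S] intro!: ennreal_leI)
      also have "\<dots> \<le> emeasure P A" using B A' by (intro emeasure_mono) auto
      finally show "ennreal (\<mu> B) \<le> emeasure P A" .
    qed
    \<comment> \<open>The set \<open>A \<inter> D\<close> would be optimal but need not be
      relatively compact, so it is exhausted by its traces on the compact sets
      \<open>C n\<close>.\<close>
    have rc: "A \<inter> D \<inter> C n \<in> rc_borel S" for n
      using A' C D by (auto simp: rc_borel_def intro: borel_compact)
    have "emeasure P A = emeasure P (A \<inter> D) + emeasure P (A - D)"
      using A' D by (subst plus_emeasure) (auto simp: radon_sets_iff[OF P S] Int_Diff_Un)
    also have "emeasure P (A - D) \<le> emeasure P (S - D)"
      using A' D S by (intro emeasure_mono) (auto simp: radon_sets_iff[OF P S])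
    finally have "emeasure P A \<le> emeasure P (A \<inter> D)" using PD by (simp add: add_left_mono)
    also have "emeasure P (A \<inter> D) = emeasure P (\<Union>n. A \<inter> D \<inter> C n)"
      using C(4) A' by (intro arg_cong[of _ _ "emeasure P"]) auto
    also have "\<dots> = (SUP n. emeasure P (A \<inter> D \<inter> C n))"
      using rc radon_rc_borel_finite(1)[OF P S]
      by (intro SUP_emeasure_incseq[symmetric] monoI Int_mono order_refl monoD[OF C(3)]) auto
    also have "\<dots> \<le> (SUP B\<in>{B \<in> rc_borel S. B \<subseteq> A}. ennreal (\<mu> B))"
    proof (rule SUP_least)
      fix n
      have "emeasure N (A \<inter> D \<inter> C n) \<le> emeasure N (S \<inter> D)"
        using A' D S by (intro emeasure_mono) (auto simp: radon_sets_iff[OF N S])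
      then have "measure N (A \<inter> D \<inter> C n) = 0" using ND by (simp add: measure_def)
      then have "emeasure P (A \<inter> D \<inter> C n) = ennreal (\<mu> (A \<inter> D \<inter> C n))"
        using \<mu>[OF rc] by (simp add: radon_emeasure_eq[OF P S rc])
      also have "\<dots> \<le> (SUP B\<in>{B \<in> rc_borel S. B \<subseteq> A}. ennreal (\<mu> B))"
        using rc by (intro SUP_upper) auto
      finally show "emeasure P (A \<inter> D \<inter> C n) \<le> (SUP B\<in>{B \<in> rc_borel S. B \<subseteq> A}. ennreal (\<mu> B))" .
    qed
    finally show "emeasure P A \<le> (SUP B\<in>{B \<in> rc_borel S. B \<subseteq> A}. ennreal (\<mu> B))" .
  qed
  \<comment> \<open>\<open>measure_of\<close> depends only on the values on the sigma-algebra. Since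
    these agree with the values of the measure \<open>P\<close>, countable additivity of the
    supremum is inherited and not proved by hand.\<close>
  have "pos_part S \<mu> = measure_of (space P) (sets P) (emeasure P)"
    unfolding pos_part_def radon_space[OF P] radon_sets[OF P]
  proof (rule measure_of_eq)
    show "sets (borel_on S) \<subseteq> Pow S" using S by (auto simp: sets_borel_on)
    have "sigma_sets S (sets (borel_on S)) = sets (borel_on S)"
      using sets.sigma_sets_eq[of "borel_on S"] by (simp add: space_restrict_space)
    then show "(SUP B\<in>{B \<in> rc_borel S. B \<subseteq> A}. ennreal (\<mu> B)) = emeasure P A"
      if "A \<in> sigma_sets S (sets (borel_on S))" for A
      using SUP that by simp
  qed
  then show ?thesis by (simp add: measure_of_of_measure)
qed

lemma neg_part_eqI:
  fixes S :: "'a::euclidean_space set"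
  assumes P: "P \<in> radon S" and N: "N \<in> radon S" and S: "open S" and D: "D \<in> sets borel"
    and \<mu>: "\<And>A. A \<in> rc_borel S \<Longrightarrow> \<mu> A = measure P A - measure N A"
    and PD: "emeasure P (S - D) = 0" and ND: "emeasure N (S \<inter> D) = 0"
  shows "neg_part S \<mu> = N"
  unfolding neg_part_def
proof (rule pos_part_eqI[OF N P S, of "-D"])
  show "emeasure N (S - - D) = 0" using ND by (simp add: Diff_eq)
  show "emeasure P (S \<inter> - D) = 0" using PD by (simp add: Diff_eq)
qed (use \<mu> D in auto)

text \<open>The given \<open>P\<close> and \<open>N\<close> may overlap. Both have densities
  \<open>f\<close> and \<open>g\<close> with respect to their sum; the common part is removed
  pointwise, and the Hahn set is where \<open>g < f\<close>.\<close>

lemma jordan_decomposition: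
  fixes S :: "'a::euclidean_space set"
  assumes \<mu>: "\<mu> \<in> signed_radon S" and S: "open S"
  obtains D where "D \<in> sets borel" "pos_part S \<mu> \<in> radon S" "neg_part S \<mu> \<in> radon S"
    "\<And>A. A \<in> rc_borel S \<Longrightarrow> \<mu> A = measure (pos_part S \<mu>) A - measure (neg_part S \<mu>) A"
    "emeasure (pos_part S \<mu>) (S - D) = 0" "emeasure (neg_part S \<mu>) (S \<inter> D) = 0"
proof -
  obtain P N where P: "P \<in> radon S" and N: "N \<in> radon S"
    and \<mu>PN: "\<And>A. A \<in> rc_borel S \<Longrightarrow> \<mu> A = measure P A - measure N A"
    using \<mu> by (auto simp: signed_radon_def)
  define M where "M = add_measure P N"
  have M: "M \<in> radon S" unfolding M_def by (rule add_measure_radon[OF P N S])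
  have sets [simp]: "sets P = sets M" "sets N = sets M" using P N M by (auto simp: radon_sets)
  have emM: "emeasure M A = emeasure P A + emeasure N A" if "A \<in> sets M" for A
    using that unfolding M_def by (subst emeasure_add_measure) (auto simp: radon_sets[OF P] radon_sets[OF N])
  interpret M: sigma_finite_measure M by (rule radon_sigma_finite[OF M S])
  have "absolutely_continuous M P" "absolutely_continuous M N"
    unfolding absolutely_continuous_def by (auto simp: null_sets_def emM)
  with M.Radon_Nikodym[of P] M.Radon_Nikodym[of N] obtain f g
    where f: "f \<in> borel_measurable M" "density M f = P"
      and g: "g \<in> borel_measurable M" "density M g = N" by auto
  \<comment> \<open>In \<open>ennreal\<close> one has \<open>\<infinity> - \<infinity> = \<infinity>\<close>, so the plain difference of the densities would not do.\<close>
  define d :: "ennreal \<Rightarrow> ennreal \<Rightarrow> ennreal" where "d a b = (if b < a then a - b else 0)" for a b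
  define P' where "P' = density M (\<lambda>x. d (f x) (g x))"
  define N' where "N' = density M (\<lambda>x. d (g x) (f x))"
  have [measurable]: "f \<in> borel_measurable M" "g \<in> borel_measurable M" using f g by auto
  have [measurable]: "(\<lambda>x. d (f x) (g x)) \<in> borel_measurable M" "(\<lambda>x. d (g x) (f x)) \<in> borel_measurable M"
    unfolding d_def by measurable
  have eP: "emeasure P A = (\<integral>\<^sup>+x. f x * indicator A x \<partial>M)"
    and eN: "emeasure N A = (\<integral>\<^sup>+x. g x * indicator A x \<partial>M)"
    and eP': "emeasure P' A = (\<integral>\<^sup>+x. d (f x) (g x) * indicator A x \<partial>M)"
    and eN': "emeasure N' A = (\<integral>\<^sup>+x. d (g x) (f x) * indicator A x \<partial>M)"
    if "A \<in> sets M" for A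
    using that f(2) g(2) by (auto simp: P'_def N'_def emeasure_density[symmetric])
  \<comment> \<open>Both sides are \<open>max a b\<close>. Stating the identity with sums avoids
    cancellation, which fails in \<open>ennreal\<close> at infinity; subtraction happens only later,
    on the real values of relatively compact sets.\<close>
  have max: "d a b + b = d b a + a" for a b :: ennreal
    unfolding d_def by (cases a; cases b) (auto simp: ennreal_minus_if ennreal_less_iff ennreal_plus[symmetric] simp del: ennreal_plus)
  have sum: "emeasure P' A + emeasure N A = emeasure N' A + emeasure P A" if "A \<in> sets M" for A
    using that by (simp add: eP eN eP' eN' nn_integral_add[symmetric] distrib_right[symmetric] max)
  have le: "emeasure P' A \<le> emeasure P A" "emeasure N' A \<le> emeasure N A" if "A \<in> sets M" for A
    using that by (auto simp: eP eN eP' eN' intro!: nn_integral_mono mult_right_mono diff_le_self_ennreal simp: d_def)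
  have [simp]: "sets P' = sets M" "sets N' = sets M" by (auto simp: P'_def N'_def)
  have P': "P' \<in> radon S" and N': "N' \<in> radon S"
    using le by (auto intro: radon_mono[OF P S] radon_mono[OF N S])
  have eq: "\<mu> A = measure P' A - measure N' A" if A: "A \<in> rc_borel S" for A
  proof -
    have "ennreal (measure P' A + measure N A) = ennreal (measure N' A + measure P A)"
      using sum[OF radon_rc_borel_finite(1)[OF M S A]]
      by (simp add: radon_emeasure_eq[OF P S A] radon_emeasure_eq[OF N S A]
        radon_emeasure_eq[OF P' S A] radon_emeasure_eq[OF N' S A])
    then have "measure P' A + measure N A = measure N' A + measure P A"
      by (subst (asm) ennreal_inj) (auto intro: add_nonneg_nonneg)
    then show ?thesis using \<mu>PN[OF A] by simp
  qed
  define D where "D = {x \<in> space M. g x < f x}"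
  have D: "D \<in> sets M" unfolding D_def by measurable
  then have D': "D \<in> sets borel" "D \<subseteq> S" using radon_sets_iff[OF M S] by auto
  have SM: "S \<in> sets M" using radon_sets_iff[OF M S] S by auto
  have "emeasure P' (S - D) = (\<integral>\<^sup>+x. 0 \<partial>M)"
    using D SM unfolding eP'[OF sets.Diff[OF SM D]]
    by (intro nn_integral_cong) (auto simp: D_def d_def indicator_def)
  then have PD: "emeasure P' (S - D) = 0" by simp
  have "emeasure N' (S \<inter> D) = (\<integral>\<^sup>+x. 0 \<partial>M)"
    using D SM unfolding eN'[OF sets.Int[OF SM D]]
    by (intro nn_integral_cong) (auto simp: D_def d_def indicator_def)
  then have ND: "emeasure N' (S \<inter> D) = 0" by simp
  show thesis
    using that[OF D'(1)] P' N' eq PD ND pos_part_eqI[OF P' N' S D'(1) eq PD ND]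
      neg_part_eqI[OF P' N' S D'(1) eq PD ND] by simp
qed

lemma pos_part_radon: "\<mu> \<in> signed_radon S \<Longrightarrow> open S \<Longrightarrow> pos_part S \<mu> \<in> radon S"
  and neg_part_radon: "\<mu> \<in> signed_radon S \<Longrightarrow> open S \<Longrightarrow> neg_part S \<mu> \<in> radon S"
  and jordan_eq: "\<mu> \<in> signed_radon S \<Longrightarrow> open S \<Longrightarrow> A \<in> rc_borel S \<Longrightarrow>
    \<mu> A = measure (pos_part S \<mu>) A - measure (neg_part S \<mu>) A"
  and hahn_set: "\<mu> \<in> signed_radon S \<Longrightarrow> open S \<Longrightarrow>
    \<exists>D\<in>sets borel. emeasure (pos_part S \<mu>) (S - D) = 0 \<and> emeasure (neg_part S \<mu>) (S \<inter> D) = 0"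
  using jordan_decomposition by metis+

lemma pos_part_cong:
  "(\<And>A. A \<in> rc_borel S \<Longrightarrow> \<mu> A = \<nu> A) \<Longrightarrow> pos_part S \<mu> = pos_part S \<nu>"
  unfolding pos_part_def by (intro arg_cong[of _ _ "measure_of S (sets (borel_on S))"] ext SUP_cong) auto

lemma neg_part_cong:
  "(\<And>A. A \<in> rc_borel S \<Longrightarrow> \<mu> A = \<nu> A) \<Longrightarrow> neg_part S \<mu> = neg_part S \<nu>"
  unfolding neg_part_def by (rule pos_part_cong) simp

text \<open>\<open>radon_le\<close> asks for one Radon measure that represents the difference on all
  relatively compact sets. The positive part of \<open>N - M\<close> is this measure once the
  negative part is seen to vanish: off the Hahn set the difference equals minus the negative part,
  yet it is nonnegative by assumption.\<close>

lemma radon_le_measureI: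
  fixes S :: "'a::euclidean_space set"
  assumes M: "M \<in> radon S" and N: "N \<in> radon S" and S: "open S"
    and le: "\<And>A. A \<in> rc_borel S \<Longrightarrow> measure M A \<le> measure N A"
  shows "radon_le S (measure M) (measure N)"
proof -
  let ?\<delta> = "\<lambda>A. measure N A - measure M A"
  have \<delta>: "?\<delta> \<in> signed_radon S" by (rule signed_radon_diff[OF N M])
  obtain D where D: "D \<in> sets borel"
    and PD: "emeasure (pos_part S ?\<delta>) (S - D) = 0" and ND: "emeasure (neg_part S ?\<delta>) (S \<inter> D) = 0"
    using hahn_set[OF \<delta> S] by blast
  note eq = jordan_eq[OF \<delta> S]
  have neg: "neg_part S ?\<delta> = null_measure (borel_on S)"
  proof (rule radon_measure_eqI[OF neg_part_radon[OF \<delta> S] null_measure_radon S])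
    fix A assume A: "A \<in> rc_borel S"
    note rs = radon_sets_iff[OF pos_part_radon[OF \<delta> S] S] radon_sets_iff[OF neg_part_radon[OF \<delta> S] S]
    have AD: "A - D \<in> rc_borel S" by (rule rc_borel_Diff[OF A D])
    have "emeasure (pos_part S ?\<delta>) (A - D) \<le> emeasure (pos_part S ?\<delta>) (S - D)"
      using D S rc_borel_sets[OF A] by (intro emeasure_mono) (auto simp: rs)
    then have "measure (pos_part S ?\<delta>) (A - D) = 0" using PD by (simp add: measure_def)
    then have "measure (neg_part S ?\<delta>) (A - D) \<le> 0"
      using eq[OF AD] le[OF AD] by simp
    then have "emeasure (neg_part S ?\<delta>) (A - D) = 0"
      using radon_emeasure_eq[OF neg_part_radon[OF \<delta> S] S AD] by (simp add: ennreal_neg)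
    moreover have "emeasure (neg_part S ?\<delta>) (A \<inter> D) \<le> emeasure (neg_part S ?\<delta>) (S \<inter> D)"
      using D S rc_borel_sets[OF A] by (intro emeasure_mono) (auto simp: rs)
    moreover have "emeasure (neg_part S ?\<delta>) A =
        emeasure (neg_part S ?\<delta>) (A \<inter> D) + emeasure (neg_part S ?\<delta>) (A - D)"
      using D rc_borel_sets[OF A] by (subst plus_emeasure) (auto simp: rs Int_Diff_Un)
    ultimately show "emeasure (neg_part S ?\<delta>) A = emeasure (null_measure (borel_on S)) A"
      using ND by simp
  qed
  then have "\<forall>A\<in>rc_borel S. measure N A - measure M A = measure (pos_part S ?\<delta>) A"
    using eq unfolding neg by simp
  then show ?thesis
    unfolding radon_le_def using pos_part_radon[OF \<delta> S] measure_signed_radon M N by blast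
qed

section \<open>Lebesgue decomposition\<close>

abbreviation lborel_on :: "'a::euclidean_space set \<Rightarrow> 'a measure" where
  "lborel_on S \<equiv> restrict_space lborel S"

lemma lborel_on_radon:
  fixes S :: "'a::euclidean_space set"
  assumes "open S"
  shows "lborel_on S \<in> radon S"
proof (rule radonI)
  show "sets (lborel_on S) = sets (borel_on S)"
    by (simp add: sets_restrict_space)
  fix K :: "'a set" assume "compact K" "K \<subseteq> S"
  then show "emeasure (lborel_on S) K < \<infinity>"
    using assms by (subst emeasure_restrict_space) (auto intro: emeasure_compact_finite[unfolded infinity_ennreal_def])
qed

lemma emeasure_lborel_on: "open S \<Longrightarrow> A \<subseteq> S \<Longrightarrow> emeasure (lborel_on S) A = emeasure lborel A"
  by (subst emeasure_restrict_space) auto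

lemma null_sets_lborel_on:
  "open S \<Longrightarrow> A \<in> null_sets (lborel_on S) \<longleftrightarrow> A \<subseteq> S \<and> A \<in> null_sets lborel"
  by (subst null_sets_restrict_space) auto

text \<open>\<open>Z\<close> is the zero set of the density of Lebesgue measure with respect to
  \<open>M\<close> plus Lebesgue measure. On a Lebesgue-null set this density vanishes almost
  everywhere for the sum, so \<open>M\<close> charges nothing there outside
  \<open>Z\<close>.\<close>

lemma lebesgue_carrier:
  fixes S :: "'a::euclidean_space set"
  assumes M: "M \<in> radon S" and S: "open S"
  obtains Z where "Z \<in> null_sets lborel"
    "\<And>A. A \<in> sets M \<Longrightarrow> A \<in> null_sets lborel \<Longrightarrow> emeasure M (A - Z) = 0"
proof -
  let ?L = "lborel_on S"
  note L = lborel_on_radon[OF S]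
  define B where "B = add_measure M ?L"
  have B: "B \<in> radon S" unfolding B_def by (rule add_measure_radon[OF M L S])
  have sets [simp]: "sets M = sets B" "sets ?L = sets B" by (simp_all add: radon_sets[OF M] radon_sets[OF L] radon_sets[OF B])
  have emB: "emeasure B A = emeasure M A + emeasure ?L A" if "A \<in> sets B" for A
    using that unfolding B_def by (subst emeasure_add_measure) (auto simp: radon_sets[OF M] radon_sets[OF L])
  interpret B: sigma_finite_measure B by (rule radon_sigma_finite[OF B S])
  have "absolutely_continuous B ?L"
    unfolding absolutely_continuous_def by (auto simp: null_sets_def emB)
  with B.Radon_Nikodym[of ?L] obtain h where h[measurable]: "h \<in> borel_measurable B" and Bh: "density B h = ?L"
    by auto
  define Z where "Z = {x \<in> space B. h x = 0}"
  have Z: "Z \<in> sets B" unfolding Z_def by measurable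
  then have ZS: "Z \<subseteq> S" "Z \<in> sets borel" using radon_sets_iff[OF B S] by auto
  have LA: "emeasure ?L A = (\<integral>\<^sup>+x. h x * indicator A x \<partial>B)" if "A \<in> sets B" for A
    using that by (simp add: Bh[symmetric] emeasure_density)
  have "emeasure ?L Z = (\<integral>\<^sup>+x. 0 \<partial>B)"
    unfolding LA[OF Z] by (intro nn_integral_cong) (auto simp: Z_def indicator_def)
  then have Z0: "Z \<in> null_sets lborel"
    using ZS S by (auto simp: null_sets_def emeasure_lborel_on)
  show thesis
  proof (rule that[OF Z0])
    fix A assume A: "A \<in> sets M" "A \<in> null_sets lborel"
    then have A': "A \<in> sets B" "A \<subseteq> S" using radon_sets_iff[OF M S] by auto
    have "emeasure ?L A = 0" using A A' S by (simp add: emeasure_lborel_on null_sets_def)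
    then have "AE x in B. h x * indicator A x = 0"
      using A' unfolding LA[OF A'(1)] by (subst (asm) nn_integral_0_iff_AE) auto
    then have "AE x in B. x \<notin> A - Z"
      by (rule AE_mp) (auto simp: Z_def indicator_def intro!: AE_I2 split: if_splits)
    then have "emeasure B (A - Z) = 0"
      using A' Z by (subst (asm) AE_iff_measurable[of "A - Z"]) (auto dest: sets.sets_into_space)
    then show "emeasure M (A - Z) = 0" using A' Z by (subst (asm) emB) auto
  qed
qed

text \<open>One null set serves both Jordan parts. The singular part is then the restriction
  \<open>\<mu> (A \<inter> Z)\<close>, a form that passes to time slices by taking sections of
  \<open>Z\<close>.\<close>

definition carries_sing :: "'a::euclidean_space set \<Rightarrow> ('a set \<Rightarrow> real) \<Rightarrow> 'a set \<Rightarrow> bool" where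
  "carries_sing S \<mu> Z \<longleftrightarrow> Z \<in> null_sets lborel \<and>
     (\<forall>A\<in>sets (borel_on S). A \<in> null_sets lborel \<longrightarrow>
        emeasure (pos_part S \<mu>) (A - Z) = 0 \<and> emeasure (neg_part S \<mu>) (A - Z) = 0)"

lemma carries_sing_ex:
  fixes S :: "'a::euclidean_space set"
  assumes \<mu>: "\<mu> \<in> signed_radon S" and S: "open S"
  shows "\<exists>Z. carries_sing S \<mu> Z"
proof -
  note P = pos_part_radon[OF assms] and N = neg_part_radon[OF assms]
  let ?M = "add_measure (pos_part S \<mu>) (neg_part S \<mu>)"
  obtain Z where Z: "Z \<in> null_sets lborel"
    "\<And>A. A \<in> sets ?M \<Longrightarrow> A \<in> null_sets lborel \<Longrightarrow> emeasure ?M (A - Z) = 0"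
    using lebesgue_carrier[OF add_measure_radon[OF P N S] S] by metis
  have "emeasure (pos_part S \<mu>) (A - Z) = 0 \<and> emeasure (neg_part S \<mu>) (A - Z) = 0"
    if A: "A \<in> sets (borel_on S)" "A \<in> null_sets lborel" for A
  proof -
    have "A \<subseteq> S" "A \<in> sets borel" using A S by (auto simp: sets_borel_on)
    then have "A - Z \<in> sets (pos_part S \<mu>)" using Z(1) by (auto simp: radon_sets_iff[OF P S])
    then show ?thesis
      using Z(2)[OF _ A(2)] A(1)
      by (simp add: emeasure_add_measure radon_sets[OF P] radon_sets[OF N])
  qed
  then show ?thesis using Z(1) by (auto simp: carries_sing_def)
qed

lemma carries_sing_borel: "carries_sing S \<mu> Z \<Longrightarrow> Z \<in> sets borel"
  by (auto simp: carries_sing_def)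

lemma carries_sing_null:
  fixes S :: "'a::euclidean_space set"
  assumes \<mu>: "\<mu> \<in> signed_radon S" and S: "open S" and Z: "carries_sing S \<mu> Z"
    and A: "A \<in> rc_borel S" "A \<in> null_sets lborel"
  shows "\<mu> (A - Z) = 0"
proof -
  have "A \<in> sets (borel_on S)" using rc_borel_sets[OF A(1)] S by (simp add: sets_borel_on)
  then have "measure (pos_part S \<mu>) (A - Z) = 0" "measure (neg_part S \<mu>) (A - Z) = 0"
    using Z A by (auto simp: carries_sing_def measure_def)
  then show ?thesis
    using jordan_eq[OF \<mu> S rc_borel_Diff[OF A(1) carries_sing_borel[OF Z]]] by simp
qed

lemma lebesgue_decomp_ex:
  fixes S :: "'a::euclidean_space set"
  assumes \<mu>: "\<mu> \<in> signed_radon S" and S: "open S" and Z: "carries_sing S \<mu> Z"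
  shows "is_lebesgue_decomp S \<mu> (\<lambda>A. \<mu> (A - Z)) (\<lambda>A. \<mu> (A \<inter> Z))"
  unfolding is_lebesgue_decomp_def
proof (intro conjI ballI impI)
  have Zb: "Z \<in> sets borel" "Z \<in> null_sets lborel" using Z by (auto simp: carries_sing_def)
  have "(\<lambda>A. \<mu> (A \<inter> - Z)) \<in> signed_radon S"
    using Zb by (intro signed_radon_restr[OF \<mu> S]) auto
  then show "(\<lambda>A. \<mu> (A - Z)) \<in> signed_radon S" by (simp add: Diff_eq)
  show "(\<lambda>A. \<mu> (A \<inter> Z)) \<in> signed_radon S" by (rule signed_radon_restr[OF \<mu> S Zb(1)])
  show "\<mu> A = \<mu> (A - Z) + \<mu> (A \<inter> Z)" if "A \<in> rc_borel S" for A
    using signed_radon_split[OF \<mu> S that Zb(1)] by simp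
  show "\<mu> (A - Z) = 0" if "A \<in> rc_borel S" "A \<in> null_sets lborel" for A
    by (rule carries_sing_null[OF assms that])
  show "\<exists>Z'\<in>null_sets lborel. \<forall>A\<in>rc_borel S. \<mu> (A \<inter> Z) = \<mu> (A \<inter> Z' \<inter> Z)"
    using Zb by (intro bexI[of _ Z]) (auto simp: Int_assoc)
qed

text \<open>The two carriers are compared on their intersection: \<open>Z\<close> absorbs all mass
  on null sets, \<open>Z'\<close> carries \<sigma>, and both \<open>\<sigma> A\<close> and
  \<open>\<mu> (A \<inter> Z)\<close> equal \<open>\<mu> (A \<inter> Z \<inter> Z')\<close>.\<close>

lemma lebesgue_decomp_unique:
  fixes S :: "'a::euclidean_space set"
  assumes \<mu>: "\<mu> \<in> signed_radon S" and S: "open S" and Z: "carries_sing S \<mu> Z"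
    and d: "is_lebesgue_decomp S \<mu> \<alpha> \<sigma>" and A: "A \<in> rc_borel S"
  shows "\<alpha> A = \<mu> (A - Z)" "\<sigma> A = \<mu> (A \<inter> Z)"
proof -
  have Zb: "Z \<in> sets borel" "Z \<in> null_sets lborel" using Z by (auto simp: carries_sing_def)
  have sum: "\<And>A. A \<in> rc_borel S \<Longrightarrow> \<mu> A = \<alpha> A + \<sigma> A"
    and ac: "\<And>A. A \<in> rc_borel S \<Longrightarrow> A \<in> null_sets lborel \<Longrightarrow> \<alpha> A = 0"
    and \<sigma>: "\<sigma> \<in> signed_radon S"
    using d by (auto simp: is_lebesgue_decomp_def)
  obtain Z' where Z': "Z' \<in> null_sets lborel" "\<And>A. A \<in> rc_borel S \<Longrightarrow> \<sigma> A = \<sigma> (A \<inter> Z')"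
    using d unfolding is_lebesgue_decomp_def by blast
  have Z'b: "Z' \<in> sets borel" using Z'(1) by auto
  note rc1 = rc_borel_Int[OF A Z'b] and rc2 = rc_borel_Int[OF A Zb(1)]
  have null_Int: "B \<inter> N \<in> null_sets lborel" if "N \<in> null_sets lborel" "B \<in> sets borel" for B N :: "'a set"
    using null_set_Int2[OF that(1), of B] that by (simp add: Int_commute)
  have Ab: "A \<in> sets borel" using rc_borel_sets[OF A] by simp
  have "\<sigma> A = \<mu> (A \<inter> Z')"
    using Z'(2)[OF A] sum[OF rc1] ac[OF rc1 null_Int[OF Z'(1) Ab]] by simp
  also have "\<dots> = \<mu> (A \<inter> Z' \<inter> Z)"
    using signed_radon_split[OF \<mu> S rc1 Zb(1)] carries_sing_null[OF \<mu> S Z rc1 null_Int[OF Z'(1) Ab]] by simp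
  also have "\<dots> = \<mu> (A \<inter> Z \<inter> Z')" by (simp add: Int_ac)
  also have "\<dots> = \<mu> (A \<inter> Z)"
  proof -
    have rc3: "A \<inter> Z - Z' \<in> rc_borel S" by (rule rc_borel_Diff[OF rc2 Z'b])
    have n3: "A \<inter> Z - Z' \<in> null_sets lborel"
      using null_set_Diff[OF null_Int[OF Zb(2) Ab], of Z'] Z'b by simp
    have "\<sigma> (A \<inter> Z - Z') = \<sigma> ((A \<inter> Z - Z') \<inter> Z')" by (rule Z'(2)[OF rc3])
    also have "(A \<inter> Z - Z') \<inter> Z' = {}" by auto
    finally have "\<mu> (A \<inter> Z - Z') = 0"
      using sum[OF rc3] ac[OF rc3 n3] signed_radon_empty[OF \<sigma>] by simp
    then show ?thesis using signed_radon_split[OF \<mu> S rc2 Z'b] by simp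
  qed
  finally show "\<sigma> A = \<mu> (A \<inter> Z)" .
  then show "\<alpha> A = \<mu> (A - Z)"
    using sum[OF A] signed_radon_split[OF \<mu> S A Zb(1)] by simp
qed

text \<open>Existence makes the \<open>SOME\<close> in the two definitions satisfiable, and
  uniqueness evaluates whatever it selects.\<close>

lemma
  fixes S :: "'a::euclidean_space set"
  assumes \<mu>: "\<mu> \<in> signed_radon S" and S: "open S" and Z: "carries_sing S \<mu> Z"
  shows sing_part_eq: "A \<in> rc_borel S \<Longrightarrow> sing_part S \<mu> A = \<mu> (A \<inter> Z)"
    and ac_part_eq: "A \<in> rc_borel S \<Longrightarrow> ac_part S \<mu> A = \<mu> (A - Z)"
proof -
  have ex: "\<exists>\<alpha> \<sigma>. is_lebesgue_decomp S \<mu> \<alpha> \<sigma>" using lebesgue_decomp_ex[OF assms] by blast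
  have "\<exists>\<sigma> \<alpha>. is_lebesgue_decomp S \<mu> \<alpha> \<sigma>" using ex by blast
  from someI_ex[OF this] have "\<exists>\<alpha>. is_lebesgue_decomp S \<mu> \<alpha> (sing_part S \<mu>)"
    unfolding sing_part_def .
  then show "sing_part S \<mu> A = \<mu> (A \<inter> Z)" if "A \<in> rc_borel S"
    using lebesgue_decomp_unique[OF assms _ that] by blast
  from someI_ex[OF ex] have "\<exists>\<sigma>. is_lebesgue_decomp S \<mu> (ac_part S \<mu>) \<sigma>"
    unfolding ac_part_def .
  then show "ac_part S \<mu> A = \<mu> (A - Z)" if "A \<in> rc_borel S"
    using lebesgue_decomp_unique[OF assms _ that] by blast
qed

text \<open>A Hahn set of \<mu> is also one for the restriction to \<open>Z\<close>, because smaller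
  measures keep its null sets. Hence Jordan parts commute with restriction.\<close>

lemma
  fixes S :: "'a::euclidean_space set"
  assumes \<mu>: "\<mu> \<in> signed_radon S" and S: "open S" and Z: "Z \<in> sets borel"
  shows pos_part_restr: "pos_part S (\<lambda>A. \<mu> (A \<inter> Z)) = restr (pos_part S \<mu>) Z"
    and neg_part_restr: "neg_part S (\<lambda>A. \<mu> (A \<inter> Z)) = restr (neg_part S \<mu>) Z"
proof -
  note P = pos_part_radon[OF \<mu> S] and N = neg_part_radon[OF \<mu> S]
  obtain D where D: "D \<in> sets borel" and PD: "emeasure (pos_part S \<mu>) (S - D) = 0"
    and ND: "emeasure (neg_part S \<mu>) (S \<inter> D) = 0" using hahn_set[OF \<mu> S] by blast
  have PD': "emeasure (restr (pos_part S \<mu>) Z) (S - D) = 0"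
    using emeasure_mono[of "(S - D) \<inter> Z" "S - D" "pos_part S \<mu>"] D Z S PD
    by (subst emeasure_restr[OF P S Z]) (auto simp: radon_sets_iff[OF P S])
  have ND': "emeasure (restr (neg_part S \<mu>) Z) (S \<inter> D) = 0"
    using emeasure_mono[of "S \<inter> D \<inter> Z" "S \<inter> D" "neg_part S \<mu>"] D Z S ND
    by (subst emeasure_restr[OF N S Z]) (auto simp: radon_sets_iff[OF N S])
  have eq: "\<mu> (A \<inter> Z) = measure (restr (pos_part S \<mu>) Z) A - measure (restr (neg_part S \<mu>) Z) A"
    if A: "A \<in> rc_borel S" for A
    using measure_restr[OF P S Z radon_rc_borel_finite(1)[OF P S A]]
      measure_restr[OF N S Z radon_rc_borel_finite(1)[OF N S A]]
      jordan_eq[OF \<mu> S rc_borel_Int[OF A Z]] by simp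
  note RP = restr_radon[OF P S Z] and RN = restr_radon[OF N S Z]
  show "pos_part S (\<lambda>A. \<mu> (A \<inter> Z)) = restr (pos_part S \<mu>) Z"
    by (rule pos_part_eqI[OF RP RN S D eq PD' ND'])
  show "neg_part S (\<lambda>A. \<mu> (A \<inter> Z)) = restr (neg_part S \<mu>) Z"
    by (rule neg_part_eqI[OF RP RN S D eq PD' ND'])
qed

lemma
  fixes S :: "'a::euclidean_space set"
  assumes \<mu>: "\<mu> \<in> signed_radon S" and S: "open S" and Z: "carries_sing S \<mu> Z"
  shows sing_part_signed_radon: "sing_part S \<mu> \<in> signed_radon S"
    and pos_part_sing_part: "pos_part S (sing_part S \<mu>) = restr (pos_part S \<mu>) Z"
    and neg_part_sing_part: "neg_part S (sing_part S \<mu>) = restr (neg_part S \<mu>) Z"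
proof -
  note Zb = carries_sing_borel[OF Z]
  show "sing_part S \<mu> \<in> signed_radon S"
    by (rule signed_radon_cong[OF signed_radon_restr[OF \<mu> S Zb] sing_part_eq[OF assms]])
  show "pos_part S (sing_part S \<mu>) = restr (pos_part S \<mu>) Z"
    unfolding pos_part_restr[OF \<mu> S Zb, symmetric] by (rule pos_part_cong[OF sing_part_eq[OF assms]])
  show "neg_part S (sing_part S \<mu>) = restr (neg_part S \<mu>) Z"
    unfolding neg_part_restr[OF \<mu> S Zb, symmetric] by (rule neg_part_cong[OF sing_part_eq[OF assms]])
qed

text \<open>Sigma-finiteness of \<open>M\<close> forces the Radon-Nikodym density to be finite
  almost everywhere, so a real function can replace it.\<close>

lemma radon_density:
  fixes S :: "'a::euclidean_space set"
  assumes M: "M \<in> radon S" and S: "open S"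
    and ac: "\<And>A. A \<in> sets M \<Longrightarrow> A \<in> null_sets lborel \<Longrightarrow> emeasure M A = 0"
  obtains f :: "'a \<Rightarrow> real" where "f \<in> borel_measurable borel" "\<And>x. 0 \<le> f x"
    "M = density (lborel_on S) (\<lambda>x. ennreal (f x))"
proof -
  note L = lborel_on_radon[OF S]
  interpret L: sigma_finite_measure "lborel_on S" by (rule radon_sigma_finite[OF L S])
  have sets: "sets M = sets (lborel_on S)" using radon_sets[OF M] radon_sets[OF L] by simp
  have "absolutely_continuous (lborel_on S) M"
    unfolding absolutely_continuous_def
  proof
    fix A assume A: "A \<in> null_sets (lborel_on S)"
    then have "A \<in> sets M" "A \<in> null_sets lborel"
      using sets null_sets_lborel_on[OF S, of A] by auto
    then show "A \<in> null_sets M" using ac by auto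
  qed
  with L.Radon_Nikodym[OF _ sets] obtain h where h: "h \<in> borel_measurable (lborel_on S)"
    and Mh: "density (lborel_on S) h = M" by auto
  have "sigma_finite_measure (density (lborel_on S) h)"
    unfolding Mh by (rule radon_sigma_finite[OF M S])
  then have fin: "AE x in lborel_on S. h x \<noteq> \<infinity>"
    using L.sigma_finite_iff_density_finite[OF h] by simp
  \<comment> \<open>Extension by 0 makes \<open>f\<close> Borel on the whole space; the value of
    \<open>enn2real\<close> at infinity matters only on a null set.\<close>
  define f where "f x = (if x \<in> S then enn2real (h x) else 0)" for x
  have "(\<lambda>x. enn2real (h x)) \<in> borel_measurable (restrict_space borel S)"
    using measurable_compose[OF h borel_measurable_enn2real] radon_sets[OF L]
    by (simp cong: measurable_cong_sets)
  then have f: "f \<in> borel_measurable borel"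
    unfolding f_def using S by (subst (asm) measurable_restrict_space_iff[where c = 0]) auto
  have "M = density (lborel_on S) (\<lambda>x. ennreal (f x))"
    unfolding Mh[symmetric]
  proof (rule density_cong[OF h])
    show "(\<lambda>x. ennreal (f x)) \<in> borel_measurable (lborel_on S)"
      using radon_measurable[OF f L] by simp
    show "AE x in lborel_on S. h x = ennreal (f x)"
      using fin by (rule AE_mp) (auto simp: f_def space_restrict_space less_top)
  qed
  then show thesis using that[of f] f by (auto simp: f_def)
qed

lemma nn_integral_density_on:
  fixes S :: "'a::euclidean_space set" and f :: "'a \<Rightarrow> ennreal"
  assumes S: "open S" and f: "f \<in> borel_measurable borel" and g: "g \<in> borel_measurable borel"
  shows "(\<integral>\<^sup>+x. g x \<partial>density (lborel_on S) f) = (\<integral>\<^sup>+x. f x * g x * indicator S x \<partial>lborel)"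
  using S radon_measurable[OF f lborel_on_radon[OF S]] radon_measurable[OF g lborel_on_radon[OF S]]
  by (subst nn_integral_density) (auto simp: nn_integral_restrict_space)

lemma
  fixes S :: "'a::euclidean_space set" and f :: "'a \<Rightarrow> real"
  assumes S: "open S" and f: "f \<in> borel_measurable borel" "\<And>x. 0 \<le> f x"
    and M: "M = density (lborel_on S) (\<lambda>x. ennreal (f x))"
    and A: "A \<subseteq> S" "A \<in> sets borel" "emeasure M A < \<infinity>"
  shows set_integrable_density_on: "set_integrable lborel A f"
    and measure_density_on: "measure M A = (LINT x:A|lborel. f x)"
proof -
  have nn: "emeasure M A = (\<integral>\<^sup>+x. ennreal (indicator A x * f x) \<partial>lborel)"
  proof -
    have "emeasure M A = (\<integral>\<^sup>+x. indicator A x \<partial>M)"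
      using A S by (intro nn_integral_indicator[symmetric]) (simp add: M sets_restrict_space_iff)
    also have "\<dots> = (\<integral>\<^sup>+x. ennreal (f x) * indicator A x * indicator S x \<partial>lborel)"
      using A f unfolding M by (intro nn_integral_density_on[OF S]) auto
    also have "\<dots> = (\<integral>\<^sup>+x. ennreal (indicator A x * f x) \<partial>lborel)"
      using A by (intro nn_integral_cong) (auto simp: indicator_def)
    finally show ?thesis .
  qed
  show int: "set_integrable lborel A f"
    unfolding set_integrable_def using A f nn by (intro integrableI_nonneg) auto
  show "measure M A = (LINT x:A|lborel. f x)"
    unfolding set_lebesgue_integral_def measure_def nn
    using A f by (subst integral_eq_nn_integral) auto
qed

lemma set_integral_nonneg_eq_0:
  fixes f :: "'a::euclidean_space \<Rightarrow> real"
  assumes "set_integrable lborel A f" "(LINT x:A|lborel. f x) = 0" "\<And>x. x \<in> A \<Longrightarrow> 0 \<le> f x"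
  shows "AE x in lborel. x \<in> A \<longrightarrow> f x = 0"
proof -
  have "AE x in lborel. indicator A x *\<^sub>R f x = 0"
    using assms unfolding set_integrable_def set_lebesgue_integral_def
    by (subst (asm) integral_nonneg_eq_0_iff_AE) (auto simp: indicator_def)
  then show ?thesis by (rule AE_mp) (auto simp: indicator_def)
qed

text \<open>On the set where one function lies strictly below the other, the difference is positive
  with integral 0, so the set is null. Cutting it with compact sets keeps both integrals
  finite.\<close>

lemma locally_integrable_AE_eq:
  fixes S :: "'a::euclidean_space set" and f g :: "'a \<Rightarrow> real"
  assumes S: "open S" and [measurable]: "f \<in> borel_measurable borel" "g \<in> borel_measurable borel"
    and f: "\<And>K. compact K \<Longrightarrow> K \<subseteq> S \<Longrightarrow> set_integrable lborel K f"
    and g: "\<And>K. compact K \<Longrightarrow> K \<subseteq> S \<Longrightarrow> set_integrable lborel K g"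
    and eq: "\<And>A. A \<in> rc_borel S \<Longrightarrow> (LINT x:A|lborel. f x) = (LINT x:A|lborel. g x)"
  shows "AE x in lborel. x \<in> S \<longrightarrow> f x = g x"
proof -
  obtain C where C: "\<And>n. compact (C n)" "\<And>n. C n \<subseteq> S" "incseq C" "(\<Union>n. C n) = S"
    using compact_exhaustion[OF S] by metis
  have *: "AE x in lborel. x \<in> C n \<longrightarrow> \<not> h1 x < h2 x"
    if [measurable]: "h1 \<in> borel_measurable borel" "h2 \<in> borel_measurable borel"
      and h1: "\<And>K. compact K \<Longrightarrow> K \<subseteq> S \<Longrightarrow> set_integrable lborel K h1"
      and h2: "\<And>K. compact K \<Longrightarrow> K \<subseteq> S \<Longrightarrow> set_integrable lborel K h2"
      and eq: "\<And>A. A \<in> rc_borel S \<Longrightarrow> (LINT x:A|lborel. h1 x) = (LINT x:A|lborel. h2 x)"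
    for n and h1 h2 :: "'a \<Rightarrow> real"
  proof -
    have "{x \<in> space borel. h1 x < h2 x} \<in> sets borel" by measurable
    then have A: "C n \<inter> {x. h1 x < h2 x} \<in> rc_borel S"
      using compact_rc_borel[OF C(1,2)] by (intro rc_borel_Int) auto
    let ?A = "C n \<inter> {x. h1 x < h2 x}"
    have i: "set_integrable lborel ?A h1" "set_integrable lborel ?A h2"
      using set_integrable_subset[OF h1[OF C(1,2)], of ?A n] set_integrable_subset[OF h2[OF C(1,2)], of ?A n]
        rc_borel_sets[OF A] by auto
    have "AE x in lborel. x \<in> ?A \<longrightarrow> h2 x - h1 x = 0"
      using i eq[OF A] by (intro set_integral_nonneg_eq_0) (auto simp: set_integral_diff)
    then show ?thesis by (rule AE_mp) auto
  qed
  have "AE x in lborel. \<forall>n. x \<in> C n \<longrightarrow> f x = g x"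
    unfolding AE_all_countable
  proof
    fix n
    show "AE x in lborel. x \<in> C n \<longrightarrow> f x = g x"
      using *[of f g n, OF _ _ f g eq] *[of g f n, OF _ _ g f eq[symmetric]] by (auto elim: AE_mp)
  qed
  then show ?thesis by (rule AE_mp) (use C(4) in auto)
qed

text \<open>Exchanges the density selected by \<open>SOME\<close> for a difference of two
  nonnegative densities, those of the Jordan parts off \<open>Z\<close>. Being nonnegative, they can
  later be sliced by Tonelli.\<close>

lemma ac_density_eq:
  fixes S :: "'a::euclidean_space set"
  assumes \<mu>: "\<mu> \<in> signed_radon S" and S: "open S" and Z: "carries_sing S \<mu> Z"
  obtains f g :: "'a \<Rightarrow> real" where
    "f \<in> borel_measurable borel" "\<And>x. 0 \<le> f x" "restr (pos_part S \<mu>) (- Z) = density (lborel_on S) f"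
    "g \<in> borel_measurable borel" "\<And>x. 0 \<le> g x" "restr (neg_part S \<mu>) (- Z) = density (lborel_on S) g"
    "ac_density S \<mu> \<in> borel_measurable borel"
    "AE x in lborel. x \<in> S \<longrightarrow> ac_density S \<mu> x = f x - g x"
proof -
  note P = pos_part_radon[OF \<mu> S] and N = neg_part_radon[OF \<mu> S]
  have Zb: "- Z \<in> sets borel" using carries_sing_borel[OF Z] by auto
  note RP = restr_radon[OF P S Zb] and RN = restr_radon[OF N S Zb]
  have ac0: "emeasure (restr (pos_part S \<mu>) (- Z)) A = 0 \<and> emeasure (restr (neg_part S \<mu>) (- Z)) A = 0"
    if A: "A \<in> sets (borel_on S)" "A \<in> null_sets lborel" for A
    using Z that emeasure_restr[OF P S Zb, of A] emeasure_restr[OF N S Zb, of A]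
    by (simp add: carries_sing_def Diff_eq radon_sets[OF P] radon_sets[OF N])
  obtain f where f: "f \<in> borel_measurable borel" "\<And>x. 0 \<le> f x"
    "restr (pos_part S \<mu>) (- Z) = density (lborel_on S) (\<lambda>x. ennreal (f x))"
    using radon_density[OF RP S] ac0 unfolding radon_sets[OF RP] by metis
  obtain g where g: "g \<in> borel_measurable borel" "\<And>x. 0 \<le> g x"
    "restr (neg_part S \<mu>) (- Z) = density (lborel_on S) (\<lambda>x. ennreal (g x))"
    using radon_density[OF RN S] ac0 unfolding radon_sets[OF RN] by metis
  have fi: "set_integrable lborel A f" and gi: "set_integrable lborel A g"
    and eq: "ac_part S \<mu> A = (LINT x:A|lborel. f x - g x)" if A: "A \<in> rc_borel S" for A
  proof -
    note A' = rc_borel_sets[OF A]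
    show fi: "set_integrable lborel A f"
      by (rule set_integrable_density_on[OF S f(1,2,3)]) (use A' radon_rc_borel_finite[OF RP S A] in auto)
    show gi: "set_integrable lborel A g"
      by (rule set_integrable_density_on[OF S g(1,2,3)]) (use A' radon_rc_borel_finite[OF RN S A] in auto)
    have "measure (restr (pos_part S \<mu>) (- Z)) A = (LINT x:A|lborel. f x)"
      by (rule measure_density_on[OF S f(1,2,3)]) (use A' radon_rc_borel_finite[OF RP S A] in auto)
    moreover have "measure (restr (neg_part S \<mu>) (- Z)) A = (LINT x:A|lborel. g x)"
      by (rule measure_density_on[OF S g(1,2,3)]) (use A' radon_rc_borel_finite[OF RN S A] in auto)
    moreover have "ac_part S \<mu> A = \<mu> (A \<inter> - Z)"
      using ac_part_eq[OF assms A] by (simp add: Diff_eq)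
    moreover have "measure (restr (pos_part S \<mu>) (- Z)) A = measure (pos_part S \<mu>) (A \<inter> - Z)"
      by (rule measure_restr[OF P S Zb radon_rc_borel_finite(1)[OF P S A]])
    moreover have "measure (restr (neg_part S \<mu>) (- Z)) A = measure (neg_part S \<mu>) (A \<inter> - Z)"
      by (rule measure_restr[OF N S Zb radon_rc_borel_finite(1)[OF N S A]])
    ultimately show "ac_part S \<mu> A = (LINT x:A|lborel. f x - g x)"
      using jordan_eq[OF \<mu> S rc_borel_Int[OF A Zb]] fi gi by (simp add: set_integral_diff)
  qed
  \<comment> \<open>\<open>Q\<close> is the predicate under the \<open>SOME\<close>; that
    \<open>f - g\<close> satisfies it makes the choice sound.\<close>
  define Q where "Q h \<longleftrightarrow> h \<in> borel_measurable borel \<and>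
     (\<forall>K. compact K \<longrightarrow> K \<subseteq> S \<longrightarrow> set_integrable lborel K h) \<and>
     (\<forall>A\<in>rc_borel S. ac_part S \<mu> A = (LINT x:A|lborel. h x))" for h :: "'a \<Rightarrow> real"
  have Q0: "Q (\<lambda>x. f x - g x)"
    unfolding Q_def using f(1) g(1) eq fi[OF compact_rc_borel] gi[OF compact_rc_borel] by auto
  have Q1: "Q (ac_density S \<mu>)"
    using someI[of Q, OF Q0] unfolding ac_density_def Q_def .
  have "AE x in lborel. x \<in> S \<longrightarrow> ac_density S \<mu> x = f x - g x"
    using Q0 Q1 by (intro locally_integrable_AE_eq[OF S]) (auto simp: Q_def)
  then show thesis using that[of f g] f g Q1 by (simp add: Q_def)
qed

section \<open>A countable family of test functions\<close>

text \<open>Without the square the function would have corners at the end points of the interval;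
  the square makes it \<open>C^1\<close>.\<close>

definition bump :: "real \<times> real \<Rightarrow> real \<Rightarrow> real" where
  "bump p x = (max 0 ((x - fst p) * (snd p - x)))\<^sup>2"

text \<open>If \<open>q \<ge> 0\<close> then \<open>n q / (1 + n q)\<close> increases with \<open>n\<close> to the indicator function of \<open>{q > 0}\<close>.\<close>

definition plateau :: "nat \<Rightarrow> (real \<times> real) set \<Rightarrow> real \<Rightarrow> real" where
  "plateau n F x = real n * (\<Sum>p\<in>F. bump p x) / (1 + real n * (\<Sum>p\<in>F. bump p x))"

text \<open>Rational end points keep the family countable, and closed intervals inside
  \<open>S\<close> give the bumps compact support in \<open>S\<close>.\<close>

definition rat_intervals :: "real set \<Rightarrow> (real \<times> real) set" where
  "rat_intervals S = {p \<in> \<rat> \<times> \<rat>. fst p < snd p \<and> {fst p..snd p} \<subseteq> S}"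

definition plateaus :: "real set \<Rightarrow> (real \<Rightarrow> real) set" where
  "plateaus S = {plateau n F | n F. finite F \<and> F \<subseteq> rat_intervals S}"

text \<open>These functions live on the whole line and vanish off \<open>K\<close> everywhere, so
  derivatives and integrals over the line need no reference to \<open>S\<close>.\<close>

definition C1c :: "real set \<Rightarrow> (real \<Rightarrow> real) set" where
  "C1c S = {\<rho>. (\<exists>K. compact K \<and> K \<subseteq> S \<and> (\<forall>x. x \<notin> K \<longrightarrow> \<rho> x = 0)) \<and>
     (\<exists>\<rho>'. continuous_on UNIV \<rho>' \<and> (\<forall>x. (\<rho> has_real_derivative \<rho>' x) (at x)))}"

lemma C1c_zero: "\<rho> \<in> C1c S \<Longrightarrow> x \<notin> S \<Longrightarrow> \<rho> x = 0"
  unfolding C1c_def by blast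

lemma C1c_continuous: "\<rho> \<in> C1c S \<Longrightarrow> continuous_on UNIV \<rho>"
  unfolding C1c_def by (auto intro: DERIV_continuous_on)

lemma C1c_measurable [measurable_dest]: "\<rho> \<in> C1c S \<Longrightarrow> \<rho> \<in> borel_measurable borel"
  by (rule borel_measurable_continuous_onI[OF C1c_continuous])

lemma bump_nonneg: "0 \<le> bump p x"
  by (simp add: bump_def)

lemma bump_eq_0_iff:
  assumes "fst p < snd p"
  shows "bump p x = 0 \<longleftrightarrow> x \<notin> {fst p<..<snd p}"
proof -
  have "bump p x = 0 \<longleftrightarrow> \<not> 0 < (x - fst p) * (snd p - x)"
    by (auto simp: bump_def max_def)
  then show ?thesis using assms by (auto simp: zero_less_mult_iff)
qed

lemma sqr_pos_part_deriv: "((\<lambda>y::real. (max 0 y)\<^sup>2) has_real_derivative 2 * max 0 y) (at y)"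
proof -
  consider "y < 0" | "y = 0" | "y > 0" by linarith
  then show ?thesis
  proof cases
    case 1
    have "((\<lambda>y::real. 0) has_real_derivative 0) (at y)" by simp
    then have "((\<lambda>y::real. (max 0 y)\<^sup>2) has_real_derivative 0) (at y)"
      by (rule has_field_derivative_transform_within_open[of _ _ _ "{..<0}"]) (use 1 in auto)
    then show ?thesis using 1 by simp
  next
    case 2
    \<comment> \<open>At 0 the difference quotient of the squared positive part equals
      \<open>max 0 h\<close>.\<close>
    have "((\<lambda>h::real. max 0 h) \<longlongrightarrow> 0) (at 0)" using tendsto_max[OF tendsto_const[of 0] tendsto_ident_at, of 0 UNIV] by simp
    then have "((\<lambda>h::real. ((max 0 (0 + h))\<^sup>2 - (max 0 0)\<^sup>2) / h) \<longlongrightarrow> 0) (at 0)"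
      by (rule filterlim_cong[THEN iffD1, rotated -1])
        (auto simp: eventually_at_filter max_def power2_eq_square intro!: always_eventually)
    then show ?thesis using 2 by (simp add: DERIV_def)
  next
    case 3
    have "((\<lambda>y::real. y\<^sup>2) has_real_derivative 2 * y) (at y)"
      by (auto intro!: derivative_eq_intros)
    then have "((\<lambda>y::real. (max 0 y)\<^sup>2) has_real_derivative 2 * y) (at y)"
      by (rule has_field_derivative_transform_within_open[of _ _ _ "{0<..}"]) (use 3 in auto)
    then show ?thesis using 3 by simp
  qed
qed

definition bump' :: "real \<times> real \<Rightarrow> real \<Rightarrow> real" where
  "bump' p x = 2 * max 0 ((x - fst p) * (snd p - x)) * (fst p + snd p - 2 * x)"

lemma bump_deriv: "(bump p has_real_derivative bump' p x) (at x)"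
proof -
  have "((\<lambda>x. (x - fst p) * (snd p - x)) has_real_derivative (fst p + snd p - 2 * x)) (at x)"
    by (auto intro!: derivative_eq_intros)
  from DERIV_chain[OF sqr_pos_part_deriv this] show ?thesis
    unfolding bump'_def bump_def[abs_def] o_def .
qed

lemma plateau_pos: "0 < 1 + real n * (\<Sum>p\<in>F. bump p x)"
  by (intro add_pos_nonneg mult_nonneg_nonneg sum_nonneg bump_nonneg) auto

text \<open>In this form monotonicity in \<open>n\<close> and in the sum of bumps is
  visible.\<close>

lemma plateau_eq: "plateau n F x = 1 - 1 / (1 + real n * (\<Sum>p\<in>F. bump p x))"
  using plateau_pos[of n x F] by (simp add: plateau_def field_simps)

lemma plateau_range: "0 \<le> plateau n F x" "plateau n F x \<le> 1"
  using plateau_pos[of n x F] sum_nonneg[of F "\<lambda>p. bump p x"] bump_nonneg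
  by (auto simp: plateau_def plateau_eq)

lemma plateau_mono:
  assumes "n \<le> m" "F \<subseteq> G" "finite G"
  shows "plateau n F x \<le> plateau m G x"
proof -
  have "real n * (\<Sum>p\<in>F. bump p x) \<le> real m * (\<Sum>p\<in>G. bump p x)"
    using assms by (intro mult_mono sum_mono2 sum_nonneg) (auto simp: bump_nonneg)
  then show ?thesis
    using plateau_pos[of n x F] unfolding plateau_eq by (intro diff_left_mono divide_left_mono) auto
qed

lemma plateau_C1c:
  assumes "finite F" "F \<subseteq> rat_intervals S"
  shows "plateau n F \<in> C1c S"
  unfolding C1c_def
proof (intro CollectI conjI)
  have F: "\<And>p. p \<in> F \<Longrightarrow> fst p < snd p \<and> {fst p..snd p} \<subseteq> S"
    using assms(2) by (auto simp: rat_intervals_def)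
  show "\<exists>K. compact K \<and> K \<subseteq> S \<and> (\<forall>x. x \<notin> K \<longrightarrow> plateau n F x = 0)"
  proof (intro exI[of _ "\<Union>p\<in>F. {fst p..snd p}"] conjI allI impI)
    fix x assume "x \<notin> (\<Union>p\<in>F. {fst p..snd p})"
    then have "bump p x = 0" if "p \<in> F" for p
      using that F by (subst bump_eq_0_iff) auto
    then show "plateau n F x = 0" by (simp add: plateau_def)
  qed (use F assms(1) in auto)
  define q where "q x = (\<Sum>p\<in>F. bump p x)" for x
  define q' where "q' x = (\<Sum>p\<in>F. bump' p x)" for x
  have q: "(q has_real_derivative q' x) (at x)" for x
    unfolding q_def[abs_def] q'_def by (intro DERIV_sum bump_deriv)
  have pos: "1 + real n * q x \<noteq> 0" for x using plateau_pos[of n x F] by (simp add: q_def)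
  show "\<exists>\<rho>'. continuous_on UNIV \<rho>' \<and> (\<forall>x. (plateau n F has_real_derivative \<rho>' x) (at x))"
  proof (intro exI[of _ "\<lambda>x. real n * q' x / (1 + real n * q x)\<^sup>2"] conjI allI)
    have "continuous_on UNIV q" using q by (auto intro!: DERIV_continuous_on)
    moreover have "continuous_on UNIV q'"
      unfolding q'_def bump'_def by (intro continuous_intros)
    ultimately show "continuous_on UNIV (\<lambda>x. real n * q' x / (1 + real n * q x)\<^sup>2)"
      using pos by (intro continuous_intros) auto
    show "(plateau n F has_real_derivative real n * q' x / (1 + real n * q x)\<^sup>2) (at x)" for x
      unfolding plateau_eq[abs_def] q_def[symmetric] using pos[of x]
      by (auto intro!: derivative_eq_intros q simp: power2_eq_square field_simps)
  qed
qed

lemma plateaus_C1c: "\<rho> \<in> plateaus S \<Longrightarrow> \<rho> \<in> C1c S"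
  by (auto simp: plateaus_def plateau_C1c)

lemma plateaus_range: "\<rho> \<in> plateaus S \<Longrightarrow> 0 \<le> \<rho> x \<and> \<rho> x \<le> 1"
  by (auto simp: plateaus_def plateau_range)

lemma plateaus_mono: "S \<subseteq> T \<Longrightarrow> plateaus S \<subseteq> plateaus T"
  unfolding plateaus_def rat_intervals_def by blast

lemma countable_rat_intervals: "countable (rat_intervals S)"
  by (rule countable_subset[of _ "\<rat> \<times> \<rat>"]) (auto simp: rat_intervals_def intro: countable_rat)

lemma countable_plateaus: "countable (plateaus S)"
proof -
  have "plateaus S = (\<lambda>(n, F). plateau n F) ` (UNIV \<times> {F. finite F \<and> F \<subseteq> rat_intervals S})"
    by (auto simp: plateaus_def)
  then show ?thesis
    using countable_Collect_finite_subset[OF countable_rat_intervals[of S]]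
    by (simp add: conj_commute)
qed

text \<open>The index \<open>n\<close> both enlarges a finite set of rational intervals and steepens
  the plateau. A point of \<open>U\<close> lies inside some such interval, whose bump is positive
  there and enters the sum from some \<open>n\<close> on; at points outside \<open>U\<close> all
  bumps vanish.\<close>

lemma open_plateau_approx:
  assumes U: "open U"
  obtains f where "\<And>n. f n \<in> plateaus U" "\<And>x. incseq (\<lambda>n. f n x)"
    "\<And>x. (\<lambda>n. f n x) \<longlonglongrightarrow> indicator U x"
proof -
  let ?R = "rat_intervals U"
  define F where "F n = {p \<in> ?R. to_nat_on ?R p < n}" for n
  have inj: "inj_on (to_nat_on ?R) ?R" by (rule inj_on_to_nat_on[OF countable_rat_intervals])
  have F: "finite (F n)" "F n \<subseteq> ?R" for n
  proof -
    have "finite (to_nat_on ?R ` F n)"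
      by (rule finite_subset[of _ "{..<n}"]) (auto simp: F_def)
    then show "finite (F n)"
      by (rule finite_imageD) (rule inj_on_subset[OF inj], auto simp: F_def)
  qed (auto simp: F_def)
  have lim: "(\<lambda>n. plateau n (F n) x) \<longlonglongrightarrow> indicator U x" for x
  proof (cases "x \<in> U")
    case False
    have "bump p x = 0" if p: "p \<in> ?R" for p
    proof -
      have "fst p < snd p" "{fst p..snd p} \<subseteq> U" using p by (auto simp: rat_intervals_def)
      moreover have "{fst p<..<snd p} \<subseteq> {fst p..snd p}" by auto
      ultimately show ?thesis using False by (subst bump_eq_0_iff) blast+
    qed
    then have "(\<Sum>p\<in>F n. bump p x) = 0" for n using F(2)[of n] by (intro sum.neutral) blast
    then have "plateau n (F n) x = 0" for n by (simp add: plateau_def)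
    then show ?thesis using False by simp
  next
    case True
    then obtain e where e: "e > 0" "ball x e \<subseteq> U" using U open_contains_ball by blast
    obtain a where a: "a \<in> \<rat>" "x - e < a" "a < x" using Rats_dense_in_real[of "x - e" x] e by auto
    obtain b where b: "b \<in> \<rat>" "x < b" "b < x + e" using Rats_dense_in_real[of x "x + e"] e by auto
    have "{a..b} \<subseteq> ball x e" using a b by (auto simp: dist_real_def)
    then have ab: "(a, b) \<in> ?R" using a b e by (auto simp: rat_intervals_def)
    define c where "c = bump (a, b) x"
    have "c \<noteq> 0" unfolding c_def using a b by (subst bump_eq_0_iff) auto
    then have c: "c > 0" using bump_nonneg[of "(a, b)" x] by (simp add: c_def)
    \<comment> \<open>The fixed bump value \<open>c\<close> bounds the whole sum from below, so the
      plateau is at least \<open>n c / (1 + n c)\<close>, which tends to 1.\<close>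
    have lo: "\<forall>\<^sub>F n in sequentially. 1 - 1 / (1 + real n * c) \<le> plateau n (F n) x"
    proof (rule eventually_sequentiallyI)
      fix n assume n: "Suc (to_nat_on ?R (a, b)) \<le> n"
      then have "(a, b) \<in> F n" using ab by (auto simp: F_def)
      then have "c \<le> (\<Sum>p\<in>F n. bump p x)"
        unfolding c_def using F bump_nonneg by (intro member_le_sum) auto
      then have "real n * c \<le> real n * (\<Sum>p\<in>F n. bump p x)" by (simp add: mult_left_mono)
      moreover have "0 < 1 + real n * c" using c by (simp add: add_pos_nonneg)
      ultimately show "1 - 1 / (1 + real n * c) \<le> plateau n (F n) x"
        unfolding plateau_eq by (intro diff_left_mono divide_left_mono) auto
    qed
    have "filterlim (\<lambda>n. 1 + real n * c) at_top sequentially"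
      using c by (intro filterlim_tendsto_add_at_top[OF tendsto_const]
        filterlim_at_top_mult_tendsto_pos[OF tendsto_const] filterlim_real_sequentially)
    then have "(\<lambda>n. 1 / (1 + real n * c)) \<longlonglongrightarrow> 0"
      by (intro real_tendsto_divide_at_top[OF tendsto_const])
    then have "(\<lambda>n. 1 - 1 / (1 + real n * c)) \<longlonglongrightarrow> 1 - 0" by (intro tendsto_intros)
    then have lim1: "(\<lambda>n. 1 - 1 / (1 + real n * c)) \<longlonglongrightarrow> 1" by simp
    have up: "\<forall>\<^sub>F n in sequentially. plateau n (F n) x \<le> 1"
      by (intro always_eventually allI plateau_range)
    have "(\<lambda>n. plateau n (F n) x) \<longlonglongrightarrow> 1"
      by (rule tendsto_sandwich[OF lo up lim1 tendsto_const])
    then show ?thesis using True by simp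
  qed
  show thesis
  proof (rule that[of "\<lambda>n. plateau n (F n)"])
    show "plateau n (F n) \<in> plateaus U" for n using F unfolding plateaus_def by blast
    show "incseq (\<lambda>n. plateau n (F n) x)" for x
      using F by (intro monoI plateau_mono) (auto simp: F_def)
  qed (rule lim)
qed

section \<open>Comparison of Radon measures by plateau functions\<close>

lemma SUP_ennreal_indicator:
  assumes "incseq (\<lambda>n. f n :: real)" "f \<longlonglongrightarrow> l"
  shows "(SUP n. ennreal (f n)) = ennreal l"
proof -
  have "incseq (\<lambda>n. ennreal (f n))" using assms(1) by (auto simp: incseq_def intro: ennreal_leI)
  then have "(\<lambda>n. ennreal (f n)) \<longlonglongrightarrow> (SUP n. ennreal (f n))" by (rule LIMSEQ_SUP)
  moreover have "(\<lambda>n. ennreal (f n)) \<longlonglongrightarrow> ennreal l" using assms(2) by (rule tendsto_ennrealI)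
  ultimately show ?thesis by (rule LIMSEQ_unique)
qed

lemma emeasure_open_plateau:
  assumes M: "M \<in> radon S" and S: "open S" and U: "U \<subseteq> S" "open U"
    and f: "\<And>n. f n \<in> plateaus U" "\<And>x. incseq (\<lambda>n. f n x)" "\<And>x. (\<lambda>n. f n x) \<longlonglongrightarrow> indicator U x"
  shows "emeasure M U = (SUP n. \<integral>\<^sup>+x. ennreal (f n x) \<partial>M)"
proof -
  have "emeasure M U = (\<integral>\<^sup>+x. indicator U x \<partial>M)"
    using U by (intro nn_integral_indicator[symmetric]) (auto simp: radon_sets_iff[OF M S])
  also have "\<dots> = (\<integral>\<^sup>+x. (SUP n. ennreal (f n x)) \<partial>M)"
    by (simp add: SUP_ennreal_indicator[OF f(2,3)] ennreal_indicator)
  also have "\<dots> = (SUP n. \<integral>\<^sup>+x. ennreal (f n x) \<partial>M)"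
  proof (rule nn_integral_monotone_convergence_SUP)
    show "incseq (\<lambda>n x. ennreal (f n x))"
      using f(2) by (auto simp: incseq_def le_fun_def intro: ennreal_leI)
    show "(\<lambda>x. ennreal (f n x)) \<in> borel_measurable M" for n
      using radon_measurable[OF C1c_measurable[OF plateaus_C1c[OF f(1)]] M] by simp
  qed
  finally show ?thesis .
qed

text \<open>Plateaus increase to indicators of open sets, which settles open sets by monotone
  convergence; Borel sets follow from outer regularity of \<open>N\<close>.\<close>

lemma radon_le_of_plateaus:
  fixes S :: "real set"
  assumes M: "M \<in> radon S" and N: "N \<in> radon S" and S: "open S"
    and le: "\<And>\<rho>. \<rho> \<in> plateaus S \<Longrightarrow> (\<integral>\<^sup>+x. ennreal (\<rho> x) \<partial>M) \<le> (\<integral>\<^sup>+x. ennreal (\<rho> x) \<partial>N)"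
    and A: "A \<in> rc_borel S"
  shows "emeasure M A \<le> emeasure N A"
proof -
  have op: "emeasure M U \<le> emeasure N U" if U: "open U" "U \<subseteq> S" for U
  proof -
    obtain f where f: "\<And>n. f n \<in> plateaus U" "\<And>x. incseq (\<lambda>n. f n x)"
      "\<And>x. (\<lambda>n. f n x) \<longlonglongrightarrow> indicator U x"
      using open_plateau_approx[OF U(1)] by metis
    show ?thesis
      unfolding emeasure_open_plateau[OF M S U(2,1) f] emeasure_open_plateau[OF N S U(2,1) f]
      using f(1) plateaus_mono[OF U(2)] by (intro SUP_mono' le) auto
  qed
  obtain K where K: "compact K" "A \<subseteq> K" "K \<subseteq> S" and Ab: "A \<in> sets borel"
    using A by (auto simp: rc_borel_def)
  obtain C where C: "\<And>n. compact(C n)" "\<And>n. C n \<subseteq> S" "\<And>n. C n \<subseteq> interior(C(Suc n))"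
    "\<And>K. \<lbrakk>compact K; K \<subseteq> S\<rbrakk> \<Longrightarrow> \<exists>N. \<forall>n\<ge>N. K \<subseteq> (C n)"
    using open_Union_compact_subsets[OF S] by metis
  obtain n where n: "K \<subseteq> C n" using C(4)[OF K(1,3)] by auto
  \<comment> \<open>Outer regularity is applied to a finite measure, so a relatively compact open
    neighbourhood \<open>V\<close> of \<open>A\<close> is fixed first.\<close>
  define V where "V = interior (C (Suc n))"
  have V: "open V" "V \<subseteq> S" "A \<subseteq> V" "V \<in> rc_borel S"
  proof -
    have sub: "V \<subseteq> C (Suc n)" unfolding V_def by (rule interior_subset)
    show V: "open V" "V \<subseteq> S" unfolding V_def using sub C(2)[of "Suc n"] by (auto simp: V_def)
    show "A \<subseteq> V" using K(2) n C(3)[of n] by (auto simp: V_def)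
    show "V \<in> rc_borel S" using sub C(1,2)[of "Suc n"] V by (auto simp: rc_borel_def)
  qed
  \<comment> \<open>Pushing the cut-off measure to \<open>borel\<close> gives a measure on the whole
    line, for which every open set of the line is measurable as it stands.\<close>
  define N0 where "N0 = distr (restr N V) borel (\<lambda>x. x)"
  have meas: "(\<lambda>x. x) \<in> measurable (restr N V) borel"
    using radon_measurable[OF _ restr_radon[OF N S, of V], of "\<lambda>x. x"] V by simp
  have N0: "emeasure N0 B = emeasure N (B \<inter> V)" if "B \<in> sets borel" for B
  proof -
    have "emeasure N0 B = emeasure (restr N V) (B \<inter> S)"
      unfolding N0_def using that by (subst emeasure_distr[OF meas]) (auto simp: radon_space[OF N])
    also have "\<dots> = emeasure N (B \<inter> S \<inter> V)"
      using that V S by (intro emeasure_restr[OF N S]) (auto simp: radon_sets_iff[OF N S])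
    also have "B \<inter> S \<inter> V = B \<inter> V" using V by auto
    finally show ?thesis .
  qed
  have "emeasure N0 (space N0) \<noteq> \<infinity>"
    using radon_rc_borel_finite(2)[OF N S V(4)] N0[of UNIV] by (simp add: N0_def)
  then have "emeasure N0 A = (INF U\<in>{U. A \<subseteq> U \<and> open U}. emeasure N0 U)"
    using Ab by (intro outer_regular) (auto simp: N0_def)
  also have "\<dots> \<ge> emeasure M A"
  proof (rule INF_greatest)
    fix U assume U: "U \<in> {U. A \<subseteq> U \<and> open U}"
    have "emeasure M A \<le> emeasure M (U \<inter> V)"
      using U V by (intro emeasure_mono) (auto simp: radon_sets_iff[OF M S])
    also have "\<dots> \<le> emeasure N (U \<inter> V)" using U V by (intro op) auto
    also have "\<dots> = emeasure N0 U" using U by (intro N0[symmetric]) auto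
    finally show "emeasure M A \<le> emeasure N0 U" .
  qed
  finally show ?thesis using N0[OF Ab] V(3) by (simp add: Int_absorb2)
qed

section \<open>Disintegration along slices\<close>

text \<open>Slices are determined only for almost every time, so measurability in \<open>t\<close>
  has to survive changes on null sets. It does because \<open>lebesgue_on\<close> is
  complete.\<close>

lemma lebesgue_on_AE_measurable:
  fixes S :: "real set"
  assumes S: "S \<in> sets lebesgue" and g: "g \<in> measurable (lebesgue_on S) N"
    and ae: "AE t in lebesgue_on S. f t = g t" and f: "\<And>t. t \<in> S \<Longrightarrow> f t \<in> space N"
  shows "f \<in> measurable (lebesgue_on S) N"
proof -
  have "complete_measure (lebesgue_on S)"
  proof
    fix A B :: "real set" assume "B \<subseteq> A" "A \<in> null_sets (lebesgue_on S)"
    then have "A \<subseteq> S" "A \<in> null_sets lebesgue" using S by (auto simp: null_sets_restrict_space)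
    then have "B \<in> sets lebesgue" using completion.complete \<open>B \<subseteq> A\<close> by blast
    then show "B \<in> sets (lebesgue_on S)" using S \<open>A \<subseteq> S\<close> \<open>B \<subseteq> A\<close> by (auto simp: sets_restrict_space_iff)
  qed
  then interpret complete_measure "lebesgue_on S" .
  show ?thesis
  proof (rule measurableI)
    fix A assume A: "A \<in> sets N"
    show "f -` A \<inter> space (lebesgue_on S) \<in> sets (lebesgue_on S)"
    proof (rule in_sets_AE)
      show "AE t in lebesgue_on S. (t \<in> g -` A \<inter> space (lebesgue_on S)) = (t \<in> f -` A \<inter> space (lebesgue_on S))"
        using ae by (rule AE_mp) auto
      show "g -` A \<inter> space (lebesgue_on S) \<in> sets (lebesgue_on S)"
        using g A by (rule measurable_sets)
    qed auto
  qed (use f in auto)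
qed

text \<open>A Lebesgue set is a Borel set up to a null set, so Borel test sets already show that the
  two functions are densities of the same measure; finiteness then gives uniqueness of the
  density.\<close>

lemma lebesgue_on_AE_eqI:
  fixes g h :: "real \<Rightarrow> ennreal"
  assumes S: "S \<in> sets borel" and [measurable]: "g \<in> borel_measurable (lebesgue_on S)" "h \<in> borel_measurable (lebesgue_on S)"
    and fin: "(\<integral>\<^sup>+t. g t \<partial>lebesgue_on S) < \<infinity>"
    and eq: "\<And>J. J \<in> sets borel \<Longrightarrow>
      (\<integral>\<^sup>+t. g t * indicator J t \<partial>lebesgue_on S) = (\<integral>\<^sup>+t. h t * indicator J t \<partial>lebesgue_on S)"
  shows "AE t in lebesgue_on S. g t = h t"
proof -
  have "density (lebesgue_on S) g = density (lebesgue_on S) h"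
  proof (rule measure_eqI)
    fix A assume "A \<in> sets (density (lebesgue_on S) g)"
    then have A: "A \<in> sets (lebesgue_on S)" by simp
    then have "A \<in> sets lebesgue" "A \<subseteq> S" using S by (auto simp: sets_restrict_space_iff)
    then obtain J N N' where J: "A = J \<union> N" "N \<subseteq> N'" "N' \<in> null_sets lborel" "J \<in> sets lborel"
      by (auto elim: sets_completionE)
    have "AE t in lborel. t \<notin> N'" by (rule AE_not_in[OF J(3)])
    then have ae: "AE t in lebesgue_on S. t \<notin> N'"
      using S by (subst AE_restrict_space_iff) (auto simp: AE_completion_iff)
    have *: "(\<integral>\<^sup>+t. k t * indicator A t \<partial>lebesgue_on S) = (\<integral>\<^sup>+t. k t * indicator J t \<partial>lebesgue_on S)" for k
      using ae J(1,2) by (intro nn_integral_cong_AE) (auto simp: indicator_def elim!: AE_mp)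
    show "emeasure (density (lebesgue_on S) g) A = emeasure (density (lebesgue_on S) h) A"
      using A eq[of J] J(4) by (simp add: emeasure_density *)
  qed simp
  then show ?thesis
    using fin by (subst finite_density_unique[symmetric]) auto
qed

text \<open>The disintegration identity for a single integrand. Measurability is included because
  the closure under sums, differences and monotone limits uses it.\<close>

definition fibred_int :: "real \<Rightarrow> (real \<times> real) measure \<Rightarrow> (real \<Rightarrow> real measure) \<Rightarrow> (real \<times> real \<Rightarrow> ennreal) \<Rightarrow> bool" where
  "fibred_int T u w f \<longleftrightarrow> (\<lambda>t. \<integral>\<^sup>+x. f (x, t) \<partial>w t) \<in> borel_measurable (time_measure T) \<and>
     (\<integral>\<^sup>+z. f z \<partial>u) = (\<integral>\<^sup>+t. \<integral>\<^sup>+x. f (x, t) \<partial>w t \<partial>time_measure T)"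

lemma sets_Times_UNIV:
  fixes K :: "real set"
  assumes "K \<in> sets borel"
  shows "K \<times> UNIV \<in> sets (borel :: (real \<times> real) measure)"
proof -
  have "(fst :: real \<times> real \<Rightarrow> real) \<in> borel_measurable borel"
    by (intro borel_measurable_continuous_onI continuous_intros)
  from measurable_sets[OF this assms] show ?thesis by (simp add: vimage_fst)
qed

lemma section_measurable:
  "f \<in> measurable borel N \<Longrightarrow> (\<lambda>x. f (x, t :: real)) \<in> measurable (borel :: real measure) N"
  by (rule measurable_compose[of "\<lambda>x. (x, t)" borel borel])
    (auto intro!: borel_measurable_continuous_onI continuous_intros)

lemma section_sets:
  assumes "Z \<in> sets borel"
  shows "{x :: real. (x, t :: real) \<in> Z} \<in> sets borel"
proof -
  have "(\<lambda>x :: real. (x, t)) \<in> measurable borel borel"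
    by (intro borel_measurable_continuous_onI continuous_intros)
  from measurable_sets[OF this assms] show ?thesis by (simp add: vimage_def)
qed

text \<open>Every \<open>w t\<close> is Radon, not only almost every one: exceptional slices will be
  replaced by the null measure. This keeps statements about inner integrals free of null
  sets.\<close>

locale fibred =
  fixes \<Omega> :: "real set" and T :: real and u :: "(real \<times> real) measure" and w :: "real \<Rightarrow> real measure"
  assumes open_\<Omega>: "open \<Omega>" and u: "u \<in> radon (cylinder \<Omega> T)" and w: "\<And>t. w t \<in> radon \<Omega>"
begin

lemma open_cylinder: "open (cylinder \<Omega> T)"
  using open_\<Omega> by (intro open_Times) auto

lemma meas_u: "f \<in> borel_measurable borel \<Longrightarrow> f \<in> borel_measurable u"
  by (rule radon_measurable[OF _ u])

lemma meas_w: "f \<in> borel_measurable borel \<Longrightarrow> (\<lambda>x. f (x, t)) \<in> borel_measurable (w t)"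
  by (rule radon_measurable[OF section_measurable w])

lemma fibred_int_SUP:
  assumes f: "\<And>n. f n \<in> borel_measurable borel" "\<And>n. fibred_int T u w (f n)" and inc: "incseq f"
  shows "fibred_int T u w (\<lambda>z. SUP n. f n z)"
proof -
  have inct: "incseq (\<lambda>n x. f n (x, t))" for t
    using inc by (auto simp: incseq_def le_fun_def)
  have 1: "(\<integral>\<^sup>+x. (SUP n. f n (x, t)) \<partial>w t) = (SUP n. \<integral>\<^sup>+x. f n (x, t) \<partial>w t)" for t
    by (rule nn_integral_monotone_convergence_SUP[OF inct meas_w[OF f(1)]])
  have inc2: "incseq (\<lambda>n t. \<integral>\<^sup>+x. f n (x, t) \<partial>w t)"
    using inct by (auto simp: incseq_def le_fun_def intro!: nn_integral_mono)
  show ?thesis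
    unfolding fibred_int_def 1
  proof
    show "(\<lambda>t. SUP n. \<integral>\<^sup>+x. f n (x, t) \<partial>w t) \<in> borel_measurable (time_measure T)"
      using f(2) by (intro borel_measurable_SUP) (auto simp: fibred_int_def)
    have "(\<integral>\<^sup>+z. (SUP n. f n z) \<partial>u) = (SUP n. \<integral>\<^sup>+z. f n z \<partial>u)"
      by (rule nn_integral_monotone_convergence_SUP[OF inc meas_u[OF f(1)]])
    also have "\<dots> = (SUP n. \<integral>\<^sup>+t. \<integral>\<^sup>+x. f n (x, t) \<partial>w t \<partial>time_measure T)"
      using f(2) by (simp add: fibred_int_def)
    also have "\<dots> = (\<integral>\<^sup>+t. (SUP n. \<integral>\<^sup>+x. f n (x, t) \<partial>w t) \<partial>time_measure T)"
      using f(2) by (intro nn_integral_monotone_convergence_SUP[symmetric, OF inc2]) (auto simp: fibred_int_def)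
    finally show "(\<integral>\<^sup>+z. (SUP n. f n z) \<partial>u) = \<dots>" .
  qed
qed

lemma fibred_int_add:
  assumes "f \<in> borel_measurable borel" "fibred_int T u w f"
    and "g \<in> borel_measurable borel" "fibred_int T u w g"
  shows "fibred_int T u w (\<lambda>z. f z + g z)"
  using assms unfolding fibred_int_def
  by (auto simp: nn_integral_add meas_u meas_w)

lemma fibred_int_cmult:
  assumes "f \<in> borel_measurable borel" "fibred_int T u w f"
  shows "fibred_int T u w (\<lambda>z. c * f z)"
  using assms unfolding fibred_int_def
  by (auto simp: nn_integral_cmult meas_u meas_w)

lemma fibred_int_suminf:
  fixes f :: "nat \<Rightarrow> real \<times> real \<Rightarrow> ennreal"
  assumes f: "\<And>n. f n \<in> borel_measurable borel" "\<And>n. fibred_int T u w (f n)"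
  shows "fibred_int T u w (\<lambda>z. \<Sum>n. f n z)"
  using f unfolding fibred_int_def
  by (auto simp: nn_integral_suminf meas_u meas_w intro!: borel_measurable_suminf_order)

text \<open>Integrals in \<open>ennreal\<close> can be subtracted only if they are finite, so
  finiteness is required of the total integral and of every inner integral of the larger
  function.\<close>

lemma fibred_int_diff:
  assumes f: "f \<in> borel_measurable borel" "fibred_int T u w f"
    and g: "g \<in> borel_measurable borel" "fibred_int T u w g"
    and le: "\<And>z. f z \<le> g z" and fin: "(\<integral>\<^sup>+z. g z \<partial>u) < \<infinity>" "\<And>t. (\<integral>\<^sup>+x. g (x, t) \<partial>w t) < \<infinity>"
  shows "fibred_int T u w (\<lambda>z. g z - f z)"
proof -
  have leu: "(\<integral>\<^sup>+z. f z \<partial>u) \<le> (\<integral>\<^sup>+z. g z \<partial>u)" and lew: "(\<integral>\<^sup>+x. f (x, t) \<partial>w t) \<le> (\<integral>\<^sup>+x. g (x, t) \<partial>w t)" for t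
    using le by (auto intro!: nn_integral_mono)
  have 1: "(\<integral>\<^sup>+x. g (x, t) - f (x, t) \<partial>w t) = (\<integral>\<^sup>+x. g (x, t) \<partial>w t) - (\<integral>\<^sup>+x. f (x, t) \<partial>w t)" for t
    using le fin(2)[of t] lew[of t] by (intro nn_integral_diff meas_w f g) auto
  have 2: "(\<integral>\<^sup>+z. g z - f z \<partial>u) = (\<integral>\<^sup>+z. g z \<partial>u) - (\<integral>\<^sup>+z. f z \<partial>u)"
    using le fin(1) leu by (intro nn_integral_diff meas_u f g) auto
  have 3: "(\<integral>\<^sup>+t. (\<integral>\<^sup>+x. g (x, t) \<partial>w t) - (\<integral>\<^sup>+x. f (x, t) \<partial>w t) \<partial>time_measure T) = (\<integral>\<^sup>+z. g z \<partial>u) - (\<integral>\<^sup>+z. f z \<partial>u)"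
    using f(2) g(2) fin(1) leu lew unfolding fibred_int_def
    by (subst nn_integral_diff) auto
  show ?thesis
    unfolding fibred_int_def 1 2 3 using f(2) g(2) by (auto simp: fibred_int_def)
qed

lemma fibred_int_all:
  assumes sets: "\<And>A. A \<in> sets borel \<Longrightarrow> fibred_int T u w (indicator A)"
    and f: "f \<in> borel_measurable borel"
  shows "fibred_int T u w f"
  using f
proof (induction rule: borel_measurable_induct)
  case (cong f g)
  then have "f = g" by (auto simp: fun_eq_iff)
  then show ?case using cong by simp
next
  case (set A) then show ?case by (intro sets)
next
  case (mult u c) then show ?case by (intro fibred_int_cmult) auto
next
  case (add u v) then show ?case by (intro fibred_int_add) auto
next
  case (seq U)
  then have "fibred_int T u w (\<lambda>z. SUP n. U n z)" by (intro fibred_int_SUP) auto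
  then show ?case by (simp add: SUP_apply[abs_def])
qed

end

lemma uniform_limit_mult_bounded:
  fixes b :: "'a \<Rightarrow> real"
  assumes c: "(c \<longlongrightarrow> c0) F" and b: "\<And>x. x \<in> X \<Longrightarrow> \<bar>b x\<bar> \<le> B"
  shows "uniform_limit X (\<lambda>s x. c s * b x) (\<lambda>x. c0 * b x) F"
proof (rule uniform_limitI)
  fix e :: real assume e: "e > 0"
  define B' where "B' = max B 0 + 1"
  have B': "B' > 0" "\<And>x. x \<in> X \<Longrightarrow> \<bar>b x\<bar> \<le> B'" using b by (auto simp: B'_def le_max_iff_disj add_increasing2 intro: order_trans)
  have "e / B' > 0" using e B' by simp
  from tendstoD[OF c this] show "\<forall>\<^sub>F s in F. \<forall>x\<in>X. dist (c s * b x) (c0 * b x) < e"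
  proof (rule eventually_mono, intro ballI)
    fix s x assume s: "dist (c s) c0 < e / B'" and x: "x \<in> X"
    have "dist (c s * b x) (c0 * b x) = \<bar>c s - c0\<bar> * \<bar>b x\<bar>"
      by (simp add: dist_real_def left_diff_distrib[symmetric] abs_mult)
    also have "\<dots> \<le> \<bar>c s - c0\<bar> * B'" using B'(2)[OF x] by (intro mult_left_mono) auto
    also have "\<dots> < e" using s B'(1) by (simp add: dist_real_def pos_less_divide_eq)
    finally show "dist (c s * b x) (c0 * b x) < e" .
  qed
qed

section \<open>Continuous test functions and their integrability\<close>

lemma C_Cc_prod:
  assumes \<rho>: "continuous_on UNIV \<rho>" "compact K" "K \<subseteq> \<Omega>" "\<And>x. x \<notin> K \<Longrightarrow> \<rho> x = 0"
    and \<phi>: "continuous_on UNIV \<phi>"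
  shows "(\<lambda>t x. \<phi> t * \<rho> x) \<in> C_Cc \<Omega> T"
  unfolding C_Cc_def
proof (intro CollectI exI[of _ K] conjI ballI assms(2,3))
  fix t assume t: "t \<in> {0..T}"
  show "continuous_on \<Omega> (\<lambda>x. \<phi> t * \<rho> x)"
    using \<rho>(1) by (intro continuous_intros) (auto intro: continuous_on_subset)
  show "\<phi> t * \<rho> x = 0" if "x \<in> \<Omega> - K" for x using that \<rho>(4) by simp
  have "compact (\<rho> ` K)" using \<rho> by (auto intro: compact_continuous_image continuous_on_subset)
  then have "bounded (\<rho> ` K)" by (rule compact_imp_bounded)
  then obtain B where B: "\<And>x. x \<in> K \<Longrightarrow> \<bar>\<rho> x\<bar> \<le> B" by (auto simp: bounded_iff)
  then have B': "\<bar>\<rho> x\<bar> \<le> max B 0" for x using \<rho>(4)[of x] by (cases "x \<in> K") force+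
  have "(\<phi> \<longlongrightarrow> \<phi> t) (at t within {0..T})"
    using \<phi> by (auto simp: continuous_on_def intro: tendsto_within_subset)
  then show "uniform_limit \<Omega> (\<lambda>t x. \<phi> t * \<rho> x) (\<lambda>x. \<phi> t * \<rho> x) (at t within {0..T})"
    using B' by (rule uniform_limit_mult_bounded)
qed

lemma radon_integrable:
  fixes f :: "'a::euclidean_space \<Rightarrow> real"
  assumes M: "M \<in> radon S" and S: "open S" and f: "f \<in> borel_measurable M"
    and K: "compact K" "K \<subseteq> S" and B: "\<And>x. x \<in> K \<Longrightarrow> \<bar>f x\<bar> \<le> B" and zero: "\<And>x. x \<in> S - K \<Longrightarrow> f x = 0"
  shows "integrable M f"
proof (rule integrableI_bounded_set[where A = K])
  show "K \<in> sets M" "emeasure M K < \<infinity>"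
    using radon_rc_borel_finite[OF M S compact_rc_borel[OF K]] by auto
qed (use f B zero radon_space[OF M] in auto)

lemma continuous_compact_bounded:
  fixes f :: "'a::euclidean_space \<Rightarrow> real"
  assumes "continuous_on S f" "compact K" "K \<subseteq> S"
  obtains B where "0 \<le> B" "\<And>x. x \<in> K \<Longrightarrow> \<bar>f x\<bar> \<le> B"
proof -
  have "bounded (f ` K)"
    using assms by (auto intro: compact_imp_bounded compact_continuous_image continuous_on_subset)
  then obtain B where "\<And>x. x \<in> K \<Longrightarrow> \<bar>f x\<bar> \<le> B" by (auto simp: bounded_iff)
  then show thesis using that[of "max B 0"] by force
qed

lemma radon_integrable_continuous:
  fixes f :: "'a::euclidean_space \<Rightarrow> real"
  assumes M: "M \<in> radon S" and S: "open S" and f: "continuous_on S f"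
    and K: "compact K" "K \<subseteq> S" and zero: "\<And>x. x \<in> S - K \<Longrightarrow> f x = 0"
  shows "integrable M f"
proof -
  obtain B where B: "\<And>x. x \<in> K \<Longrightarrow> \<bar>f x\<bar> \<le> B"
    using continuous_compact_bounded[OF f K] by metis
  have "f \<in> borel_measurable (restrict_space borel S)"
    using f by (rule borel_measurable_continuous_on_restrict)
  then have "f \<in> borel_measurable M"
    unfolding measurable_cong_sets[OF radon_sets[OF M] refl] .
  then show ?thesis by (rule radon_integrable[OF M S _ K B zero])
qed

lemma C1c_integrable:
  assumes M: "M \<in> radon S" and S: "open S" and \<rho>: "\<rho> \<in> C1c S"
  shows "integrable M \<rho>"
proof -
  obtain K where K: "compact K" "K \<subseteq> S" "\<And>x. x \<notin> K \<Longrightarrow> \<rho> x = 0"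
    using \<rho> by (auto simp: C1c_def)
  then show ?thesis
    using C1c_continuous[OF \<rho>]
    by (intro radon_integrable_continuous[OF M S _ K(1,2)]) (auto intro: continuous_on_subset)
qed

text \<open>A function constant in time belongs to \<open>C_Cc\<close>, which imposes no vanishing
  at the times 0 and \<open>T\<close>. So the weighted mass is finite up to both ends of the
  cylinder, more than local finiteness on the open cylinder provides.\<close>

lemma slicing_plateau_finite:
  assumes sl: "is_slicing \<Omega> T u v" and \<rho>: "\<rho> \<in> plateaus \<Omega>"
  shows "(\<integral>\<^sup>+z. ennreal (\<rho> (fst z)) \<partial>u) < \<infinity>"
proof -
  have \<rho>c: "\<rho> \<in> C1c \<Omega>" by (rule plateaus_C1c[OF \<rho>])
  obtain K where K: "compact K" "K \<subseteq> \<Omega>" "\<And>x. x \<notin> K \<Longrightarrow> \<rho> x = 0"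
    using \<rho>c by (auto simp: C1c_def)
  have "(\<lambda>t x. 1 * \<rho> x) \<in> C_Cc \<Omega> T" by (rule C_Cc_prod[OF C1c_continuous[OF \<rho>c] K]) auto
  then have "integrable u (\<lambda>(x, t). 1 * \<rho> x)" using sl unfolding is_slicing_def by fastforce
  then have "integrable u (\<lambda>z. \<rho> (fst z))" by (simp add: case_prod_beta')
  then show ?thesis using plateaus_range[OF \<rho>] by (simp add: nn_integral_eq_integral)
qed

text \<open>Open rectangles are the generator of choice: they are stable under intersection, and
  products of plateaus approximate their indicators.\<close>

lemma sets_borel_prod_rectangles:
  "sets (borel :: (real \<times> real) measure) = sigma_sets UNIV {U \<times> V | U V. open U \<and> open V}"
proof (rule antisym)
  let ?G = "{U \<times> V | U V. open U \<and> open V} :: (real \<times> real) set set"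
  have "range (\<lambda>(a, b). box a b :: (real \<times> real) set) \<subseteq> ?G"
  proof clarify
    fix a b c d :: real
    have "box (a, b) (c, d) = {a<..<c} \<times> {b<..<d}"
      by (auto simp: box_def Basis_prod_def inner_Pair)
    then show "\<exists>U V. box (a, b) (c, d) = U \<times> V \<and> open U \<and> open V"
      by (intro exI[of _ "{a<..<c}"] exI[of _ "{b<..<d}"]) simp
  qed
  then have "sigma_sets UNIV (range (\<lambda>(a, b). box a b :: (real \<times> real) set)) \<subseteq> sigma_sets UNIV ?G"
    by (rule sigma_sets_mono')
  then show "sets (borel :: (real \<times> real) measure) \<subseteq> sigma_sets UNIV ?G"
    by (subst borel_eq_box) simp
  show "sigma_sets UNIV ?G \<subseteq> sets borel"
  proof -
    have "?G \<subseteq> sets borel" by (auto intro!: borel_open open_Times)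
    from sets.sigma_sets_subset[OF this] show ?thesis by simp
  qed
qed

lemma Int_stable_rectangles: "Int_stable ({U \<times> V | U V. open U \<and> open V} :: (real \<times> real) set set)"
  unfolding Int_stable_def
proof clarify
  fix U V U' V' :: "real set" assume "open U" "open V" "open U'" "open V'"
  then show "\<exists>A B. U \<times> V \<inter> U' \<times> V' = A \<times> B \<and> open A \<and> open B"
    by (intro exI[of _ "U \<inter> U'"] exI[of _ "V \<inter> V'"]) (simp add: Times_Int_Times open_Int)
qed

lemma borel_compose_fst: "g \<in> measurable borel N \<Longrightarrow> (\<lambda>z. g (fst z :: real)) \<in> measurable (borel :: (real \<times> real) measure) N"
  and borel_compose_snd: "g \<in> measurable borel N \<Longrightarrow> (\<lambda>z. g (snd z :: real)) \<in> measurable (borel :: (real \<times> real) measure) N"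
  by (erule measurable_compose[rotated], intro borel_measurable_continuous_onI continuous_intros)+

context fibred
begin

lemma fibred_int_cong:
  assumes "\<And>x t. x \<in> \<Omega> \<Longrightarrow> f (x, t) = g (x, t)"
  shows "fibred_int T u w f \<longleftrightarrow> fibred_int T u w g"
proof -
  have "(\<integral>\<^sup>+x. f (x, t) \<partial>w t) = (\<integral>\<^sup>+x. g (x, t) \<partial>w t)" for t
    using assms by (intro nn_integral_cong) (simp add: radon_space[OF w])
  moreover have "(\<integral>\<^sup>+z. f z \<partial>u) = (\<integral>\<^sup>+z. g z \<partial>u)"
    using assms by (intro nn_integral_cong) (auto simp: radon_space[OF u])
  ultimately show ?thesis by (simp add: fibred_int_def)
qed

text \<open>Translates the Bochner identity of \<open>is_slicing\<close> into one between
  nonnegative integrals, and passes from \<open>v\<close> to the version \<open>w\<close> by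
  completeness of the time measure.\<close>

lemma fibred_int_test:
  assumes sl: "is_slicing \<Omega> T u v" and ae: "AE t in time_measure T. w t = v t"
    and \<zeta>: "\<zeta> \<in> C_Cc \<Omega> T" "\<And>t x. 0 \<le> \<zeta> t x"
  shows "fibred_int T u w (\<lambda>z. ennreal (\<zeta> (snd z) (fst z)))"
proof -
  obtain K where K: "compact K" "K \<subseteq> \<Omega>" "\<And>t. t \<in> {0..T} \<Longrightarrow> continuous_on \<Omega> (\<zeta> t)"
    "\<And>t x. t \<in> {0..T} \<Longrightarrow> x \<in> \<Omega> - K \<Longrightarrow> \<zeta> t x = 0"
    using \<zeta>(1) by (auto simp: C_Cc_def)
  define h where "h t = (LINT x|w t. \<zeta> t x)" for t
  let ?g = "\<lambda>t. LINT x|v t. \<zeta> t x"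
  have iu: "integrable u (\<lambda>(x, t). \<zeta> t x)" and ig: "integrable (time_measure T) ?g"
    and eq: "(LINT (x, t)|u. \<zeta> t x) = (LINT t|time_measure T. ?g t)"
    using sl \<zeta>(1) by (auto simp: is_slicing_def)
  have nnh: "(\<integral>\<^sup>+x. ennreal (\<zeta> t x) \<partial>w t) = ennreal (h t)" if t: "t \<in> {0<..<T}" for t
    unfolding h_def using \<zeta>(2) t K(3)[of t] K(4)[of t]
    by (intro nn_integral_eq_integral radon_integrable_continuous[OF w open_\<Omega> _ K(1,2)]) auto
  have aeh: "AE t in time_measure T. h t = ?g t"
    using ae by (rule AE_mp) (auto simp: h_def)
  have hm: "h \<in> borel_measurable (time_measure T)"
    by (rule lebesgue_on_AE_measurable[OF _ borel_measurable_integrable[OF ig] aeh]) auto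
  have ih: "integrable (time_measure T) h"
    using ig by (subst integrable_cong_AE[OF hm _ aeh]) auto
  show ?thesis
    unfolding fibred_int_def fst_conv snd_conv
  proof
    have "(\<lambda>t. ennreal (h t)) \<in> borel_measurable (time_measure T)" using hm by simp
    then show "(\<lambda>t. \<integral>\<^sup>+x. ennreal (\<zeta> t x) \<partial>w t) \<in> borel_measurable (time_measure T)"
      by (rule measurable_cong[THEN iffD1, rotated]) (simp add: nnh)
    have "(\<integral>\<^sup>+z. ennreal (\<zeta> (snd z) (fst z)) \<partial>u) = ennreal (LINT z|u. \<zeta> (snd z) (fst z))"
      using iu \<zeta>(2) by (intro nn_integral_eq_integral) (auto simp: case_prod_beta')
    also have "(LINT z|u. \<zeta> (snd z) (fst z)) = (LINT t|time_measure T. h t)"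
      using eq integral_cong_AE[OF hm borel_measurable_integrable[OF ig] aeh] by (simp add: case_prod_beta')
    also have "ennreal \<dots> = (\<integral>\<^sup>+t. ennreal (h t) \<partial>time_measure T)"
      using \<zeta>(2) by (intro nn_integral_eq_integral[symmetric] ih) (auto simp: h_def)
    also have "\<dots> = (\<integral>\<^sup>+t. \<integral>\<^sup>+x. ennreal (\<zeta> t x) \<partial>w t \<partial>time_measure T)"
      by (intro nn_integral_cong) (simp add: nnh)
    finally show "(\<integral>\<^sup>+z. ennreal (\<zeta> (snd z) (fst z)) \<partial>u) = \<dots>" .
  qed
qed

text \<open>\<open>is_slicing\<close> speaks only of continuous test functions. Products of plateaus
  in \<open>x\<close> and \<open>t\<close> increase to indicators of open rectangles, and induction
  over disjoint unions and complements extends the identity to Borel sets.\<close>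

lemma fibred_int_slicing:
  assumes sl: "is_slicing \<Omega> T u v" and ae: "AE t in time_measure T. w t = v t"
    and f: "f \<in> borel_measurable borel"
  shows "fibred_int T u w f"
proof (rule fibred_int_all[OF _ f])
  \<comment> \<open>The weight \<open>\<rho>\<close> makes the masses finite, so that complements can be handled by subtraction.\<close>
  have weighted: "fibred_int T u w (\<lambda>z. ennreal (\<rho> (fst z)) * indicator A z)"
    if \<rho>: "\<rho> \<in> plateaus \<Omega>" and A: "A \<in> sets borel" for \<rho> A
  proof -
    have \<rho>c: "\<rho> \<in> C1c \<Omega>" by (rule plateaus_C1c[OF \<rho>])
    have \<rho>r: "0 \<le> \<rho> x" "\<rho> x \<le> 1" for x using plateaus_range[OF \<rho>] by auto
    obtain K where K: "compact K" "K \<subseteq> \<Omega>" "\<And>x. x \<notin> K \<Longrightarrow> \<rho> x = 0"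
      using \<rho>c by (auto simp: C1c_def)
    have cont: "continuous_on UNIV \<rho>" by (rule C1c_continuous[OF \<rho>c])
    have [measurable]: "\<rho> \<in> borel_measurable borel" by (rule C1c_measurable[OF \<rho>c])
    have test: "fibred_int T u w (\<lambda>z. ennreal (\<beta> (snd z) * (\<rho> (fst z) * \<alpha> (fst z))))"
      if "continuous_on UNIV \<alpha>" "continuous_on UNIV \<beta>" "\<And>x. 0 \<le> \<alpha> x" "\<And>t. 0 \<le> \<beta> t" for \<alpha> \<beta>
    proof (rule fibred_int_test[OF sl ae])
      show "(\<lambda>t x. \<beta> t * (\<rho> x * \<alpha> x)) \<in> C_Cc \<Omega> T"
        using K by (intro C_Cc_prod[OF _ K(1,2)] continuous_intros cont that) auto
    qed (use that \<rho>r in auto)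
    have \<rho>0: "fibred_int T u w (\<lambda>z. ennreal (\<rho> (fst z)))"
      using test[of "\<lambda>_. 1" "\<lambda>_. 1"] by simp
    have fin_w: "(\<integral>\<^sup>+x. ennreal (\<rho> (fst (x, t))) \<partial>w t) < \<infinity>" for t
      using C1c_integrable[OF w open_\<Omega> \<rho>c] \<rho>r by (simp add: nn_integral_eq_integral)
    note fin_u = slicing_plateau_finite[OF sl \<rho>]
    have "Int_stable ({U \<times> V | U V. open U \<and> open V} :: (real \<times> real) set set)"
      by (rule Int_stable_rectangles)
    moreover have "{U \<times> V | U V. open U \<and> open V} \<subseteq> Pow (UNIV :: (real \<times> real) set)" by simp
    moreover have "A \<in> sigma_sets UNIV {U \<times> V | U V. open U \<and> open V}"
      using A by (simp add: sets_borel_prod_rectangles)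
    ultimately show ?thesis
    proof (induction rule: sigma_sets_induct_disjoint)
      case (basic A)
      then obtain U V where UV: "A = U \<times> V" "open U" "open V" by auto
      obtain \<alpha> where \<alpha>: "\<And>n. \<alpha> n \<in> plateaus U" "\<And>x. incseq (\<lambda>n. \<alpha> n x)" "\<And>x. (\<lambda>n. \<alpha> n x) \<longlonglongrightarrow> indicator U x"
        using open_plateau_approx[OF UV(2)] by metis
      obtain \<beta> where \<beta>: "\<And>n. \<beta> n \<in> plateaus V" "\<And>x. incseq (\<lambda>n. \<beta> n x)" "\<And>x. (\<lambda>n. \<beta> n x) \<longlonglongrightarrow> indicator V x"
        using open_plateau_approx[OF UV(3)] by metis
      have ab: "0 \<le> \<alpha> n x" "0 \<le> \<beta> n x" for n x
        using plateaus_range[OF \<alpha>(1)] plateaus_range[OF \<beta>(1)] by auto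
      have cc: "continuous_on UNIV (\<alpha> n)" "continuous_on UNIV (\<beta> n)" for n
        using C1c_continuous[OF plateaus_C1c[OF \<alpha>(1)]] C1c_continuous[OF plateaus_C1c[OF \<beta>(1)]] by auto
      have mono: "incseq (\<lambda>n. \<beta> n (snd z) * (\<rho> (fst z) * \<alpha> n (fst z)))" for z
        using \<rho>r ab monoD[OF \<alpha>(2)] monoD[OF \<beta>(2)]
        by (intro monoI mult_mono) (auto intro!: mult_left_mono)
      have lim: "(\<lambda>n. \<beta> n (snd z) * (\<rho> (fst z) * \<alpha> n (fst z))) \<longlonglongrightarrow> indicator V (snd z) * (\<rho> (fst z) * indicator U (fst z))" for z
        by (intro tendsto_intros \<alpha> \<beta>)
      have "fibred_int T u w (\<lambda>z. SUP n. ennreal (\<beta> n (snd z) * (\<rho> (fst z) * \<alpha> n (fst z))))"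
      proof (rule fibred_int_SUP)
        show "(\<lambda>z. ennreal (\<beta> n (snd z) * (\<rho> (fst z) * \<alpha> n (fst z)))) \<in> borel_measurable borel" for n
          using borel_compose_fst[OF borel_measurable_continuous_onI[OF cc(1)], of n]
            borel_compose_snd[OF borel_measurable_continuous_onI[OF cc(2)], of n]
            borel_compose_fst[OF borel_measurable_continuous_onI[OF cont]]
          by simp
        show "fibred_int T u w (\<lambda>z. ennreal (\<beta> n (snd z) * (\<rho> (fst z) * \<alpha> n (fst z))))" for n
          by (rule test[OF cc ab])
        show "incseq (\<lambda>n z. ennreal (\<beta> n (snd z) * (\<rho> (fst z) * \<alpha> n (fst z))))"
          using mono by (auto simp: incseq_def le_fun_def intro: ennreal_leI)
      qed
      moreover have "(SUP n. ennreal (\<beta> n (snd z) * (\<rho> (fst z) * \<alpha> n (fst z)))) = ennreal (\<rho> (fst z)) * indicator A z" for z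
        unfolding SUP_ennreal_indicator[OF mono lim] UV(1)
        by (cases z) (auto simp: indicator_def)
      ultimately show ?case by simp
    next
      case empty
      then show ?case by (simp add: fibred_int_def)
    next
      case (compl A)
      then have [measurable]: "A \<in> sets borel" by (simp add: sets_borel_prod_rectangles)
      have m: "(\<lambda>z::real \<times> real. ennreal (\<rho> (fst z))) \<in> borel_measurable borel"
        using borel_compose_fst[OF borel_measurable_continuous_onI[OF cont]] by simp
      have "fibred_int T u w (\<lambda>z. ennreal (\<rho> (fst z)) - ennreal (\<rho> (fst z)) * indicator A z)"
        by (intro fibred_int_diff m \<rho>0 compl fin_u fin_w) (use m in \<open>auto simp: indicator_def\<close>)
      moreover have "ennreal (\<rho> (fst z)) - ennreal (\<rho> (fst z)) * indicator A z = ennreal (\<rho> (fst z)) * indicator (UNIV - A) z" for z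
        by (auto simp: indicator_def)
      ultimately show ?case by simp
    next
      case (union A)
      then have [measurable]: "\<And>i. A i \<in> sets borel" by (auto simp: sets_borel_prod_rectangles)
      have m: "(\<lambda>z::real \<times> real. ennreal (\<rho> (fst z))) \<in> borel_measurable borel"
        using borel_compose_fst[OF borel_measurable_continuous_onI[OF cont]] by simp
      have "fibred_int T u w (\<lambda>z. \<Sum>i. ennreal (\<rho> (fst z)) * indicator (A i) z)"
        using m by (intro fibred_int_suminf union) auto
      then show ?case using union(1) by (simp add: suminf_indicator ennreal_suminf_cmult)
    qed
  qed
  fix A :: "(real \<times> real) set" assume A: "A \<in> sets borel"
  \<comment> \<open>Letting the weights increase to the indicator of \<Omega> removes them; values
    outside \<Omega> are invisible to \<open>u\<close> and \<open>w t\<close>.\<close>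
  obtain \<rho> where \<rho>: "\<And>n. \<rho> n \<in> plateaus \<Omega>" "\<And>x. incseq (\<lambda>n. \<rho> n x)" "\<And>x. (\<lambda>n. \<rho> n x) \<longlonglongrightarrow> indicator \<Omega> x"
    using open_plateau_approx[OF open_\<Omega>] by metis
  have cont: "continuous_on UNIV (\<rho> n)" for n by (rule C1c_continuous[OF plateaus_C1c[OF \<rho>(1)]])
  have m: "(\<lambda>z::real \<times> real. ennreal (\<rho> n (fst z))) \<in> borel_measurable borel" for n
    using borel_compose_fst[OF borel_measurable_continuous_onI[OF cont]] by simp
  have "fibred_int T u w (\<lambda>z. SUP n. ennreal (\<rho> n (fst z)) * indicator A z)"
  proof (rule fibred_int_SUP)
    show "incseq (\<lambda>n z. ennreal (\<rho> n (fst z)) * indicator A z)"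
      using \<rho>(2) by (auto simp: incseq_def le_fun_def intro!: mult_right_mono ennreal_leI)
  qed (use m weighted[OF \<rho>(1) A] A in auto)
  moreover have "(SUP n. ennreal (\<rho> n (fst z)) * indicator A z) = indicator \<Omega> (fst z) * indicator A z" for z
    using SUP_ennreal_indicator[OF \<rho>(2,3), of "fst z"]
    by (simp add: SUP_mult_right_ennreal[symmetric] ennreal_indicator)
  ultimately have "fibred_int T u w (\<lambda>z. indicator \<Omega> (fst z) * indicator A z)" by simp
  then show "fibred_int T u w (indicator A)"
    by (subst fibred_int_cong[of _ "\<lambda>z. indicator \<Omega> (fst z) * indicator A z"]) auto
qed

end

text \<open>Admitting all Borel integrands makes the notion stable under restriction to Borel sets
  of the plane: the integrand is multiplied by an indicator, which leaves the class of continuous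
  test functions but not this one.\<close>

locale disintegration = fibred +
  assumes fib: "\<And>f. f \<in> borel_measurable borel \<Longrightarrow> fibred_int T u w f"
begin

lemma nn_integral_eq:
  "f \<in> borel_measurable borel \<Longrightarrow> (\<integral>\<^sup>+z. f z \<partial>u) = (\<integral>\<^sup>+t. \<integral>\<^sup>+x. f (x, t) \<partial>w t \<partial>time_measure T)"
  using fib by (simp add: fibred_int_def)

lemma nn_integral_meas:
  "f \<in> borel_measurable borel \<Longrightarrow> (\<lambda>t. \<integral>\<^sup>+x. f (x, t) \<partial>w t) \<in> borel_measurable (time_measure T)"
  using fib by (simp add: fibred_int_def)

text \<open>Carries the Hahn set of a measure on the cylinder over to almost every slice.\<close>

lemma sections_null:
  assumes A: "A \<in> sets borel" "emeasure u (A \<inter> cylinder \<Omega> T) = 0"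
  shows "AE t in time_measure T. emeasure (w t) ({x. (x, t) \<in> A} \<inter> \<Omega>) = 0"
proof -
  let ?f = "indicator (A \<inter> cylinder \<Omega> T) :: real \<times> real \<Rightarrow> ennreal"
  have A': "A \<inter> cylinder \<Omega> T \<in> sets borel" using A open_cylinder by auto
  have "(\<integral>\<^sup>+t. \<integral>\<^sup>+x. ?f (x, t) \<partial>w t \<partial>time_measure T) = (\<integral>\<^sup>+z. ?f z \<partial>u)"
    using A' by (intro nn_integral_eq[symmetric]) auto
  also have "\<dots> = 0"
    using A A' radon_sets_iff[OF u open_cylinder] by (subst nn_integral_indicator) auto
  finally have ae: "AE t in time_measure T. (\<integral>\<^sup>+x. ?f (x, t) \<partial>w t) = 0"
    using nn_integral_meas[of ?f] A' by (subst (asm) nn_integral_0_iff_AE) auto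
  have e: "(\<integral>\<^sup>+x. ?f (x, t) \<partial>w t) = emeasure (w t) ({x. (x, t) \<in> A} \<inter> \<Omega>)" if t: "t \<in> {0<..<T}" for t
  proof -
    have "(\<integral>\<^sup>+x. ?f (x, t) \<partial>w t) = (\<integral>\<^sup>+x. indicator ({x. (x, t) \<in> A} \<inter> \<Omega>) x \<partial>w t)"
      using t by (intro nn_integral_cong) (auto simp: indicator_def)
    also have "\<dots> = emeasure (w t) ({x. (x, t) \<in> A} \<inter> \<Omega>)"
      using section_sets[OF A(1), of t] open_\<Omega> radon_sets_iff[OF w open_\<Omega>] by (intro nn_integral_indicator) auto
    finally show ?thesis .
  qed
  show ?thesis using ae by (rule AE_mp) (use e in \<open>auto intro!: AE_I2\<close>)
qed

lemma restr_disintegration: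
  assumes Z: "Z \<in> sets borel"
  shows "disintegration \<Omega> T (restr u Z) (\<lambda>t. restr (w t) {x. (x, t) \<in> Z})"
proof
  show "open \<Omega>" by (rule open_\<Omega>)
  show "restr u Z \<in> radon (cylinder \<Omega> T)" by (rule restr_radon[OF u open_cylinder Z])
  show "restr (w t) {x. (x, t) \<in> Z} \<in> radon \<Omega>" for t by (rule restr_radon[OF w open_\<Omega> section_sets[OF Z]])
  fix f :: "real \<times> real \<Rightarrow> ennreal" assume f: "f \<in> borel_measurable borel"
  have "(\<integral>\<^sup>+x. f (x, t) \<partial>restr (w t) {x. (x, t) \<in> Z}) = (\<integral>\<^sup>+x. indicator Z (x, t) * f (x, t) \<partial>w t)" for t
    by (subst nn_integral_restr[OF w section_sets[OF Z] meas_w[OF f]]) (simp add: indicator_def)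
  moreover have "(\<integral>\<^sup>+z. f z \<partial>restr u Z) = (\<integral>\<^sup>+z. indicator Z z * f z \<partial>u)"
    by (rule nn_integral_restr[OF u Z meas_u[OF f]])
  moreover have "(\<lambda>z. indicator Z z * f z) \<in> borel_measurable borel" using f Z by auto
  from fib[OF this] have "fibred_int T u w (\<lambda>z. indicator Z z * f z)" .
  ultimately show "fibred_int T (restr u Z) (\<lambda>t. restr (w t) {x. (x, t) \<in> Z}) f"
    by (simp add: fibred_int_def)
qed

lemma measure_measurable:
  assumes "K \<in> sets borel" "K \<subseteq> \<Omega>"
  shows "(\<lambda>t. emeasure (w t) K) \<in> borel_measurable (time_measure T)"
proof -
  note K = sets_Times_UNIV[OF assms(1)]
  have "(\<lambda>t. \<integral>\<^sup>+x. indicator (K \<times> UNIV) (x, t) \<partial>w t) \<in> borel_measurable (time_measure T)"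
    using K by (intro nn_integral_meas) auto
  moreover have "(\<integral>\<^sup>+x. indicator (K \<times> UNIV) (x, t) \<partial>w t) = emeasure (w t) K" for t
  proof -
    have "(\<integral>\<^sup>+x. indicator (K \<times> UNIV) (x, t) \<partial>w t) = (\<integral>\<^sup>+x. indicator K x \<partial>w t)"
      by (intro nn_integral_cong) (simp add: indicator_def)
    also have "\<dots> = emeasure (w t) K"
      using assms radon_sets_iff[OF w open_\<Omega>, of K t] by (intro nn_integral_indicator) auto
    finally show ?thesis .
  qed
  ultimately show ?thesis by simp
qed

text \<open>The bounds on \<open>F\<close> and on the slice masses over \<open>K\<close> make the
  inner integrals essentially bounded, and the time interval has finite length; this yields Bochner
  integrability.\<close>

lemma fubini_nonneg:
  fixes F :: "real \<times> real \<Rightarrow> real"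
  assumes F: "F \<in> borel_measurable borel" and K: "compact K" "K \<subseteq> \<Omega>"
    and nn: "\<And>z. 0 \<le> F z"
    and B: "\<And>x t. t \<in> {0<..<T} \<Longrightarrow> x \<in> K \<Longrightarrow> F (x, t) \<le> B"
    and zero: "\<And>x t. t \<in> {0<..<T} \<Longrightarrow> x \<in> \<Omega> - K \<Longrightarrow> F (x, t) = 0"
    and C: "AE t in time_measure T. measure (w t) K \<le> C"
  shows "integrable u F" "integrable (time_measure T) (\<lambda>t. LINT x|w t. F (x, t))"
    "(LINT z|u. F z) = (LINT t|time_measure T. LINT x|w t. F (x, t))"
proof -
  let ?F = "\<lambda>z. ennreal (F z)"
  have Fm: "?F \<in> borel_measurable borel" using F by simp
  define g where "g t = (\<integral>\<^sup>+x. ?F (x, t) \<partial>w t)" for t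
  have Kw: "K \<in> sets (w t)" for t using radon_rc_borel_finite(1)[OF w open_\<Omega> compact_rc_borel[OF K]] .
  have bnd: "g t \<le> ennreal B * emeasure (w t) K" if t: "t \<in> {0<..<T}" for t
  proof -
    have "g t \<le> (\<integral>\<^sup>+x. ennreal B * indicator K x \<partial>w t)"
      unfolding g_def using B[OF t] zero[OF t]
      by (intro nn_integral_mono) (auto simp: radon_space[OF w] indicator_def intro!: ennreal_leI)
    also have "\<dots> = ennreal B * emeasure (w t) K" using Kw by (simp add: nn_integral_cmult)
    finally show ?thesis .
  qed
  have "AE t in time_measure T. g t \<le> ennreal B * ennreal C"
    using C
  proof (rule AE_mp, intro AE_I2 impI)
    fix t assume t: "t \<in> space (time_measure T)" "measure (w t) K \<le> C"
    then have "emeasure (w t) K \<le> ennreal C"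
      unfolding radon_emeasure_eq[OF w open_\<Omega> compact_rc_borel[OF K]] by (intro ennreal_leI)
    then have "ennreal B * emeasure (w t) K \<le> ennreal B * ennreal C" by (intro mult_left_mono) auto
    then show "g t \<le> ennreal B * ennreal C"
      using bnd[of t] t(1) by simp
  qed
  then have "(\<integral>\<^sup>+t. g t \<partial>time_measure T) \<le> (\<integral>\<^sup>+t. ennreal B * ennreal C \<partial>time_measure T)"
    by (rule nn_integral_mono_AE)
  also have "\<dots> < \<infinity>"
    using emeasure_lborel_box_finite[of 0 T]
    by (simp add: emeasure_restrict_space ennreal_mult_less_top box_real)
  finally have fin: "(\<integral>\<^sup>+t. g t \<partial>time_measure T) < \<infinity>" .
  have eq: "(\<integral>\<^sup>+z. ?F z \<partial>u) = (\<integral>\<^sup>+t. g t \<partial>time_measure T)"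
    unfolding g_def by (rule nn_integral_eq[OF Fm])
  have gm: "g \<in> borel_measurable (time_measure T)" unfolding g_def by (rule nn_integral_meas[OF Fm])
  show "integrable u F" using F nn fin by (intro integrableI_nonneg meas_u) (auto simp: eq)
  have intg: "(LINT x|w t. F (x, t)) = enn2real (g t)" for t
    unfolding g_def using nn by (intro integral_eq_nn_integral meas_w F) auto
  have gfin: "ennreal (enn2real (g t)) = g t" if t: "t \<in> {0<..<T}" for t
  proof -
    have "integrable (w t) (\<lambda>x. F (x, t))"
      using nn B[OF t] zero[OF t] by (intro radon_integrable[OF w open_\<Omega> meas_w[OF F] K]) auto
    then show ?thesis unfolding g_def using nn by (simp add: nn_integral_eq_integral)
  qed
  have e: "(\<integral>\<^sup>+t. ennreal (enn2real (g t)) \<partial>time_measure T) = (\<integral>\<^sup>+t. g t \<partial>time_measure T)"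
    using gfin by (intro nn_integral_cong) auto
  show "integrable (time_measure T) (\<lambda>t. LINT x|w t. F (x, t))"
    unfolding intg using gm fin by (intro integrableI_nonneg) (auto simp: e)
  show "(LINT z|u. F z) = (LINT t|time_measure T. LINT x|w t. F (x, t))"
    unfolding intg using gm meas_u[OF F] nn by (simp add: integral_eq_nn_integral e eq)
qed

lemma fubini:
  fixes F :: "real \<times> real \<Rightarrow> real"
  assumes F: "F \<in> borel_measurable borel" and K: "compact K" "K \<subseteq> \<Omega>"
    and B: "\<And>x t. t \<in> {0<..<T} \<Longrightarrow> x \<in> K \<Longrightarrow> \<bar>F (x, t)\<bar> \<le> B"
    and zero: "\<And>x t. t \<in> {0<..<T} \<Longrightarrow> x \<in> \<Omega> - K \<Longrightarrow> F (x, t) = 0"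
    and C: "AE t in time_measure T. measure (w t) K \<le> C"
  shows "integrable u F" "integrable (time_measure T) (\<lambda>t. LINT x|w t. F (x, t))"
    "(LINT z|u. F z) = (LINT t|time_measure T. LINT x|w t. F (x, t))"
proof -
  let ?P = "\<lambda>z. max 0 (F z)" and ?N = "\<lambda>z. max 0 (- F z)"
  have Pm: "?P \<in> borel_measurable borel" and Nm: "?N \<in> borel_measurable borel" using F by auto
  have BP: "?P (x, t) \<le> B" "?N (x, t) \<le> B" if "t \<in> {0<..<T}" "x \<in> K" for x t
    using B[OF that] by auto
  have ZP: "?P (x, t) = 0" "?N (x, t) = 0" if "t \<in> {0<..<T}" "x \<in> \<Omega> - K" for x t
    using zero[OF that] by auto
  note P = fubini_nonneg[OF Pm K _ BP(1) ZP(1) C, simplified] and N = fubini_nonneg[OF Nm K _ BP(2) ZP(2) C, simplified]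
  have FPN: "F z = ?P z - ?N z" for z by auto
  have inner: "(LINT x|w t. F (x, t)) = (LINT x|w t. ?P (x, t)) - (LINT x|w t. ?N (x, t))"
    if t: "t \<in> {0<..<T}" for t
  proof -
    have "integrable (w t) (\<lambda>x. ?P (x, t))"
      by (rule radon_integrable[OF w open_\<Omega> meas_w[OF Pm] K, where B = B]) (use BP(1)[OF t] ZP(1)[OF t] in auto)
    moreover have "integrable (w t) (\<lambda>x. ?N (x, t))"
      by (rule radon_integrable[OF w open_\<Omega> meas_w[OF Nm] K, where B = B]) (use BP(2)[OF t] ZP(2)[OF t] in auto)
    ultimately have "(LINT x|w t. ?P (x, t) - ?N (x, t)) = (LINT x|w t. ?P (x, t)) - (LINT x|w t. ?N (x, t))"
      by (rule Bochner_Integration.integral_diff)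
    then show ?thesis using FPN by simp
  qed
  have "integrable u (\<lambda>z. ?P z - ?N z)" using P(1) N(1) by (rule Bochner_Integration.integrable_diff)
  then show "integrable u F" using FPN by simp
  have "integrable (time_measure T) (\<lambda>t. (LINT x|w t. ?P (x, t)) - (LINT x|w t. ?N (x, t)))"
    using P(2) N(2) by (rule Bochner_Integration.integrable_diff)
  then show "integrable (time_measure T) (\<lambda>t. LINT x|w t. F (x, t))"
    by (rule Bochner_Integration.integrable_cong[THEN iffD1, rotated -1]) (auto simp: inner)
  have "(LINT z|u. F z) = (LINT z|u. ?P z) - (LINT z|u. ?N z)"
    using Bochner_Integration.integral_diff[OF P(1) N(1)] FPN by simp
  also have "\<dots> = (LINT t|time_measure T. (LINT x|w t. ?P (x, t)) - (LINT x|w t. ?N (x, t)))"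
    unfolding P(3) N(3) using P(2) N(2) by (rule Bochner_Integration.integral_diff[symmetric])
  also have "\<dots> = (LINT t|time_measure T. LINT x|w t. F (x, t))"
    by (rule Bochner_Integration.integral_cong) (auto simp: inner)
  finally show "(LINT z|u. F z) = (LINT t|time_measure T. LINT x|w t. F (x, t))" .
qed

end

text \<open>Uniform convergence in time and continuity in \<open>x\<close> combine to joint
  continuity, which supplies Borel measurability in the plane and bounds on compact sets.\<close>

lemma C_Cc_continuous:
  assumes "\<zeta> \<in> C_Cc \<Omega> T"
  shows "continuous_on (\<Omega> \<times> {0..T}) (\<lambda>z. \<zeta> (snd z) (fst z))"
  unfolding continuous_on_iff
proof (intro ballI allI impI)
  fix z and e :: real assume z: "z \<in> \<Omega> \<times> {0..T}" and e: "0 < e"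
  define x t where "x = fst z" and "t = snd z"
  have xt: "x \<in> \<Omega>" "t \<in> {0..T}" using z by (auto simp: x_def t_def)
  have c: "continuous_on \<Omega> (\<zeta> t)" and ul: "uniform_limit \<Omega> \<zeta> (\<zeta> t) (at t within {0..T})"
    using assms xt by (auto simp: C_Cc_def)
  have e2: "e / 2 > 0" using e by simp
  obtain d1 where d1: "d1 > 0" "\<And>y. y \<in> \<Omega> \<Longrightarrow> dist y x < d1 \<Longrightarrow> dist (\<zeta> t y) (\<zeta> t x) < e / 2"
    using c xt(1) e2 unfolding continuous_on_iff by metis
  have "\<forall>\<^sub>F s in at t within {0..T}. \<forall>y\<in>\<Omega>. dist (\<zeta> s y) (\<zeta> t y) < e / 2"
    using uniform_limitD[OF ul e2] .
  then obtain d2 where d2: "d2 > 0"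
    "\<And>s y. s \<in> {0..T} \<Longrightarrow> s \<noteq> t \<Longrightarrow> dist s t < d2 \<Longrightarrow> y \<in> \<Omega> \<Longrightarrow> dist (\<zeta> s y) (\<zeta> t y) < e / 2"
    unfolding eventually_at by (auto simp: less_le)
  show "\<exists>d>0. \<forall>z'\<in>\<Omega> \<times> {0..T}. dist z' z < d \<longrightarrow> dist (\<zeta> (snd z') (fst z')) (\<zeta> (snd z) (fst z)) < e"
  proof (intro exI[of _ "min d1 d2"] conjI ballI impI)
    fix z' assume z': "z' \<in> \<Omega> \<times> {0..T}" "dist z' z < min d1 d2"
    have "dist (fst z') x < d1" "dist (snd z') t < d2"
      using z'(2) dist_fst_le[of z' z] dist_snd_le[of z' z] by (auto simp: x_def t_def)
    then have "dist (\<zeta> t (fst z')) (\<zeta> t x) < e / 2" "dist (\<zeta> (snd z') (fst z')) (\<zeta> t (fst z')) < e / 2"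
      using d1(2) d2(2) z'(1) e2 by (auto, cases "snd z' = t") auto
    then show "dist (\<zeta> (snd z') (fst z')) (\<zeta> (snd z) (fst z)) < e"
      unfolding x_def[symmetric] t_def[symmetric]
      using dist_triangle[of "\<zeta> (snd z') (fst z')" "\<zeta> t x" "\<zeta> t (fst z')"] by linarith
  qed (use d1 d2 in auto)
qed

text \<open>The way back to the original notion. It shows that restricted measures belong to
  \<open>Linf_radon\<close>, so that the \<open>SOME\<close> behind \<open>slice\<close> selects a
  genuine slicing for them.\<close>

lemma (in disintegration) is_slicing:
  assumes C: "\<And>K. compact K \<Longrightarrow> K \<subseteq> \<Omega> \<Longrightarrow> \<exists>C. AE t in time_measure T. measure (w t) K \<le> C"
  shows "is_slicing \<Omega> T u w"
  unfolding is_slicing_def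
proof (intro conjI ballI allI impI)
  show "AE t in time_measure T. w t \<in> radon \<Omega>" using w by simp
next
  fix K assume K: "compact K" "K \<subseteq> \<Omega>"
  have "(\<lambda>t. emeasure (w t) K) \<in> borel_measurable (time_measure T)"
    using K by (intro measure_measurable) (auto intro: borel_compact)
  then have "(\<lambda>t. measure (w t) K) \<in> borel_measurable (time_measure T)"
    unfolding measure_def by simp
  then show "(\<lambda>t. measure (w t) K) \<in> Linf (time_measure T)"
    using C[OF K] by (auto simp: Linf_def)
next
  fix \<zeta> assume \<zeta>: "\<zeta> \<in> C_Cc \<Omega> T"
  then obtain K where K: "compact K" "K \<subseteq> \<Omega>" "\<And>t x. t \<in> {0..T} \<Longrightarrow> x \<in> \<Omega> - K \<Longrightarrow> \<zeta> t x = 0"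
    by (auto simp: C_Cc_def)
  note cont = C_Cc_continuous[OF \<zeta>]
  obtain B where B: "\<And>z. z \<in> K \<times> {0..T} \<Longrightarrow> \<bar>\<zeta> (snd z) (fst z)\<bar> \<le> B"
    using continuous_compact_bounded[OF cont, of "K \<times> {0..T}"] K compact_Times[OF K(1) compact_Icc]
    by (metis Sigma_mono order_refl)
  \<comment> \<open>The test function is controlled only over \<Omega> and for times in
    \<open>[0,T]\<close>; cutting it off at the open cylinder gives a Borel function on the
    plane.\<close>
  define F where "F z = indicator (cylinder \<Omega> T) z *\<^sub>R \<zeta> (snd z) (fst z)" for z
  have "continuous_on (cylinder \<Omega> T) (\<lambda>z. \<zeta> (snd z) (fst z))"
    by (rule continuous_on_subset[OF cont]) auto
  then have F: "F \<in> borel_measurable borel"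
    unfolding F_def using open_cylinder by (intro borel_measurable_continuous_on_indicator) auto
  obtain C where C': "AE t in time_measure T. measure (w t) K \<le> C" using C[OF K(1,2)] by blast
  have BF: "\<bar>F (x, t)\<bar> \<le> B" if "t \<in> {0<..<T}" "x \<in> K" for x t
    using that B[of "(x, t)"] K(2) by (auto simp: F_def indicator_def)
  have ZF: "F (x, t) = 0" if "t \<in> {0<..<T}" "x \<in> \<Omega> - K" for x t
    using that K(3)[of t x] by (auto simp: F_def)
  note * = fubini[OF F K(1,2) BF ZF C']
  have Fu: "F z = (case z of (x, t) \<Rightarrow> \<zeta> t x)" if "z \<in> space u" for z
    using that radon_space[OF u] by (cases z) (auto simp: F_def)
  have Fw: "(LINT x|w t. F (x, t)) = (LINT x|w t. \<zeta> t x)" if "t \<in> {0<..<T}" for t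
    using that by (intro Bochner_Integration.integral_cong) (auto simp: F_def radon_space[OF w])
  show "integrable u (\<lambda>(x, t). \<zeta> t x)"
    using *(1) by (rule Bochner_Integration.integrable_cong[THEN iffD1, rotated -1]) (auto simp: Fu)
  show "integrable (time_measure T) (\<lambda>t. LINT x|w t. \<zeta> t x)"
    using *(2) by (rule Bochner_Integration.integrable_cong[THEN iffD1, rotated -1]) (auto simp: Fw)
  have "(LINT (x, t)|u. \<zeta> t x) = (LINT z|u. F z)"
    by (rule Bochner_Integration.integral_cong) (auto simp: Fu)
  also have "\<dots> = (LINT t|time_measure T. LINT x|w t. F (x, t))" by (rule *(3))
  also have "\<dots> = (LINT t|time_measure T. LINT x|w t. \<zeta> t x)"
    by (rule Bochner_Integration.integral_cong) (auto simp: Fw)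
  finally show "(LINT (x, t)|u. \<zeta> t x) = (LINT t|time_measure T. LINT x|w t. \<zeta> t x)" .
qed

lemma slicing_disintegration:
  assumes \<Omega>: "open \<Omega>" and u: "u \<in> radon (cylinder \<Omega> T)" and sl: "is_slicing \<Omega> T u v"
  obtains w where "disintegration \<Omega> T u w" "AE t in time_measure T. w t = v t"
proof -
  \<comment> \<open>The times at which the slice fails to be Radon form a null set and receive the
    null measure.\<close>
  define w where "w t = (if v t \<in> radon \<Omega> then v t else null_measure (borel_on \<Omega>))" for t
  have ae: "AE t in time_measure T. w t = v t"
    using sl unfolding is_slicing_def by (auto simp: w_def elim: AE_mp)
  interpret fibred \<Omega> T u w
    using \<Omega> u by unfold_locales (auto simp: w_def null_measure_radon)
  show thesis
    using fibred_int_slicing[OF sl ae] ae by (intro that[of w]) unfold_locales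
qed

text \<open>For one plateau, testing with Borel sets of times identifies the two slice integrals
  almost everywhere. Countably many plateaus cost a single null set, and they determine each Radon
  measure.\<close>

lemma disintegration_unique:
  assumes d: "disintegration \<Omega> T u w" and d': "disintegration \<Omega> T u w'"
    and fin: "\<And>\<rho>. \<rho> \<in> plateaus \<Omega> \<Longrightarrow> (\<integral>\<^sup>+z. ennreal (\<rho> (fst z)) \<partial>u) < \<infinity>"
  shows "AE t in time_measure T. w t = w' t"
proof -
  interpret A: disintegration \<Omega> T u w by fact
  interpret B: disintegration \<Omega> T u w' by fact
  have "AE t in time_measure T. (\<integral>\<^sup>+x. ennreal (\<rho> x) \<partial>w t) = (\<integral>\<^sup>+x. ennreal (\<rho> x) \<partial>w' t)"
    if \<rho>: "\<rho> \<in> plateaus \<Omega>" for \<rho>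
  proof (rule lebesgue_on_AE_eqI)
    have \<rho>m: "\<rho> \<in> borel_measurable borel" by (rule C1c_measurable[OF plateaus_C1c[OF \<rho>]])
    have m: "(\<lambda>z::real \<times> real. ennreal (\<rho> (fst z))) \<in> borel_measurable borel"
      using borel_compose_fst[OF \<rho>m] by simp
    show "(\<lambda>t. \<integral>\<^sup>+x. ennreal (\<rho> x) \<partial>w t) \<in> borel_measurable (time_measure T)"
      "(\<lambda>t. \<integral>\<^sup>+x. ennreal (\<rho> x) \<partial>w' t) \<in> borel_measurable (time_measure T)"
      using A.nn_integral_meas[OF m] B.nn_integral_meas[OF m] by auto
    show "(\<integral>\<^sup>+t. \<integral>\<^sup>+x. ennreal (\<rho> x) \<partial>w t \<partial>time_measure T) < \<infinity>"
      using fin[OF \<rho>] A.nn_integral_eq[OF m] by simp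
    fix J :: "real set" assume J: "J \<in> sets borel"
    have mJ: "(\<lambda>z::real \<times> real. ennreal (\<rho> (fst z)) * indicator J (snd z)) \<in> borel_measurable borel"
      using m borel_compose_snd[of "indicator J :: real \<Rightarrow> ennreal"] J by simp
    have "(\<integral>\<^sup>+t. (\<integral>\<^sup>+x. ennreal (\<rho> x) \<partial>w t) * indicator J t \<partial>time_measure T) =
        (\<integral>\<^sup>+t. \<integral>\<^sup>+x. ennreal (\<rho> x) * indicator J t \<partial>w t \<partial>time_measure T)"
      using radon_measurable[OF \<rho>m A.w] by (simp add: nn_integral_multc)
    also have "\<dots> = (\<integral>\<^sup>+t. \<integral>\<^sup>+x. ennreal (\<rho> x) * indicator J t \<partial>w' t \<partial>time_measure T)"
      using A.nn_integral_eq[OF mJ] B.nn_integral_eq[OF mJ] by simp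
    also have "\<dots> = (\<integral>\<^sup>+t. (\<integral>\<^sup>+x. ennreal (\<rho> x) \<partial>w' t) * indicator J t \<partial>time_measure T)"
      using radon_measurable[OF \<rho>m B.w] by (simp add: nn_integral_multc)
    finally show "(\<integral>\<^sup>+t. (\<integral>\<^sup>+x. ennreal (\<rho> x) \<partial>w t) * indicator J t \<partial>time_measure T) =
      (\<integral>\<^sup>+t. (\<integral>\<^sup>+x. ennreal (\<rho> x) \<partial>w' t) * indicator J t \<partial>time_measure T)" .
  qed simp
  then have "AE t in time_measure T. \<forall>\<rho>\<in>plateaus \<Omega>.
      (\<integral>\<^sup>+x. ennreal (\<rho> x) \<partial>w t) = (\<integral>\<^sup>+x. ennreal (\<rho> x) \<partial>w' t)"
    by (simp add: AE_ball_countable[OF countable_plateaus])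
  then show ?thesis
  proof (rule AE_mp, intro AE_I2 impI)
    fix t assume eq: "\<forall>\<rho>\<in>plateaus \<Omega>. (\<integral>\<^sup>+x. ennreal (\<rho> x) \<partial>w t) = (\<integral>\<^sup>+x. ennreal (\<rho> x) \<partial>w' t)"
    show "w t = w' t"
      by (intro radon_measure_eqI[OF A.w B.w A.open_\<Omega>] antisym
        radon_le_of_plateaus[OF A.w B.w A.open_\<Omega>] radon_le_of_plateaus[OF B.w A.w A.open_\<Omega>])
        (use eq in auto)
  qed
qed

lemma slicing_bound:
  assumes sl: "is_slicing \<Omega> T u v" and ae: "AE t in time_measure T. w t = v t"
    and K: "compact K" "K \<subseteq> \<Omega>"
  shows "\<exists>C. AE t in time_measure T. measure (w t) K \<le> C"
proof -
  obtain C where C: "AE t in time_measure T. \<bar>measure (v t) K\<bar> \<le> C"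
    using sl K unfolding is_slicing_def Linf_def by blast
  have "AE t in time_measure T. measure (w t) K \<le> C"
    using ae C by eventually_elim simp
  then show ?thesis by blast
qed

section \<open>Slices of absolutely continuous measures\<close>

lemma nn_integral_time_measure:
  assumes "f \<in> borel_measurable borel"
  shows "(\<integral>\<^sup>+t. f t \<partial>time_measure T) = (\<integral>\<^sup>+t. f t * indicator {0<..<T} t \<partial>lborel)"
  by (simp add: nn_integral_restrict_space nn_integral_completion)

lemma borel_time_measurable:
  "f \<in> measurable borel N \<Longrightarrow> f \<in> measurable (time_measure T) N"
  by (intro measurable_restrict_space1 measurable_completion) simp

lemma tonelli_lborel:
  fixes f :: "real \<times> real \<Rightarrow> ennreal"
  assumes f: "f \<in> borel_measurable borel"
  shows "(\<integral>\<^sup>+z. f z \<partial>lborel) = (\<integral>\<^sup>+t. \<integral>\<^sup>+x. f (x, t) \<partial>lborel \<partial>lborel)"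
    and "(\<lambda>t. \<integral>\<^sup>+x. f (x, t) \<partial>lborel) \<in> borel_measurable borel"
proof -
  have f': "f \<in> borel_measurable (lborel \<Otimes>\<^sub>M lborel)" using f by (simp add: lborel_prod)
  then have c: "case_prod (\<lambda>x t. f (x, t)) \<in> borel_measurable (lborel \<Otimes>\<^sub>M lborel)" by simp
  show "(\<integral>\<^sup>+z. f z \<partial>lborel) = (\<integral>\<^sup>+t. \<integral>\<^sup>+x. f (x, t) \<partial>lborel \<partial>lborel)"
    using lborel_pair.nn_integral_snd[OF c] by (simp add: lborel_prod)
  have "(\<lambda>z. f (snd z, fst z)) \<in> borel_measurable (lborel \<Otimes>\<^sub>M lborel)"
    using measurable_compose[OF measurable_pair_swap'[of lborel lborel] f'] by (simp add: case_prod_beta')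
  from lborel.borel_measurable_nn_integral_fst[OF this]
  show "(\<lambda>t. \<integral>\<^sup>+x. f (x, t) \<partial>lborel) \<in> borel_measurable borel" by simp
qed

text \<open>By Tonelli the slices are \<open>f(x,t) dx\<close>. Finite mass over
  \<open>K \<times> (0,T)\<close> makes them finite on \<open>K\<close> for almost every
  \<open>t\<close>, and a countable exhaustion yields one null set of times outside which they are
  Radon.\<close>

lemma density_disintegration:
  fixes f :: "real \<times> real \<Rightarrow> real"
  assumes \<Omega>: "open \<Omega>" and f: "f \<in> borel_measurable borel" "\<And>z. 0 \<le> f z"
    and M: "M = density (lborel_on (cylinder \<Omega> T)) (\<lambda>z. ennreal (f z))" "M \<in> radon (cylinder \<Omega> T)"
    and fin: "\<And>K. compact K \<Longrightarrow> K \<subseteq> \<Omega> \<Longrightarrow> emeasure M (K \<times> {0<..<T}) < \<infinity>"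
  obtains w where "disintegration \<Omega> T M w"
    "AE t in time_measure T. w t = density (lborel_on \<Omega>) (\<lambda>x. ennreal (f (x, t)))"
proof -
  define k where "k t = density (lborel_on \<Omega>) (\<lambda>x. ennreal (f (x, t)))" for t
  define w where "w t = (if k t \<in> radon \<Omega> then k t else null_measure (borel_on \<Omega>))" for t
  have oc: "open (cylinder \<Omega> T)" using \<Omega> by (intro open_Times) auto
  have fe: "(\<lambda>z. ennreal (f z)) \<in> borel_measurable borel" using f by simp
  have fs: "(\<lambda>x. ennreal (f (x, t))) \<in> borel_measurable borel" for t
    by (rule section_measurable[OF fe])
  have ki: "(\<integral>\<^sup>+x. g (x, t) \<partial>k t) = (\<integral>\<^sup>+x. ennreal (f (x, t)) * g (x, t) * indicator \<Omega> x \<partial>lborel)"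
    if g: "g \<in> borel_measurable borel" for g :: "real \<times> real \<Rightarrow> ennreal" and t
    unfolding k_def by (rule nn_integral_density_on[OF \<Omega> fs section_measurable[OF g]])
  have h: "(\<lambda>z. ennreal (f z) * g z * indicator \<Omega> (fst z)) \<in> borel_measurable borel"
    if g: "g \<in> borel_measurable borel" for g :: "real \<times> real \<Rightarrow> ennreal"
    using fe g borel_compose_fst[of "indicator \<Omega> :: real \<Rightarrow> ennreal"] \<Omega> by simp
  have meas: "(\<lambda>t. \<integral>\<^sup>+x. g (x, t) \<partial>k t) \<in> borel_measurable borel"
    if g: "g \<in> borel_measurable borel" for g :: "real \<times> real \<Rightarrow> ennreal"
    unfolding ki[OF g] using tonelli_lborel(2)[OF h[OF g]] by simp
  have eq: "(\<integral>\<^sup>+z. g z \<partial>M) = (\<integral>\<^sup>+t. \<integral>\<^sup>+x. g (x, t) \<partial>k t \<partial>time_measure T)"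
    if g: "g \<in> borel_measurable borel" for g :: "real \<times> real \<Rightarrow> ennreal"
  proof -
    let ?h = "\<lambda>z. ennreal (f z) * g z * indicator \<Omega> (fst z)"
    have "(\<integral>\<^sup>+z. g z \<partial>M) = (\<integral>\<^sup>+z. ennreal (f z) * g z * indicator (cylinder \<Omega> T) z \<partial>lborel)"
      unfolding M(1) by (rule nn_integral_density_on[OF oc fe g])
    also have "\<dots> = (\<integral>\<^sup>+z. ?h z * indicator {0<..<T} (snd z) \<partial>lborel)"
      by (intro nn_integral_cong) (auto simp: indicator_def)
    also have "\<dots> = (\<integral>\<^sup>+t. \<integral>\<^sup>+x. ?h (x, t) * indicator {0<..<T} t \<partial>lborel \<partial>lborel)"
      using h[OF g] borel_compose_snd[of "indicator {0<..<T} :: real \<Rightarrow> ennreal"]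
      by (subst tonelli_lborel(1)) auto
    also have "\<dots> = (\<integral>\<^sup>+t. (\<integral>\<^sup>+x. ?h (x, t) \<partial>lborel) * indicator {0<..<T} t \<partial>lborel)"
      using section_measurable[OF h[OF g]] by (intro nn_integral_cong nn_integral_multc) simp
    also have "\<dots> = (\<integral>\<^sup>+t. \<integral>\<^sup>+x. g (x, t) \<partial>k t \<partial>time_measure T)"
      unfolding ki[OF g] using tonelli_lborel(2)[OF h[OF g]] by (subst nn_integral_time_measure) auto
    finally show ?thesis .
  qed
  obtain C where C: "\<And>n. compact (C n)" "\<And>n. C n \<subseteq> \<Omega>" "\<And>K. compact K \<Longrightarrow> K \<subseteq> \<Omega> \<Longrightarrow> \<exists>n::nat. K \<subseteq> C n"
    using compact_exhaustion[OF \<Omega>] by metis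
  have ks: "sets (k t) = sets (borel_on \<Omega>)" for t
    by (simp add: k_def sets_restrict_space)
  have "AE t in time_measure T. emeasure (k t) (C n) \<noteq> \<infinity>" for n
  proof -
    have Cn: "C n \<times> UNIV \<in> sets (borel :: (real \<times> real) measure)"
      using C(1) by (intro sets_Times_UNIV borel_compact)
    let ?g = "indicator (C n \<times> UNIV) :: real \<times> real \<Rightarrow> ennreal"
    have gm: "?g \<in> borel_measurable borel" using Cn by simp
    have kC: "(\<integral>\<^sup>+x. ?g (x, t) \<partial>k t) = emeasure (k t) (C n)" for t
    proof -
      have "(\<integral>\<^sup>+x. ?g (x, t) \<partial>k t) = (\<integral>\<^sup>+x. indicator (C n) x \<partial>k t)"
        by (intro nn_integral_cong) (simp add: indicator_def)
      also have "\<dots> = emeasure (k t) (C n)"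
        using C \<Omega> by (intro nn_integral_indicator) (auto simp: ks sets_borel_on intro: borel_compact)
      finally show ?thesis .
    qed
    have "(\<integral>\<^sup>+z. ?g z \<partial>M) = (\<integral>\<^sup>+z. indicator (C n \<times> {0<..<T}) z \<partial>M)"
      using radon_space[OF M(2)] by (intro nn_integral_cong) (auto simp: indicator_def)
    also have "\<dots> = emeasure M (C n \<times> {0<..<T})"
    proof (rule nn_integral_indicator)
      have "C n \<times> {0<..<T} = (C n \<times> UNIV) \<inter> cylinder \<Omega> T" using C(2) by auto
      then show "C n \<times> {0<..<T} \<in> sets M" using Cn oc by (simp add: radon_sets_iff[OF M(2) oc])
    qed
    finally have "(\<integral>\<^sup>+t. \<integral>\<^sup>+x. ?g (x, t) \<partial>k t \<partial>time_measure T) < \<infinity>"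
      using fin[OF C(1,2)] eq[OF gm] by simp
    then have "AE t in time_measure T. (\<integral>\<^sup>+x. ?g (x, t) \<partial>k t) \<noteq> \<infinity>"
      by (intro nn_integral_noteq_infinite borel_time_measurable meas[OF gm]) auto
    then show ?thesis unfolding kC .
  qed
  then have "AE t in time_measure T. \<forall>n. emeasure (k t) (C n) \<noteq> \<infinity>"
    by (simp add: AE_all_countable)
  then have ae: "AE t in time_measure T. w t = k t"
  proof (rule AE_mp, intro AE_I2 impI)
    fix t assume t: "\<forall>n. emeasure (k t) (C n) \<noteq> \<infinity>"
    have "k t \<in> radon \<Omega>"
    proof (rule radonI[OF ks])
      fix K assume K: "compact K" "K \<subseteq> \<Omega>"
      obtain n where n: "K \<subseteq> C n" using C(3)[OF K] by blast
      have "emeasure (k t) K \<le> emeasure (k t) (C n)"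
        using C(1,2)[of n] \<Omega> by (intro emeasure_mono n) (simp add: ks sets_borel_on borel_compact)
      also have "\<dots> < \<infinity>" using t by (simp add: less_top)
      finally show "emeasure (k t) K < \<infinity>" .
    qed
    then show "w t = k t" by (simp add: w_def)
  qed
  have "disintegration \<Omega> T M w"
  proof
    show "open \<Omega>" by fact
    show "M \<in> radon (cylinder \<Omega> T)" by fact
    show "w t \<in> radon \<Omega>" for t by (simp add: w_def null_measure_radon)
    fix g :: "real \<times> real \<Rightarrow> ennreal" assume g: "g \<in> borel_measurable borel"
    have aeg: "AE t in time_measure T. (\<integral>\<^sup>+x. g (x, t) \<partial>w t) = (\<integral>\<^sup>+x. g (x, t) \<partial>k t)"
      using ae by (rule AE_mp) auto
    show "fibred_int T M w g"
      unfolding fibred_int_def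
    proof
      show "(\<lambda>t. \<integral>\<^sup>+x. g (x, t) \<partial>w t) \<in> borel_measurable (time_measure T)"
        by (rule lebesgue_on_AE_measurable[OF _ borel_time_measurable[OF meas[OF g]] aeg]) auto
      show "(\<integral>\<^sup>+z. g z \<partial>M) = (\<integral>\<^sup>+t. \<integral>\<^sup>+x. g (x, t) \<partial>w t \<partial>time_measure T)"
        unfolding eq[OF g] using aeg by (intro nn_integral_cong_AE) auto
    qed
  qed
  then show thesis using that ae by (simp add: k_def)
qed

lemma emeasure_density_null:
  assumes \<Omega>: "open \<Omega>" and A: "A \<in> sets (borel_on \<Omega>)" "A \<in> null_sets lborel"
    and f: "f \<in> borel_measurable borel"
  shows "emeasure (density (lborel_on \<Omega>) f) A = 0"
proof -
  have A': "A \<subseteq> \<Omega>" "A \<in> sets borel" using A \<Omega> by (auto simp: sets_borel_on)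
  have L: "A \<in> null_sets (lborel_on \<Omega>)" using A A' by (simp add: null_sets_lborel_on[OF \<Omega>])
  have "f \<in> borel_measurable (lborel_on \<Omega>)" by (rule radon_measurable[OF f lborel_on_radon[OF \<Omega>]])
  then have "emeasure (density (lborel_on \<Omega>) f) A = (\<integral>\<^sup>+x. f x * indicator A x \<partial>lborel_on \<Omega>)"
    using L by (intro emeasure_density) auto
  also have "\<dots> = (\<integral>\<^sup>+x. 0 \<partial>lborel_on \<Omega>)"
    using AE_not_in[OF L] by (intro nn_integral_cong_AE) (auto elim!: AE_mp)
  finally show ?thesis by simp
qed

lemma null_sets_sections:
  assumes "Z \<in> null_sets (lborel :: (real \<times> real) measure)"
  shows "AE t in time_measure T. {x. (x, t) \<in> Z} \<in> null_sets lborel"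
proof -
  have Z: "Z \<in> sets borel" using assms by auto
  have m: "(indicator Z :: real \<times> real \<Rightarrow> ennreal) \<in> borel_measurable borel" using Z by simp
  have s: "(\<integral>\<^sup>+x. indicator Z (x, t) \<partial>lborel) = emeasure lborel {x. (x, t) \<in> Z}" for t
  proof -
    have "(\<integral>\<^sup>+x. indicator Z (x, t) \<partial>lborel) = (\<integral>\<^sup>+x. indicator {x. (x, t) \<in> Z} x \<partial>lborel)"
      by (intro nn_integral_cong) (simp add: indicator_def)
    also have "\<dots> = emeasure lborel {x. (x, t) \<in> Z}"
      using section_sets[OF Z, of t] by (intro nn_integral_indicator) auto
    finally show ?thesis .
  qed
  have "(\<integral>\<^sup>+z. indicator Z z \<partial>lborel) = 0" using assms Z by (simp add: null_sets_def)
  then have "(\<integral>\<^sup>+t. \<integral>\<^sup>+x. indicator Z (x, t) \<partial>lborel \<partial>lborel) = 0"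
    using tonelli_lborel(1)[OF m] by simp
  then have "AE t in lborel. emeasure lborel {x. (x, t) \<in> Z} = 0"
    using tonelli_lborel(2)[OF m] unfolding s by (subst (asm) nn_integral_0_iff_AE) auto
  then have "AE t in lebesgue. emeasure lborel {x. (x, t) \<in> Z} = 0" by (rule AE_completion)
  then have "AE t in time_measure T. emeasure lborel {x. (x, t) \<in> Z} = 0"
    by (subst AE_restrict_space_iff) auto
  then show ?thesis
    by (rule AE_mp) (use section_sets[OF Z] in \<open>auto intro!: AE_I2 simp: null_sets_def\<close>)
qed

section \<open>Slices of restrictions and of singular parts\<close>

lemma open_cylinder: "open \<Omega> \<Longrightarrow> open (cylinder \<Omega> T)"
  by (intro open_Times) auto

lemma Linf_radon_slice:
  assumes "M \<in> Linf_radon \<Omega> T"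
  shows "M \<in> radon (cylinder \<Omega> T)" "is_slicing \<Omega> T M (slice \<Omega> T M)"
  using assms someI_ex[of "is_slicing \<Omega> T M"] by (auto simp: Linf_radon_def slice_def)

text \<open>The slice of the restriction is selected by \<open>SOME\<close> independently of the
  slice of \<open>M\<close>. The restricted disintegration is itself a slicing, and uniqueness
  forces the selected one to agree with it almost everywhere.\<close>

lemma restr_slice:
  assumes \<Omega>: "open \<Omega>" and M: "M \<in> Linf_radon \<Omega> T" and Z: "Z \<in> sets borel"
    and d: "disintegration \<Omega> T M w" and ae: "AE t in time_measure T. w t = slice \<Omega> T M t"
  shows "disintegration \<Omega> T (restr M Z) (\<lambda>t. restr (w t) {x. (x, t) \<in> Z})"
    and "compact K \<Longrightarrow> K \<subseteq> \<Omega> \<Longrightarrow> \<exists>C. AE t in time_measure T. measure (restr (w t) {x. (x, t) \<in> Z}) K \<le> C"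
    and "AE t in time_measure T. slice \<Omega> T (restr M Z) t = restr (w t) {x. (x, t) \<in> Z}"
proof -
  interpret disintegration \<Omega> T M w by fact
  note sl = Linf_radon_slice(2)[OF M]
  show r: "disintegration \<Omega> T (restr M Z) (\<lambda>t. restr (w t) {x. (x, t) \<in> Z})"
    by (rule restr_disintegration[OF Z])
  show bound: "\<exists>C. AE t in time_measure T. measure (restr (w t) {x. (x, t) \<in> Z}) K \<le> C"
    if K: "compact K" "K \<subseteq> \<Omega>" for K
  proof -
    obtain C where C: "AE t in time_measure T. measure (w t) K \<le> C"
      using slicing_bound[OF sl ae K] by blast
    have le: "measure (restr (w t) {x. (x, t) \<in> Z}) K \<le> measure (w t) K" for t
    proof -
      have rc: "K \<in> rc_borel \<Omega>" by (rule compact_rc_borel[OF K])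
      note s = section_sets[OF Z, of t]
      have "emeasure (w t) (K \<inter> {x. (x, t) \<in> Z}) \<le> emeasure (w t) K"
        using radon_rc_borel_finite(1)[OF w open_\<Omega> rc] by (intro emeasure_mono) auto
      then show ?thesis
        unfolding measure_restr[OF w open_\<Omega> s radon_rc_borel_finite(1)[OF w open_\<Omega> rc]]
          radon_emeasure_eq[OF w open_\<Omega> rc] radon_emeasure_eq[OF w open_\<Omega> rc_borel_Int[OF rc s]]
        by (simp add: ennreal_le_iff)
    qed
    have "AE t in time_measure T. measure (restr (w t) {x. (x, t) \<in> Z}) K \<le> C"
      using C by (rule AE_mp) (intro AE_I2 impI order_trans[OF le])
    then show ?thesis by blast
  qed
  interpret R: disintegration \<Omega> T "restr M Z" "\<lambda>t. restr (w t) {x. (x, t) \<in> Z}" by fact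
  have slR: "is_slicing \<Omega> T (restr M Z) (\<lambda>t. restr (w t) {x. (x, t) \<in> Z})"
    by (rule R.is_slicing[OF bound])
  then have "restr M Z \<in> Linf_radon \<Omega> T" using R.u by (auto simp: Linf_radon_def)
  then have sl': "is_slicing \<Omega> T (restr M Z) (slice \<Omega> T (restr M Z))" by (rule Linf_radon_slice)
  obtain w' where w': "disintegration \<Omega> T (restr M Z) w'"
    "AE t in time_measure T. w' t = slice \<Omega> T (restr M Z) t"
    by (rule slicing_disintegration[OF \<Omega> R.u sl'])
  have "AE t in time_measure T. restr (w t) {x. (x, t) \<in> Z} = w' t"
    by (rule disintegration_unique[OF r w'(1) slicing_plateau_finite[OF slR]])
  then show "AE t in time_measure T. slice \<Omega> T (restr M Z) t = restr (w t) {x. (x, t) \<in> Z}"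
    using w'(2) by eventually_elim simp
qed

text \<open>The mass over \<open>K\<close> is at most \<open>C\<close> times the length of the time
  interval.\<close>

lemma (in disintegration) cylinder_finite:
  assumes K: "compact K" "K \<subseteq> \<Omega>" and C: "AE t in time_measure T. measure (w t) K \<le> C"
  shows "emeasure u (K \<times> {0<..<T}) < \<infinity>"
proof -
  let ?F = "indicator (K \<times> UNIV) :: real \<times> real \<Rightarrow> real"
  have Km: "K \<times> UNIV \<in> sets (borel :: (real \<times> real) measure)"
    using K(1) by (intro sets_Times_UNIV borel_compact)
  have "integrable u ?F"
    by (rule fubini_nonneg(1)[OF _ K, where B = 1 and C = C]) (use Km C in auto)
  then have "emeasure u ((K \<times> UNIV) \<inter> space u) < \<infinity>"
    by (simp add: integrable_indicator_iff)
  moreover have "(K \<times> UNIV) \<inter> space u = K \<times> {0<..<T}"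
    using K(2) radon_space[OF u] by auto
  ultimately show ?thesis by simp
qed

text \<open>Off \<open>Z\<close> the measure has a density, so by uniqueness its slices there are
  \<open>f(x,t) dx\<close> and do not charge null sets. Thus the sections of \<open>Z\<close>
  capture the singular parts of the slices.\<close>

lemma ac_sections:
  assumes \<Omega>: "open \<Omega>" and M: "M \<in> Linf_radon \<Omega> T" and Z: "Z \<in> sets borel"
    and d: "disintegration \<Omega> T M w" and ae: "AE t in time_measure T. w t = slice \<Omega> T M t"
    and f: "f \<in> borel_measurable borel" "\<And>z. 0 \<le> f z"
      "restr M (- Z) = density (lborel_on (cylinder \<Omega> T)) (\<lambda>z. ennreal (f z :: real))"
  shows "AE t in time_measure T. \<forall>A\<in>sets (borel_on \<Omega>). A \<in> null_sets lborel \<longrightarrow>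
    emeasure (w t) (A - {x. (x, t) \<in> Z}) = 0"
proof -
  interpret disintegration \<Omega> T M w by fact
  have Z': "- Z \<in> sets borel" using Z by auto
  note r = restr_slice[OF \<Omega> M Z' d ae]
  interpret R: disintegration \<Omega> T "restr M (- Z)" "\<lambda>t. restr (w t) {x. (x, t) \<in> - Z}" by (rule r(1))
  have fin: "emeasure (restr M (- Z)) (K \<times> {0<..<T}) < \<infinity>" if "compact K" "K \<subseteq> \<Omega>" for K
    using r(2)[OF that] R.cylinder_finite[OF that] by blast
  obtain k where k: "disintegration \<Omega> T (restr M (- Z)) k"
    "AE t in time_measure T. k t = density (lborel_on \<Omega>) (\<lambda>x. ennreal (f (x, t)))"
    by (rule density_disintegration[OF \<Omega> f R.u fin])
  have "AE t in time_measure T. restr (w t) {x. (x, t) \<in> - Z} = k t"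
    by (rule disintegration_unique[OF r(1) k(1) slicing_plateau_finite[OF R.is_slicing[OF r(2)]]])
  then show ?thesis
    using k(2)
  proof eventually_elim
    fix t assume t: "restr (w t) {x. (x, t) \<in> - Z} = k t"
      "k t = density (lborel_on \<Omega>) (\<lambda>x. ennreal (f (x, t)))"
    show "\<forall>A\<in>sets (borel_on \<Omega>). A \<in> null_sets lborel \<longrightarrow> emeasure (w t) (A - {x. (x, t) \<in> Z}) = 0"
    proof (intro ballI impI)
      fix A assume A: "A \<in> sets (borel_on \<Omega>)" "A \<in> null_sets lborel"
      have m: "(\<lambda>z. ennreal (f z)) \<in> borel_measurable borel" using f(1) by simp
      have "emeasure (restr (w t) {x. (x, t) \<in> - Z}) A = 0"
        unfolding t by (rule emeasure_density_null[OF \<Omega> A section_measurable[OF m]])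
      then have "emeasure (w t) (A \<inter> {x. (x, t) \<in> - Z}) = 0"
        using A(1) by (subst (asm) emeasure_restr[OF w \<Omega> section_sets[OF Z']]) (simp_all add: radon_sets[OF w])
      moreover have "A \<inter> {x. (x, t) \<in> - Z} = A - {x. (x, t) \<in> Z}" by auto
      ultimately show "emeasure (w t) (A - {x. (x, t) \<in> Z}) = 0" by simp
    qed
  qed
qed

text \<open>For almost every \<open>t\<close> the section of a Hahn set of \<open>u\<close> is a
  Hahn set of the slice, and the section of \<open>Z\<close> carries its singular part. Slicing
  therefore commutes with Jordan parts and with singular parts; \<open>mp\<close> and
  \<open>mn\<close> are the common values.\<close>

lemma slice_structure:
  assumes \<Omega>: "open \<Omega>" and u: "u \<in> Linf_signed_radon \<Omega> T"
  obtains mp mn where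
    "disintegration \<Omega> T (pos_part (cylinder \<Omega> T) (sing_part (cylinder \<Omega> T) u)) mp"
    "disintegration \<Omega> T (neg_part (cylinder \<Omega> T) (sing_part (cylinder \<Omega> T) u)) mn"
    "\<And>K. compact K \<Longrightarrow> K \<subseteq> \<Omega> \<Longrightarrow> \<exists>C. AE t in time_measure T. measure (mp t) K \<le> C"
    "\<And>K. compact K \<Longrightarrow> K \<subseteq> \<Omega> \<Longrightarrow> \<exists>C. AE t in time_measure T. measure (mn t) K \<le> C"
    "AE t in time_measure T.
       signed_slice \<Omega> T (sing_part (cylinder \<Omega> T) u) t \<in> signed_radon \<Omega> \<and>
       pos_part \<Omega> (signed_slice \<Omega> T (sing_part (cylinder \<Omega> T) u) t) = mp t \<and>
       neg_part \<Omega> (signed_slice \<Omega> T (sing_part (cylinder \<Omega> T) u) t) = mn t \<and>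
       pos_part \<Omega> (sing_part \<Omega> (signed_slice \<Omega> T u t)) = mp t \<and>
       neg_part \<Omega> (sing_part \<Omega> (signed_slice \<Omega> T u t)) = mn t"
proof -
  let ?C = "cylinder \<Omega> T"
  let ?us = "sing_part ?C u"
  have us: "u \<in> signed_radon ?C" and P: "pos_part ?C u \<in> Linf_radon \<Omega> T" and N: "neg_part ?C u \<in> Linf_radon \<Omega> T"
    using u by (auto simp: Linf_signed_radon_def)
  note C = open_cylinder[OF \<Omega>, of T]
  obtain Z where Z: "carries_sing ?C u Z" using carries_sing_ex[OF us C] by blast
  have Zb: "Z \<in> sets borel" "Z \<in> null_sets lborel" using Z by (auto simp: carries_sing_def)
  obtain wp where wp: "disintegration \<Omega> T (pos_part ?C u) wp"
    "AE t in time_measure T. wp t = slice \<Omega> T (pos_part ?C u) t"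
    by (rule slicing_disintegration[OF \<Omega> Linf_radon_slice[OF P]])
  obtain wn where wn: "disintegration \<Omega> T (neg_part ?C u) wn"
    "AE t in time_measure T. wn t = slice \<Omega> T (neg_part ?C u) t"
    by (rule slicing_disintegration[OF \<Omega> Linf_radon_slice[OF N]])
  interpret P: disintegration \<Omega> T "pos_part ?C u" wp by (rule wp(1))
  interpret N: disintegration \<Omega> T "neg_part ?C u" wn by (rule wn(1))
  obtain D where D: "D \<in> sets borel" "emeasure (pos_part ?C u) (?C - D) = 0" "emeasure (neg_part ?C u) (?C \<inter> D) = 0"
    using hahn_set[OF us C] by blast
  have Dp: "AE t in time_measure T. emeasure (wp t) ({x. (x, t) \<in> - D} \<inter> \<Omega>) = 0"
    using D by (intro P.sections_null) (auto simp: Diff_eq Int_commute)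
  have Dn: "AE t in time_measure T. emeasure (wn t) ({x. (x, t) \<in> D} \<inter> \<Omega>) = 0"
    using D by (intro N.sections_null) (auto simp: Int_commute)
  obtain f g where f: "f \<in> borel_measurable borel" "\<And>x. 0 \<le> f x" "restr (pos_part ?C u) (- Z) = density (lborel_on ?C) (\<lambda>z. ennreal (f z))"
    and g: "g \<in> borel_measurable borel" "\<And>x. 0 \<le> g x" "restr (neg_part ?C u) (- Z) = density (lborel_on ?C) (\<lambda>z. ennreal (g z))"
    and "ac_density ?C u \<in> borel_measurable borel" "AE z in lborel. z \<in> ?C \<longrightarrow> ac_density ?C u z = f z - g z"
    by (rule ac_density_eq[OF us C Z], rule that) auto
  note acp = ac_sections[OF \<Omega> P Zb(1) wp f] and acn = ac_sections[OF \<Omega> N Zb(1) wn g]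
  define mp where "mp t = restr (wp t) {x. (x, t) \<in> Z}" for t
  define mn where "mn t = restr (wn t) {x. (x, t) \<in> Z}" for t
  note rp = restr_slice[OF \<Omega> P Zb(1) wp, folded mp_def] and rn = restr_slice[OF \<Omega> N Zb(1) wn, folded mn_def]
  note psp = pos_part_sing_part[OF us C Z] and nsp = neg_part_sing_part[OF us C Z]
  have "AE t in time_measure T.
       signed_slice \<Omega> T ?us t \<in> signed_radon \<Omega> \<and>
       pos_part \<Omega> (signed_slice \<Omega> T ?us t) = mp t \<and>
       neg_part \<Omega> (signed_slice \<Omega> T ?us t) = mn t \<and>
       pos_part \<Omega> (sing_part \<Omega> (signed_slice \<Omega> T u t)) = mp t \<and>
       neg_part \<Omega> (sing_part \<Omega> (signed_slice \<Omega> T u t)) = mn t"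
    using wp(2) wn(2) Dp Dn acp acn rp(3) rn(3) null_sets_sections[OF Zb(2), of T]
  proof eventually_elim
    fix t
    assume wpt: "wp t = slice \<Omega> T (pos_part ?C u) t" and wnt: "wn t = slice \<Omega> T (neg_part ?C u) t"
      and Dpt: "emeasure (wp t) ({x. (x, t) \<in> - D} \<inter> \<Omega>) = 0"
      and Dnt: "emeasure (wn t) ({x. (x, t) \<in> D} \<inter> \<Omega>) = 0"
      and acpt: "\<forall>A\<in>sets (borel_on \<Omega>). A \<in> null_sets lborel \<longrightarrow> emeasure (wp t) (A - {x. (x, t) \<in> Z}) = 0"
      and acnt: "\<forall>A\<in>sets (borel_on \<Omega>). A \<in> null_sets lborel \<longrightarrow> emeasure (wn t) (A - {x. (x, t) \<in> Z}) = 0"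
      and mpt: "slice \<Omega> T (restr (pos_part ?C u) Z) t = mp t"
      and mnt: "slice \<Omega> T (restr (neg_part ?C u) Z) t = mn t"
      and Zt: "{x. (x, t) \<in> Z} \<in> null_sets lborel"
    define Dt Zs where "Dt = {x. (x, t) \<in> D}" and "Zs = {x. (x, t) \<in> Z}"
    have Dtb: "Dt \<in> sets borel" and Zsb: "Zs \<in> sets borel"
      unfolding Dt_def Zs_def by (rule section_sets[OF D(1)], rule section_sets[OF Zb(1)])
    have ut: "signed_slice \<Omega> T u t = (\<lambda>A. measure (wp t) A - measure (wn t) A)"
      by (rule ext) (simp add: signed_slice_def wpt wnt)
    have ust: "signed_slice \<Omega> T ?us t = (\<lambda>A. measure (mp t) A - measure (mn t) A)"
      by (rule ext) (simp add: signed_slice_def psp nsp mpt mnt)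
    have utr: "signed_slice \<Omega> T u t \<in> signed_radon \<Omega>"
      unfolding ut by (rule signed_radon_diff[OF P.w N.w])
    have Dpt': "emeasure (wp t) (\<Omega> - Dt) = 0" and Dnt': "emeasure (wn t) (\<Omega> \<inter> Dt) = 0"
      using Dpt Dnt by (auto simp: Dt_def Diff_eq Compl_eq Int_commute Collect_neg_eq[symmetric])
    have pu: "pos_part \<Omega> (signed_slice \<Omega> T u t) = wp t"
      by (rule pos_part_eqI[OF P.w N.w \<Omega> Dtb _ Dpt' Dnt']) (simp add: ut)
    have nu: "neg_part \<Omega> (signed_slice \<Omega> T u t) = wn t"
      by (rule neg_part_eqI[OF P.w N.w \<Omega> Dtb _ Dpt' Dnt']) (simp add: ut)
    \<comment> \<open>The section of \<open>Z\<close> is null by Tonelli and captures the mass on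
      null sets by \<open>ac_sections\<close>; hence it evaluates the \<open>SOME\<close> in
      \<open>sing_part\<close> for the slice.\<close>
    have cs: "carries_sing \<Omega> (signed_slice \<Omega> T u t) Zs"
      using Zt acpt acnt unfolding carries_sing_def pu nu Zs_def by blast
    have eqs: "signed_slice \<Omega> T ?us t A = signed_slice \<Omega> T u t (A \<inter> Zs)" if A: "A \<in> rc_borel \<Omega>" for A
      unfolding ust ut mp_def mn_def Zs_def[symmetric]
      by (simp add: measure_restr[OF P.w \<Omega> Zsb radon_rc_borel_finite(1)[OF P.w \<Omega> A]]
        measure_restr[OF N.w \<Omega> Zsb radon_rc_borel_finite(1)[OF N.w \<Omega> A]])
    have 1: "signed_slice \<Omega> T ?us t \<in> signed_radon \<Omega>"
      by (rule signed_radon_cong[OF signed_radon_restr[OF utr \<Omega> Zsb] eqs])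
    have 2: "pos_part \<Omega> (signed_slice \<Omega> T ?us t) = mp t"
    proof -
      have "pos_part \<Omega> (signed_slice \<Omega> T ?us t) = pos_part \<Omega> (\<lambda>A. signed_slice \<Omega> T u t (A \<inter> Zs))"
        by (rule pos_part_cong[OF eqs])
      also have "\<dots> = restr (pos_part \<Omega> (signed_slice \<Omega> T u t)) Zs"
        by (rule pos_part_restr[OF utr \<Omega> Zsb])
      also have "\<dots> = mp t" unfolding pu mp_def Zs_def ..
      finally show ?thesis .
    qed
    have 3: "neg_part \<Omega> (signed_slice \<Omega> T ?us t) = mn t"
    proof -
      have "neg_part \<Omega> (signed_slice \<Omega> T ?us t) = neg_part \<Omega> (\<lambda>A. signed_slice \<Omega> T u t (A \<inter> Zs))"
        by (rule neg_part_cong[OF eqs])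
      also have "\<dots> = restr (neg_part \<Omega> (signed_slice \<Omega> T u t)) Zs"
        by (rule neg_part_restr[OF utr \<Omega> Zsb])
      also have "\<dots> = mn t" unfolding nu mn_def Zs_def ..
      finally show ?thesis .
    qed
    have 4: "pos_part \<Omega> (sing_part \<Omega> (signed_slice \<Omega> T u t)) = mp t"
      using pos_part_sing_part[OF utr \<Omega> cs] by (simp add: pu mp_def Zs_def)
    have 5: "neg_part \<Omega> (sing_part \<Omega> (signed_slice \<Omega> T u t)) = mn t"
      using neg_part_sing_part[OF utr \<Omega> cs] by (simp add: nu mn_def Zs_def)
    show "signed_slice \<Omega> T ?us t \<in> signed_radon \<Omega> \<and>
       pos_part \<Omega> (signed_slice \<Omega> T ?us t) = mp t \<and> neg_part \<Omega> (signed_slice \<Omega> T ?us t) = mn t \<and>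
       pos_part \<Omega> (sing_part \<Omega> (signed_slice \<Omega> T u t)) = mp t \<and>
       neg_part \<Omega> (sing_part \<Omega> (signed_slice \<Omega> T u t)) = mn t"
      using 1 2 3 4 5 by blast
  qed
  then show thesis
    using rp(1,2) rn(1,2) unfolding psp[symmetric] nsp[symmetric] by (intro that[of mp mn])
qed

section \<open>Integration against the total variation\<close>

lemma nn_integral_add_measure:
  assumes sets: "sets N = sets M" and f: "f \<in> borel_measurable M"
  shows "(\<integral>\<^sup>+x. f x \<partial>add_measure M N) = (\<integral>\<^sup>+x. f x \<partial>M) + (\<integral>\<^sup>+x. f x \<partial>N)"
  using f
proof (induction rule: borel_measurable_induct)
  have sp: "space (add_measure M N) = space M" "space N = space M"
    by (rule sets_eq_imp_space_eq[OF sets_add_measure], rule sets_eq_imp_space_eq[OF sets])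
  have m: "measurable (add_measure M N) (borel :: ennreal measure) = measurable M borel"
    "measurable N (borel :: ennreal measure) = measurable M borel"
    by (auto intro!: measurable_cong_sets simp: sets)
  {
    case (cong f g)
    have "(\<integral>\<^sup>+x. f x \<partial>L) = (\<integral>\<^sup>+x. g x \<partial>L)" if "space L = space M" for L
      using that cong by (intro nn_integral_cong) auto
    with sp cong show ?case by simp
  next
    case (set A)
    then show ?case using sets by (simp add: emeasure_add_measure)
  next
    case (mult u c)
    then show ?case using m by (simp add: nn_integral_cmult distrib_left)
  next
    case (add u v)
    then show ?case using m by (simp add: nn_integral_add ac_simps)
  next
    case (seq U)
    have "(\<integral>\<^sup>+x. (SUP i. U i x) \<partial>add_measure M N) = (SUP i. \<integral>\<^sup>+x. U i x \<partial>add_measure M N)"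
      using seq m by (intro nn_integral_monotone_convergence_SUP) auto
    also have "\<dots> = (SUP i. (\<integral>\<^sup>+x. U i x \<partial>M) + (\<integral>\<^sup>+x. U i x \<partial>N))" using seq by simp
    also have "\<dots> = (SUP i. \<integral>\<^sup>+x. U i x \<partial>M) + (SUP i. \<integral>\<^sup>+x. U i x \<partial>N)"
      using seq by (intro ennreal_SUP_add) (auto simp: incseq_def le_fun_def intro!: nn_integral_mono)
    also have "\<dots> = (\<integral>\<^sup>+x. (SUP i. U i x) \<partial>M) + (\<integral>\<^sup>+x. (SUP i. U i x) \<partial>N)"
      using seq m by (subst (1 2) nn_integral_monotone_convergence_SUP) auto
    finally show ?case by (simp add: SUP_apply[abs_def] image_image)
  }
qed

lemma integral_add_measure:
  fixes f :: "'a \<Rightarrow> real"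
  assumes sets: "sets N = sets M" and M: "integrable M f" and N: "integrable N f"
  shows "(LINT x|add_measure M N. f x) = (LINT x|M. f x) + (LINT x|N. f x)"
proof -
  have [measurable]: "f \<in> borel_measurable M" using M by auto
  have m: "f \<in> borel_measurable (add_measure M N)"
    using M by (simp cong: measurable_cong_sets)
  have p: "(\<integral>\<^sup>+x. ennreal (f x) \<partial>add_measure M N) = (\<integral>\<^sup>+x. ennreal (f x) \<partial>M) + (\<integral>\<^sup>+x. ennreal (f x) \<partial>N)"
    and n: "(\<integral>\<^sup>+x. ennreal (- f x) \<partial>add_measure M N) = (\<integral>\<^sup>+x. ennreal (- f x) \<partial>M) + (\<integral>\<^sup>+x. ennreal (- f x) \<partial>N)"
    by (auto intro!: nn_integral_add_measure[OF sets])
  have fin: "(\<integral>\<^sup>+x. ennreal (f x) \<partial>M) < \<infinity>" "(\<integral>\<^sup>+x. ennreal (- f x) \<partial>M) < \<infinity>"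
    "(\<integral>\<^sup>+x. ennreal (f x) \<partial>N) < \<infinity>" "(\<integral>\<^sup>+x. ennreal (- f x) \<partial>N) < \<infinity>"
    using M N by (auto simp: real_integrable_def less_top)
  have "integrable (add_measure M N) f"
    using m fin unfolding real_integrable_def p n by (simp add: less_top)
  then show ?thesis
    using M N fin by (simp add: real_lebesgue_integral_def p n enn2real_plus)
qed

lemma total_variation_eq:
  assumes "\<mu> \<in> signed_radon S" "open S"
  shows "total_variation S \<mu> = add_measure (pos_part S \<mu>) (neg_part S \<mu>)"
  by (simp add: total_variation_def add_measure_def radon_space[OF pos_part_radon[OF assms]]
    radon_sets[OF pos_part_radon[OF assms]])

section \<open>Test functions of product form\<close>

text \<open>The complement of \<open>K\<close> is open, so the derivative vanishes there too, and
  flux terms keep the compact support of the test function.\<close>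

lemma C1c_E:
  assumes "\<rho> \<in> C1c S"
  obtains K \<rho>' B where "compact K" "K \<subseteq> S" "\<And>x. x \<notin> K \<Longrightarrow> \<rho> x = 0" "\<And>x. x \<notin> K \<Longrightarrow> \<rho>' x = 0"
    "continuous_on UNIV \<rho>" "continuous_on UNIV \<rho>'" "\<And>x. (\<rho> has_real_derivative \<rho>' x) (at x)"
    "\<And>x. \<bar>\<rho> x\<bar> \<le> B" "\<And>x. \<bar>\<rho>' x\<bar> \<le> B"
proof -
  obtain K \<rho>' where K: "compact K" "K \<subseteq> S" "\<And>x. x \<notin> K \<Longrightarrow> \<rho> x = 0"
    and d: "continuous_on UNIV \<rho>'" "\<And>x. (\<rho> has_real_derivative \<rho>' x) (at x)"
    using assms by (auto simp: C1c_def)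
  have d0: "\<rho>' x = 0" if "x \<notin> K" for x
  proof -
    have "open (- K)" using K(1) by (auto intro: compact_imp_closed open_Compl)
    have "((\<lambda>x. 0) has_real_derivative 0) (at x)" by simp
    then have "(\<rho> has_real_derivative 0) (at x)"
      by (rule has_field_derivative_transform_within_open[OF _ \<open>open (- K)\<close>]) (use that K(3) in auto)
    then show ?thesis using DERIV_unique d(2) by blast
  qed
  have c: "continuous_on UNIV \<rho>" by (rule C1c_continuous[OF assms])
  obtain B1 where B1: "0 \<le> B1" "\<And>x. x \<in> K \<Longrightarrow> \<bar>\<rho> x\<bar> \<le> B1"
    by (rule continuous_compact_bounded[OF c K(1)]) auto
  obtain B2 where B2: "0 \<le> B2" "\<And>x. x \<in> K \<Longrightarrow> \<bar>\<rho>' x\<bar> \<le> B2"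
    by (rule continuous_compact_bounded[OF d(1) K(1)]) auto
  have "\<bar>\<rho> x\<bar> \<le> max B1 B2" "\<bar>\<rho>' x\<bar> \<le> max B1 B2" for x
    using B1(2)[of x] B2(2)[of x] B1(1) B2(1) K(3)[of x] d0[of x] by (cases "x \<in> K"; auto)+
  then show thesis using that[OF K d0 c d] by blast
qed

text \<open>Difference quotients in time act only on the scalar factor, so uniform convergence, also
  of the space derivatives, reduces to scalar limits times a bounded function.\<close>

lemma C1_C1c_prod:
  assumes \<rho>: "\<rho> \<in> C1c \<Omega>" and \<phi>: "\<And>t. (\<phi> has_real_derivative \<phi>' t) (at t)" "continuous_on UNIV \<phi>'"
  shows "(\<lambda>t x. \<phi> t * \<rho> x) \<in> C1_C1c \<Omega> T"
proof -
  obtain K \<rho>' B where K: "compact K" "K \<subseteq> \<Omega>" "\<And>x. x \<notin> K \<Longrightarrow> \<rho> x = 0"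
    and \<rho>': "continuous_on UNIV \<rho>'" "\<And>x. (\<rho> has_real_derivative \<rho>' x) (at x)"
    and B: "\<And>x. \<bar>\<rho> x\<bar> \<le> B" "\<And>x. \<bar>\<rho>' x\<bar> \<le> B"
    by (rule C1c_E[OF \<rho>]) blast
  have C1: "(\<lambda>x. c * \<rho> x) C1_differentiable_on \<Omega>" for c
    unfolding C1_differentiable_on_def
  proof (intro exI[of _ "\<lambda>x. c * \<rho>' x"] conjI ballI)
    show "((\<lambda>x. c * \<rho> x) has_vector_derivative c * \<rho>' x) (at x)" for x
      using DERIV_cmult[OF \<rho>'(2), of c x] by (simp add: has_real_derivative_iff_has_vector_derivative)
    show "continuous_on \<Omega> (\<lambda>x. c * \<rho>' x)"
      using \<rho>'(1) by (intro continuous_intros) (auto intro: continuous_on_subset)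
  qed
  have d\<rho>: "deriv (\<lambda>x. c * \<rho> x) = (\<lambda>x. c * \<rho>' x)" for c
    by (rule ext, rule DERIV_imp_deriv) (rule DERIV_cmult[OF \<rho>'(2)])
  have q: "(\<lambda>x. (\<phi> s * \<rho> x - \<phi> t * \<rho> x) / (s - t)) = (\<lambda>x. (\<phi> s - \<phi> t) / (s - t) * \<rho> x)" for s t
    by (simp add: left_diff_distrib[symmetric])
  have lim: "((\<lambda>s. (\<phi> s - \<phi> t) / (s - t)) \<longlongrightarrow> \<phi>' t) (at t within X)" for t X
    using has_field_derivative_at_within[OF \<phi>(1), of t X] unfolding has_field_derivative_iff .
  have lim': "(\<phi>' \<longlongrightarrow> \<phi>' t) (at t within X)" for t X
    using \<phi>(2) by (auto simp: continuous_on_def intro: tendsto_within_subset)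
  show ?thesis
    unfolding C1_C1c_def
  proof (intro CollectI exI[of _ K] exI[of _ "\<lambda>t x. \<phi>' t * \<rho> x"] conjI ballI K(1,2) C1)
    fix t assume "t \<in> {0..T}"
    show "C1_limit \<Omega> (\<lambda>s x. (\<phi> s * \<rho> x - \<phi> t * \<rho> x) / (s - t)) (\<lambda>x. \<phi>' t * \<rho> x) (at t within {0..T})"
      unfolding C1_limit_def q d\<rho> using B by (intro conjI uniform_limit_mult_bounded[OF lim])
    show "C1_limit \<Omega> (\<lambda>t x. \<phi>' t * \<rho> x) (\<lambda>x. \<phi>' t * \<rho> x) (at t within {0..T})"
      unfolding C1_limit_def d\<rho> using B by (intro conjI uniform_limit_mult_bounded[OF lim'])
  qed (use K(3) in auto)
qed

lemma real_antiderivative: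
  fixes \<psi> :: "real \<Rightarrow> real"
  assumes "continuous_on UNIV \<psi>"
  obtains \<Phi> where "\<And>x. (\<Phi> has_real_derivative \<psi> x) (at x)"
proof (rule that)
  fix x :: real
  define a b where "a = - \<bar>x\<bar> - 1" and "b = \<bar>x\<bar> + 1"
  have "((\<lambda>u. LBINT y=ereal 0..ereal u. \<psi> y) has_vector_derivative \<psi> x) (at x within {a..b})"
    using assms by (intro interval_integral_FTC2) (auto simp: a_def b_def intro: continuous_on_subset)
  moreover have "at x within {a..b} = at x"
    by (rule at_within_interior) (auto simp: a_def b_def)
  ultimately show "((\<lambda>u. LBINT y=ereal 0..ereal u. \<psi> y) has_real_derivative \<psi> x) (at x)"
    by (simp add: has_real_derivative_iff_has_vector_derivative)
qed

lemma integral_C1c_deriv: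
  assumes K: "compact K" "\<And>x. x \<notin> K \<Longrightarrow> \<rho> x = 0" "\<And>x. x \<notin> K \<Longrightarrow> \<rho>' x = 0"
    and \<rho>': "continuous_on UNIV \<rho>'" "\<And>x. (\<rho> has_real_derivative \<rho>' x) (at x)"
  shows "(LINT x|lborel. \<rho>' x) = (0 :: real)"
proof -
  obtain r where r: "K \<subseteq> {-r<..<r}" "r > 0"
  proof -
    obtain r where "r > 0" "K \<subseteq> ball 0 r" using bounded_subset_ballD[OF compact_imp_bounded[OF K(1)], of 0] by auto
    then show thesis using that[of r] by (simp add: ball_eq_greaterThanLessThan)
  qed
  have "(LINT x|lborel. \<rho>' x) = (LINT x:{-r..r}|lborel. \<rho>' x)"
    unfolding set_lebesgue_integral_def
  proof (intro Bochner_Integration.integral_cong refl)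
    fix x show "\<rho>' x = indicat_real {-r..r} x *\<^sub>R \<rho>' x"
    proof (cases "x \<in> K")
      case True
      then have "x \<in> {-r<..<r}" using r(1) by blast
      then show ?thesis by simp
    qed (simp add: K(3))
  qed
  also have "\<dots> = \<rho> r - \<rho> (-r)"
  proof -
    have "has_bochner_integral lborel (\<lambda>x. \<rho>' x * indicator {-r..r} x) (\<rho> r - \<rho> (- r))"
      using r(2) \<rho>' by (intro has_bochner_integral_FTC_Icc_real) (auto simp: continuous_on_eq_continuous_at)
    then show ?thesis
      unfolding set_lebesgue_integral_def by (simp add: has_bochner_integral_iff mult.commute)
  qed
  also have "\<dots> = 0" using K(2)[of r] K(2)[of "-r"] r by force
  finally show ?thesis .
qed

section \<open>Integrability of the regular part\<close>

text \<open>Local integrability on the open cylinder says nothing near the times 0 and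
  \<open>T\<close>. The essentially bounded slice masses give integrability up to both ends, as the
  integrals over the whole cylinder require.\<close>

lemma ac_density_cylinder:
  assumes \<Omega>: "open \<Omega>" and u: "u \<in> Linf_signed_radon \<Omega> T"
  shows "ac_density (cylinder \<Omega> T) u \<in> borel_measurable borel"
    and "compact K \<Longrightarrow> K \<subseteq> \<Omega> \<Longrightarrow> set_integrable lborel (K \<times> {0<..<T}) (ac_density (cylinder \<Omega> T) u)"
proof -
  let ?C = "cylinder \<Omega> T"
  have us: "u \<in> signed_radon ?C" and P: "pos_part ?C u \<in> Linf_radon \<Omega> T" and N: "neg_part ?C u \<in> Linf_radon \<Omega> T"
    using u by (auto simp: Linf_signed_radon_def)
  note C = open_cylinder[OF \<Omega>, of T]
  obtain Z where Z: "carries_sing ?C u Z" using carries_sing_ex[OF us C] by blast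
  have Z': "- Z \<in> sets borel" using Z by (auto simp: carries_sing_def)
  obtain f g where f: "f \<in> borel_measurable borel" "\<And>x. 0 \<le> f x" "restr (pos_part ?C u) (- Z) = density (lborel_on ?C) (\<lambda>z. ennreal (f z))"
    and g: "g \<in> borel_measurable borel" "\<And>x. 0 \<le> g x" "restr (neg_part ?C u) (- Z) = density (lborel_on ?C) (\<lambda>z. ennreal (g z))"
    and a: "ac_density ?C u \<in> borel_measurable borel" and ae: "AE z in lborel. z \<in> ?C \<longrightarrow> ac_density ?C u z = f z - g z"
    by (rule ac_density_eq[OF us C Z], rule that) auto
  show "ac_density ?C u \<in> borel_measurable borel" by (rule a)
  assume K: "compact K" "K \<subseteq> \<Omega>"
  let ?A = "K \<times> {0<..<T}"
  have A: "?A \<subseteq> ?C" "?A \<in> sets borel"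
  proof -
    have "K \<times> UNIV \<in> sets (borel :: (real \<times> real) measure)"
      using K(1) by (intro sets_Times_UNIV borel_compact)
    moreover have "?A = (K \<times> UNIV) \<inter> ?C" using K(2) by auto
    ultimately show "?A \<in> sets borel" using C by simp
  qed (use K(2) in auto)
  have fin: "emeasure (restr M (- Z)) ?A < \<infinity>" if M: "M \<in> Linf_radon \<Omega> T" for M
  proof -
    obtain w where w: "disintegration \<Omega> T M w" "AE t in time_measure T. w t = slice \<Omega> T M t"
      by (rule slicing_disintegration[OF \<Omega> Linf_radon_slice[OF M]])
    obtain c where "AE t in time_measure T. measure (restr (w t) {x. (x, t) \<in> - Z}) K \<le> c"
      using restr_slice(2)[OF \<Omega> M Z' w K] by blast
    then show ?thesis by (rule disintegration.cylinder_finite[OF restr_slice(1)[OF \<Omega> M Z' w] K])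
  qed
  have fi: "set_integrable lborel ?A f"
    by (rule set_integrable_density_on[OF C f A]) (use fin[OF P] in simp)
  have gi: "set_integrable lborel ?A g"
    by (rule set_integrable_density_on[OF C g A]) (use fin[OF N] in simp)
  have "set_integrable lborel ?A (\<lambda>z. f z - g z)" using fi gi by (rule set_integral_diff)
  then show "set_integrable lborel ?A (ac_density ?C u)"
    unfolding set_integrable_def
    by (subst integrable_cong_AE) (use ae A a f(1) g(1) in \<open>auto simp: indicator_def elim!: AE_mp\<close>)
qed

lemma integral_restr:
  fixes f :: "'a::euclidean_space \<Rightarrow> real"
  assumes M: "M \<in> radon S" and Z: "Z \<in> sets borel" and f: "f \<in> borel_measurable M"
  shows "(LINT x|restr M Z. f x) = (LINT x|M. indicator Z x * f x)"
proof -
  have "(indicator Z :: 'a \<Rightarrow> real) \<in> borel_measurable M" using Z by (intro radon_measurable[OF _ M]) auto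
  moreover have "restr M Z = density M (\<lambda>x. ennreal (indicator Z x))"
    by (simp add: restr_def ennreal_indicator)
  ultimately show ?thesis using f by (simp add: integral_density)
qed

text \<open>The weak formulation pairs with all of \<open>u0\<close>, the entropy inequality treats
  its density and its singular part separately; this splitting makes their boundary terms
  comparable.\<close>

lemma pairing_decomp:
  fixes S :: "'a::euclidean_space set" and f :: "'a \<Rightarrow> real"
  assumes \<mu>: "\<mu> \<in> signed_radon S" and S: "open S"
    and f: "continuous_on UNIV f" "compact K" "K \<subseteq> S" "\<And>x. x \<notin> K \<Longrightarrow> f x = 0"
  shows "set_integrable lborel S (\<lambda>x. ac_density S \<mu> x * f x)"
    and "pairing S \<mu> f = (LINT x:S|lborel. ac_density S \<mu> x * f x) + pairing S (sing_part S \<mu>) f"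
proof -
  obtain Z where Z: "carries_sing S \<mu> Z" using carries_sing_ex[OF \<mu> S] by blast
  have Zb: "Z \<in> sets borel" "- Z \<in> sets borel" using Z by (auto simp: carries_sing_def)
  obtain p n where p: "p \<in> borel_measurable borel" "\<And>x. 0 \<le> p x" "restr (pos_part S \<mu>) (- Z) = density (lborel_on S) (\<lambda>z. ennreal (p z))"
    and n: "n \<in> borel_measurable borel" "\<And>x. 0 \<le> n x" "restr (neg_part S \<mu>) (- Z) = density (lborel_on S) (\<lambda>z. ennreal (n z))"
    and a: "ac_density S \<mu> \<in> borel_measurable borel" and ae: "AE z in lborel. z \<in> S \<longrightarrow> ac_density S \<mu> z = p z - n z"
    by (rule ac_density_eq[OF \<mu> S Z], rule that) auto
  note P = pos_part_radon[OF \<mu> S] and N = neg_part_radon[OF \<mu> S]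
  have fm: "f \<in> borel_measurable borel" by (rule borel_measurable_continuous_onI[OF f(1)])
  have int: "integrable M f" if "M \<in> radon S" for M
    using f by (intro radon_integrable_continuous[OF that S _ f(2,3)]) (auto intro: continuous_on_subset)
  have split: "(LINT x|M. f x) = (LINT x|restr M Z. f x) + (LINT x|restr M (- Z). f x)" if M: "M \<in> radon S" for M
  proof -
    have [measurable]: "f \<in> borel_measurable M" by (rule radon_measurable[OF fm M])
    have i: "integrable M (\<lambda>x. indicator A x * f x)" if "A \<in> sets borel" for A
    proof (rule Bochner_Integration.integrable_bound[OF int[OF M]])
      have "(indicator A :: 'a \<Rightarrow> real) \<in> borel_measurable M"
        using that by (intro radon_measurable[OF _ M]) auto
      then show "(\<lambda>x. indicator A x * f x) \<in> borel_measurable M" by simp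
    qed (auto simp: indicator_def)
    have "(LINT x|M. f x) = (LINT x|M. indicator Z x * f x + indicator (- Z) x * f x)"
      by (intro Bochner_Integration.integral_cong) (auto simp: indicator_def)
    also have "\<dots> = (LINT x|M. indicator Z x * f x) + (LINT x|M. indicator (- Z) x * f x)"
      using i Zb by (intro Bochner_Integration.integral_add) auto
    finally show ?thesis by (simp add: integral_restr[OF M] Zb)
  qed
  have dens: "set_integrable lborel S (\<lambda>x. q x * f x) \<and> (LINT x|restr M (- Z). f x) = (LINT x:S|lborel. q x * f x)"
    if M: "M \<in> radon S" and q: "q \<in> borel_measurable borel" "\<And>x. 0 \<le> q x" "restr M (- Z) = density (lborel_on S) (\<lambda>z. ennreal (q z))"
    for M q
  proof -
    note L = lborel_on_radon[OF S]
    have m: "q \<in> borel_measurable (lborel_on S)" "f \<in> borel_measurable (lborel_on S)"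
      by (rule radon_measurable[OF q(1) L], rule radon_measurable[OF fm L])
    have "integrable (density (lborel_on S) (\<lambda>z. ennreal (q z))) f"
      using int[OF restr_radon[OF M S Zb(2)]] by (simp add: q(3))
    then have "integrable (lborel_on S) (\<lambda>x. q x * f x)"
      using m q(2) by (subst (asm) integrable_density) auto
    moreover have "(LINT x|restr M (- Z). f x) = (LINT x|lborel_on S. q x * f x)"
      unfolding q(3) using m q(2) by (subst integral_density) auto
    ultimately show ?thesis
      using S unfolding set_integrable_def set_lebesgue_integral_def
      by (simp add: integrable_restrict_space integral_restrict_space)
  qed
  note dp = dens[OF P p] and dn = dens[OF N n]
  have fm': "f \<in> borel_measurable lborel" "ac_density S \<mu> \<in> borel_measurable lborel" "p \<in> borel_measurable lborel" "n \<in> borel_measurable lborel"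
    using fm a p(1) n(1) by auto
  have Sm: "S \<in> sets lborel" using S by simp
  have ind: "(indicat_real S) \<in> borel_measurable lborel" using Sm by simp
  have ae': "AE x in lborel. indicat_real S x *\<^sub>R (ac_density S \<mu> x * f x) = indicat_real S x *\<^sub>R (p x * f x - n x * f x)"
    using ae by (rule AE_mp) (auto intro!: AE_I2 simp: indicator_def left_diff_distrib)
  have m1: "(\<lambda>x. indicat_real S x *\<^sub>R (ac_density S \<mu> x * f x)) \<in> borel_measurable lborel"
    "(\<lambda>x. indicat_real S x *\<^sub>R (p x * f x - n x * f x)) \<in> borel_measurable lborel"
    using fm' ind by (auto intro!: borel_measurable_times borel_measurable_scaleR borel_measurable_diff)
  have d: "set_integrable lborel S (\<lambda>x. p x * f x - n x * f x)"
    "(LINT x:S|lborel. p x * f x - n x * f x) = (LINT x:S|lborel. p x * f x) - (LINT x:S|lborel. n x * f x)"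
    using dp dn by (auto intro: set_integral_diff)
  show "set_integrable lborel S (\<lambda>x. ac_density S \<mu> x * f x)"
    using d(1) unfolding set_integrable_def by (subst integrable_cong_AE[OF m1 ae'])
  have "(LINT x:S|lborel. ac_density S \<mu> x * f x) = (LINT x:S|lborel. p x * f x - n x * f x)"
    unfolding set_lebesgue_integral_def by (rule integral_cong_AE[OF m1 ae'])
  then show "pairing S \<mu> f = (LINT x:S|lborel. ac_density S \<mu> x * f x) + pairing S (sing_part S \<mu>) f"
    unfolding pairing_def pos_part_sing_part[OF \<mu> S Z] neg_part_sing_part[OF \<mu> S Z]
    using split[OF P] split[OF N] dp dn d(2) by simp
qed

section \<open>The entropy inequality for the singular part\<close>

text \<open>The bound in \<open>Linf\<close> holds almost everywhere, but the values
  \<open>H k\<close> at single constants have to be bounded too. By continuity the exceptional set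
  is open, and an open null set is empty.\<close>

lemma W1inf_bounded:
  assumes "H \<in> W1inf"
  obtains M where "0 \<le> M" "\<And>x. \<bar>H x\<bar> \<le> M"
proof -
  have cont: "continuous_on UNIV H" using assms by (simp add: W1inf_def)
  obtain c where c: "AE x in lebesgue. \<bar>H x\<bar> \<le> c"
    using assms by (auto simp: W1inf_def Linf_def)
  define U where "U = {x. c < \<bar>H x\<bar>}"
  have "open U" unfolding U_def using cont by (intro open_Collect_less continuous_intros)
  moreover have "negligible U"
  proof -
    have "AE x in lebesgue. x \<notin> U" using c by (rule AE_mp) (auto simp: U_def)
    then have "U \<in> null_sets lebesgue"
      using \<open>open U\<close> by (subst (asm) AE_iff_null_sets[symmetric]) auto
    then show ?thesis by (simp add: negligible_iff_null_sets)
  qed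
  ultimately have "U = {}" using open_not_negligible by blast
  then have "\<bar>H x\<bar> \<le> c" for x by (auto simp: U_def not_less)
  then show thesis by (intro that[of "max c 0"]) (auto simp: le_max_iff_disj)
qed

section \<open>Integrals over the cylinder\<close>

lemma set_integral_FTC_Ioo:
  fixes \<phi> :: "real \<Rightarrow> real"
  assumes T: "0 \<le> T" and \<phi>: "\<And>t. (\<phi> has_real_derivative \<phi>' t) (at t)" "continuous_on UNIV \<phi>'"
  shows "(LINT t:{0<..<T}|lborel. \<phi>' t) = \<phi> T - \<phi> 0"
proof -
  have m: "\<phi>' \<in> borel_measurable borel" by (rule borel_measurable_continuous_onI[OF \<phi>(2)])
  have "has_bochner_integral lborel (\<lambda>x. \<phi>' x * indicator {0..T} x) (\<phi> T - \<phi> 0)"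
    using T \<phi> by (intro has_bochner_integral_FTC_Icc_real) (auto simp: continuous_on_eq_continuous_at)
  then have "(LINT x|lborel. \<phi>' x * indicator {0..T} x) = \<phi> T - \<phi> 0"
    by (simp add: has_bochner_integral_iff)
  moreover have "(LINT x|lborel. indicator {0<..<T} x *\<^sub>R \<phi>' x) = (LINT x|lborel. \<phi>' x * indicator {0..T} x)"
  proof (rule integral_cong_AE)
    show "AE x in lborel. indicator {0<..<T} x *\<^sub>R \<phi>' x = \<phi>' x * indicator {0..T} x"
      using AE_lborel_singleton[of 0] AE_lborel_singleton[of T] by eventually_elim (auto simp: indicator_def)
  qed (use m in auto)
  ultimately show ?thesis by (simp add: set_lebesgue_integral_def)
qed

lemma integral_cylinder_prod:
  fixes a b :: "real \<Rightarrow> real"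
  assumes \<Omega>: "open \<Omega>" and a: "continuous_on UNIV a" "compact K" "K \<subseteq> \<Omega>" "\<And>x. x \<notin> K \<Longrightarrow> a x = 0"
    and b: "continuous_on UNIV b"
  shows "(LINT z:cylinder \<Omega> T|lborel. b (snd z) * a (fst z)) = (LINT t:{0<..<T}|lborel. b t) * (LINT x|lborel. a x)"
proof -
  let ?F = "\<lambda>z. (indicator {0<..<T} (snd z) * b (snd z)) * a (fst z)"
  have m: "a \<in> borel_measurable borel" "b \<in> borel_measurable borel"
    by (rule borel_measurable_continuous_onI, fact)+
  have Fm: "?F \<in> borel_measurable borel"
    using borel_compose_fst[OF m(1)] borel_compose_snd[OF m(2)] borel_compose_snd[of "indicator {0<..<T} :: real \<Rightarrow> real"] by simp
  obtain A where A: "0 \<le> A" "\<And>x. x \<in> K \<Longrightarrow> \<bar>a x\<bar> \<le> A"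
    by (rule continuous_compact_bounded[OF a(1,2)]) auto
  obtain B where B: "0 \<le> B" "\<And>x. x \<in> {0..T} \<Longrightarrow> \<bar>b x\<bar> \<le> B"
    by (rule continuous_compact_bounded[OF b compact_Icc]) auto
  have KT: "compact (K \<times> {0..T})" by (rule compact_Times[OF a(2) compact_Icc])
  have int: "integrable lborel ?F"
  proof (rule integrableI_bounded_set[where A = "K \<times> {0..T}" and B = "B * A"])
    show "K \<times> {0..T} \<in> sets lborel" using KT by (simp add: borel_compact)
    show "emeasure lborel (K \<times> {0..T}) < \<infinity>" using emeasure_compact_finite[OF KT] by simp
    show "AE z in lborel. z \<in> K \<times> {0..T} \<longrightarrow> norm (?F z) \<le> B * A"
      using A B by (intro AE_I2) (auto simp: abs_mult indicator_def intro!: mult_mono)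
    show "AE z in lborel. z \<notin> K \<times> {0..T} \<longrightarrow> ?F z = 0"
    proof -
      have "a x \<noteq> 0 \<Longrightarrow> x \<in> K" for x using a(4) by blast
      then show ?thesis by (intro AE_I2) (auto simp: indicator_def)
    qed
  qed (use Fm in simp)
  have "(LINT z:cylinder \<Omega> T|lborel. b (snd z) * a (fst z)) = (LINT z|lborel. ?F z)"
    unfolding set_lebesgue_integral_def
  proof (intro Bochner_Integration.integral_cong refl)
    fix z :: "real \<times> real"
    show "indicator (cylinder \<Omega> T) z *\<^sub>R (b (snd z) * a (fst z)) = ?F z"
    proof (cases "fst z \<in> K")
      case True
      then show ?thesis using a(3) by (cases z) (auto simp: indicator_def)
    qed (simp add: a(4))
  qed
  also have "\<dots> = (LINT z|(lborel \<Otimes>\<^sub>M lborel). ?F z)" by (simp add: lborel_prod)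
  also have "\<dots> = (LINT x|lborel. LINT t|lborel. ?F (x, t))"
    using int by (intro lborel_pair.integral_fst'[symmetric]) (simp add: lborel_prod)
  also have "\<dots> = (LINT t:{0<..<T}|lborel. b t) * (LINT x|lborel. a x)"
    by (simp add: set_lebesgue_integral_def)
  finally show ?thesis .
qed

lemma time_integral_cong_AE:
  fixes f g :: "real \<Rightarrow> real"
  assumes "integrable (time_measure T) g" "AE t in time_measure T. f t = g t"
  shows "integrable (time_measure T) f" "(LINT t|time_measure T. f t) = (LINT t|time_measure T. g t)"
proof -
  have f: "f \<in> borel_measurable (time_measure T)"
    by (rule lebesgue_on_AE_measurable[OF _ borel_measurable_integrable[OF assms(1)] assms(2)]) auto
  note g = borel_measurable_integrable[OF assms(1)]
  show "integrable (time_measure T) f" using assms(1) by (subst integrable_cong_AE[OF f g assms(2)])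
  show "(LINT t|time_measure T. f t) = (LINT t|time_measure T. g t)" by (rule integral_cong_AE[OF f g assms(2)])
qed

text \<open>All regular integrands below grow at most linearly in the density of \<open>u\<close>
  and are supported over \<open>K\<close>; this is their common majorant.\<close>

lemma cylinder_integrable:
  assumes \<Omega>: "open \<Omega>" and u: "u \<in> Linf_signed_radon \<Omega> T" and K: "compact K" "K \<subseteq> \<Omega>"
  shows "integrable lborel (\<lambda>z. indicator (K \<times> {0<..<T}) z * (A * (1 + \<bar>ac_density (cylinder \<Omega> T) u z\<bar>)))"
proof -
  let ?ur = "ac_density (cylinder \<Omega> T) u" and ?A = "K \<times> {0<..<T}"
  have i: "set_integrable lborel ?A ?ur" by (rule ac_density_cylinder(2)[OF \<Omega> u K])
  have "?A \<subseteq> K \<times> {0..T}" by auto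
  moreover have KT: "compact (K \<times> {0..T})" by (rule compact_Times[OF K(1) compact_Icc])
  moreover have Am: "?A \<in> sets borel"
  proof -
    have "?A = K \<times> {0..T} \<inter> cylinder \<Omega> T" using K(2) by auto
    then show ?thesis using borel_compact[OF KT] borel_open[OF open_cylinder[OF \<Omega>, of T]] by simp
  qed
  ultimately have "emeasure lborel ?A < \<infinity>"
    using emeasure_mono[of ?A "K \<times> {0..T}" lborel] emeasure_compact_finite[OF KT]
    by (auto simp: borel_compact intro: le_less_trans)
  then have "set_integrable lborel ?A (\<lambda>_. 1 :: real)"
    using Am by (simp add: set_integrable_def integrable_indicator_iff)
  then have "set_integrable lborel ?A (\<lambda>z. A * (1 + \<bar>?ur z\<bar>))"
    using set_integrable_abs[OF i] by (intro set_integrable_mult_right set_integral_add) auto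
  then show ?thesis by (simp add: set_integrable_def)
qed

lemma cylinder_dominated:
  assumes \<Omega>: "open \<Omega>" and u: "u \<in> Linf_signed_radon \<Omega> T" and K: "compact K" "K \<subseteq> \<Omega>"
    and g: "g \<in> borel_measurable borel"
    and bound: "\<And>x t. x \<in> K \<Longrightarrow> t \<in> {0<..<T} \<Longrightarrow> \<bar>g (x, t)\<bar> \<le> A * (1 + \<bar>ac_density (cylinder \<Omega> T) u (x, t)\<bar>)"
    and zero: "\<And>x t. x \<notin> K \<Longrightarrow> g (x, t) = (0 :: real)"
  shows "set_integrable lborel (cylinder \<Omega> T) g"
  unfolding set_integrable_def
proof (rule Bochner_Integration.integrable_bound[OF cylinder_integrable[OF \<Omega> u K, of A]])
  show "(\<lambda>z. indicator (cylinder \<Omega> T) z *\<^sub>R g z) \<in> borel_measurable lborel"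
    using g open_cylinder[OF \<Omega>, of T] by simp
  show "AE z in lborel. norm (indicator (cylinder \<Omega> T) z *\<^sub>R g z)
      \<le> norm (indicator (K \<times> {0<..<T}) z * (A * (1 + \<bar>ac_density (cylinder \<Omega> T) u z\<bar>)))"
  proof (intro AE_I2)
    fix z :: "real \<times> real"
    obtain x t where z: "z = (x, t)" by (cases z)
    show "norm (indicator (cylinder \<Omega> T) z *\<^sub>R g z)
      \<le> norm (indicator (K \<times> {0<..<T}) z * (A * (1 + \<bar>ac_density (cylinder \<Omega> T) u z\<bar>)))"
      using bound[of x t] zero[of x t] unfolding z by (auto simp: indicator_def)
  qed
qed

text \<open>The sign \<open>s\<close> treats both Jordan parts at once. The entropy inequality is
  taken at \<open>k = s * j\<close> and \<open>s\<close> times the weak formulation is added: total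
  variation plus \<open>s\<close> times the measure is twice the wanted Jordan part, and the factor
  2 is divided out after the limit in \<open>j\<close>.\<close>

lemma entropy_singular_ineq:
  fixes s T :: real
  assumes T: "0 < T" and H: "H \<in> W1inf" and \<Omega>: "open \<Omega>" and u0: "u0 \<in> signed_radon \<Omega>"
    and ent: "is_entropy_solution \<Omega> T H u0 u" and s: "s = 1 \<or> s = -1"
    and mp: "disintegration \<Omega> T (pos_part (cylinder \<Omega> T) (sing_part (cylinder \<Omega> T) u)) mp"
      "\<And>K. compact K \<Longrightarrow> K \<subseteq> \<Omega> \<Longrightarrow> \<exists>C. AE t in time_measure T. measure (mp t) K \<le> C"
    and mn: "disintegration \<Omega> T (neg_part (cylinder \<Omega> T) (sing_part (cylinder \<Omega> T) u)) mn"
      "\<And>K. compact K \<Longrightarrow> K \<subseteq> \<Omega> \<Longrightarrow> \<exists>C. AE t in time_measure T. measure (mn t) K \<le> C"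
    and ae: "AE t in time_measure T.
       signed_slice \<Omega> T (sing_part (cylinder \<Omega> T) u) t \<in> signed_radon \<Omega> \<and>
       pos_part \<Omega> (signed_slice \<Omega> T (sing_part (cylinder \<Omega> T) u) t) = mp t \<and>
       neg_part \<Omega> (signed_slice \<Omega> T (sing_part (cylinder \<Omega> T) u) t) = mn t"
    and \<rho>: "\<rho> \<in> C1c \<Omega>" "\<And>x. 0 \<le> \<rho> x"
    and \<phi>: "\<And>t. (\<phi> has_real_derivative \<phi>' t) (at t)" "continuous_on UNIV \<phi>'" "\<phi> T = 0"
      "\<And>t. t \<in> {0..T} \<Longrightarrow> 0 \<le> \<phi> t"
  shows "- \<phi> 0 * (LINT x|(if s = 1 then pos_part else neg_part) \<Omega> (sing_part \<Omega> u0). \<rho> x)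
    \<le> (LINT t|time_measure T. \<phi>' t * (LINT x|(if s = 1 then mp else mn) t. \<rho> x))"
proof -
  let ?C = "cylinder \<Omega> T"
  define ur us u0r u0s where "ur = ac_density ?C u" and "us = sing_part ?C u"
    and "u0r = ac_density \<Omega> u0" and "u0s = sing_part \<Omega> u0"
  have u: "u \<in> Linf_signed_radon \<Omega> T" using ent by (simp add: is_entropy_solution_def is_solution_def)
  obtain K \<rho>' R where K: "compact K" "K \<subseteq> \<Omega>" "\<And>x. x \<notin> K \<Longrightarrow> \<rho> x = 0" "\<And>x. x \<notin> K \<Longrightarrow> \<rho>' x = 0"
    and \<rho>c: "continuous_on UNIV \<rho>" "continuous_on UNIV \<rho>'" and \<rho>d: "\<And>x. (\<rho> has_real_derivative \<rho>' x) (at x)"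
    and R: "\<And>x. \<bar>\<rho> x\<bar> \<le> R" "\<And>x. \<bar>\<rho>' x\<bar> \<le> R"
    by (rule C1c_E[OF \<rho>(1)]) blast
  have R0: "0 \<le> R" using R(1)[of 0] by simp
  have \<phi>c: "continuous_on UNIV \<phi>" using \<phi>(1) by (auto intro!: DERIV_continuous_on)
  obtain B1 where B1: "0 \<le> B1" "\<And>x. x \<in> {0..T} \<Longrightarrow> \<bar>\<phi> x\<bar> \<le> B1"
    by (rule continuous_compact_bounded[OF \<phi>c compact_Icc]) auto
  obtain B2 where B2: "0 \<le> B2" "\<And>x. x \<in> {0..T} \<Longrightarrow> \<bar>\<phi>' x\<bar> \<le> B2"
    by (rule continuous_compact_bounded[OF \<phi>(2) compact_Icc]) auto
  obtain M where M: "0 \<le> M" "\<And>x. \<bar>H x\<bar> \<le> M"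
    by (rule W1inf_bounded[OF H], rule that) auto
  have Hc: "continuous_on UNIV H" using H by (simp add: W1inf_def)
  have [measurable]: "ur \<in> borel_measurable borel"
    unfolding ur_def by (rule ac_density_cylinder(1)[OF \<Omega> u])
  have [measurable]: "H \<in> borel_measurable borel" by (rule borel_measurable_continuous_onI[OF Hc])
  have fs [measurable]: "(\<lambda>z::real \<times> real. \<rho> (fst z)) \<in> borel_measurable borel"
    "(\<lambda>z::real \<times> real. \<rho>' (fst z)) \<in> borel_measurable borel"
    "(\<lambda>z::real \<times> real. \<phi> (snd z)) \<in> borel_measurable borel"
    "(\<lambda>z::real \<times> real. \<phi>' (snd z)) \<in> borel_measurable borel"
    by (rule borel_compose_fst[OF borel_measurable_continuous_onI[OF \<rho>c(1)]]
      borel_compose_fst[OF borel_measurable_continuous_onI[OF \<rho>c(2)]]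
      borel_compose_snd[OF borel_measurable_continuous_onI[OF \<phi>c]]
      borel_compose_snd[OF borel_measurable_continuous_onI[OF \<phi>(2)]])+
  define \<zeta> where "\<zeta> t x = \<phi> t * \<rho> x" for t x
  have \<zeta>C: "\<zeta> \<in> C1_C1c \<Omega> T" unfolding \<zeta>_def by (rule C1_C1c_prod[OF \<rho>(1) \<phi>(1,2)])
  have \<zeta>T: "\<forall>x\<in>\<Omega>. \<zeta> T x = 0" by (simp add: \<zeta>_def \<phi>(3))
  have \<zeta>nn: "\<forall>t\<in>{0..T}. \<forall>x\<in>\<Omega>. 0 \<le> \<zeta> t x" using \<rho>(2) \<phi>(4) by (simp add: \<zeta>_def)
  have td: "time_deriv \<zeta> t x = \<phi>' t * \<rho> x" for t x
    unfolding \<zeta>_def by (rule DERIV_imp_deriv) (rule DERIV_cmult_right[OF \<phi>(1)])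
  have sd: "space_deriv \<zeta> t x = \<phi> t * \<rho>' x" for t x
    unfolding \<zeta>_def by (rule DERIV_imp_deriv) (rule DERIV_cmult[OF \<rho>d])
  define g2 where "g2 z = ur z * (\<phi>' (snd z) * \<rho> (fst z)) + H (ur z) * (\<phi> (snd z) * \<rho>' (fst z))" for z
  define g1 where "g1 k z = \<bar>ur z - k\<bar> * (\<phi>' (snd z) * \<rho> (fst z)) + sgn (ur z - k) * (H (ur z) - H k) * (\<phi> (snd z) * \<rho>' (fst z))" for k z
  \<comment> \<open>The integrand of the weak formulation at the constant state \<open>k\<close>.
    Subtracting it removes the growth in \<open>k\<close>, so that one majorant serves all
    \<open>j\<close>.\<close>
  define g3 where "g3 k z = k * (\<phi>' (snd z) * \<rho> (fst z)) + H k * (\<phi> (snd z) * \<rho>' (fst z))" for k z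
  have sol: "(LINT z:?C|lborel. g2 z) + (LINT t|time_measure T. pairing \<Omega> (signed_slice \<Omega> T us t) (\<lambda>x. \<phi>' t * \<rho> x))
      = - pairing \<Omega> u0 (\<lambda>x. \<phi> 0 * \<rho> x)"
    using ent \<zeta>C \<zeta>T unfolding is_entropy_solution_def is_solution_def Let_def
    by (auto simp: td sd g2_def ur_def us_def case_prod_beta' \<zeta>_def[symmetric])
  have ent_k: "- (LINT x:\<Omega>|lborel. \<bar>u0r x - k\<bar> * (\<phi> 0 * \<rho> x)) - (LINT x|total_variation \<Omega> u0s. \<phi> 0 * \<rho> x)
      \<le> (LINT z:?C|lborel. g1 k z) + (LINT t|time_measure T. LINT x|total_variation \<Omega> (signed_slice \<Omega> T us t). \<phi>' t * \<rho> x)" for k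
    using ent \<zeta>C \<zeta>T \<zeta>nn unfolding is_entropy_solution_def Let_def
    by (auto simp: td sd g1_def ur_def us_def u0r_def u0s_def case_prod_beta' \<zeta>_def[symmetric])
  \<comment> \<open>What remains after the subtraction. Where \<open>s * ur < j\<close>, both the
    positive part and the sum of \<open>sgn\<close> and \<open>s\<close> are zero.\<close>
  define G where "G j z = 2 * max 0 (s * ur z - j) * (\<phi>' (snd z) * \<rho> (fst z))
      + (sgn (ur z - s * j) + s) * (H (ur z) - H (s * j)) * (\<phi> (snd z) * \<rho>' (fst z))" for j z
  have abs_s: "\<bar>y\<bar> + s * y = 2 * max 0 (s * y)" for y using s by auto
  have ss: "s * s = 1" using s by auto
  have G_eq: "G j z = g1 (s * j) z + s * g2 z - s * g3 (s * j) z" for j z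
  proof -
    have h: "2 * max 0 (s * ur z - j) = \<bar>ur z - s * j\<bar> + s * (ur z - s * j)"
      unfolding abs_s using ss by (simp add: algebra_simps mult.assoc[symmetric])
    show ?thesis unfolding G_def g1_def g2_def g3_def h by (simp add: algebra_simps)
  qed
  have prod_bounds: "\<bar>\<phi>' t * \<rho> x\<bar> \<le> B2 * R" "\<bar>\<phi> t * \<rho>' x\<bar> \<le> B1 * R" if "t \<in> {0<..<T}" for t x
    using that B1 B2 R by (auto simp: abs_mult intro!: mult_mono)
  \<comment> \<open>One estimate for all integrands: the coefficient of the time derivative may grow
    linearly in \<open>y\<close>, the flux coefficient must be bounded. \<open>B1\<close> and
    \<open>B2\<close> bound \<phi> and its derivative on \<open>[0,T]\<close>, \<open>R\<close>
    bounds \<rho> and its derivative.\<close>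
  have dom: "\<bar>a * (\<phi>' t * \<rho> x) + b * (\<phi> t * \<rho>' x)\<bar> \<le> (A * (B2 * R) + B * (B1 * R)) * (1 + \<bar>y\<bar>)"
    if t: "t \<in> {0<..<T}" and ab: "\<bar>a\<bar> \<le> A * (1 + \<bar>y\<bar>)" "\<bar>b\<bar> \<le> B" "0 \<le> B" for a b A B t x y :: real
  proof -
    have "\<bar>a * (\<phi>' t * \<rho> x)\<bar> \<le> A * (1 + \<bar>y\<bar>) * (B2 * R)"
      unfolding abs_mult[of a] using ab prod_bounds(1)[OF t] by (intro mult_mono) auto
    moreover have "\<bar>b * (\<phi> t * \<rho>' x)\<bar> \<le> B * (B1 * R)"
      unfolding abs_mult[of b] using ab prod_bounds(2)[OF t] by (intro mult_mono) auto
    moreover have "B * (B1 * R) \<le> B * (B1 * R) * (1 + \<bar>y\<bar>)"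
      using mult_left_mono[of 1 "1 + \<bar>y\<bar>" "B * (B1 * R)"] ab(3) B1(1) R0 by simp
    ultimately have "\<bar>a * (\<phi>' t * \<rho> x)\<bar> + \<bar>b * (\<phi> t * \<rho>' x)\<bar> \<le> A * (1 + \<bar>y\<bar>) * (B2 * R) + B * (B1 * R) * (1 + \<bar>y\<bar>)"
      by linarith
    also have "\<dots> = (A * (B2 * R) + B * (B1 * R)) * (1 + \<bar>y\<bar>)" by (simp add: algebra_simps)
    finally show ?thesis using abs_triangle_ineq by (rule order_trans[rotated])
  qed
  have Hdiff: "\<bar>H a - H b\<bar> \<le> 2 * M" for a b using M(2)[of a] M(2)[of b] by linarith
  have sgn_diff: "\<bar>sgn a * (H b - H c)\<bar> \<le> 2 * M" for a b c :: real
    using Hdiff[of b c] M(1) by (auto simp: sgn_if)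
  \<comment> \<open>The weak identity of a constant state: in time, the fundamental theorem with
    \<open>\<phi> T = 0\<close> leaves the initial term; in space, the derivative of \<rho>
    integrates to 0.\<close>
  have const: "(LINT z:?C|lborel. g3 k z) = - k * \<phi> 0 * (LINT x|lborel. \<rho> x)" for k
  proof -
    \<comment> \<open>The majorant constant is left unsimplified to match what \<open>dom\<close>
      yields for the coefficients 1 and 0; \<open>j2\<close> uses 0 and 1.\<close>
    have j1: "set_integrable lborel ?C (\<lambda>z. \<phi>' (snd z) * \<rho> (fst z))"
      by (rule cylinder_dominated[OF \<Omega> u K(1,2), where A = "1 * (B2 * R) + 0 * (B1 * R)"])
        (use dom[of _ 1 1 _ 0 0] K(3) in auto)
    have j2: "set_integrable lborel ?C (\<lambda>z. \<phi> (snd z) * \<rho>' (fst z))"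
      by (rule cylinder_dominated[OF \<Omega> u K(1,2), where A = "0 * (B2 * R) + 1 * (B1 * R)"])
        (use dom[of _ 0 0 _ 1 1] K(4) in auto)
    have "(LINT z:?C|lborel. g3 k z) = k * (LINT z:?C|lborel. \<phi>' (snd z) * \<rho> (fst z)) + H k * (LINT z:?C|lborel. \<phi> (snd z) * \<rho>' (fst z))"
      unfolding g3_def using j1 j2 by (simp add: set_integral_add set_integrable_mult_right)
    also have "(LINT z:?C|lborel. \<phi>' (snd z) * \<rho> (fst z)) = - \<phi> 0 * (LINT x|lborel. \<rho> x)"
      by (subst integral_cylinder_prod[OF \<Omega> \<rho>c(1) K(1,2) _ \<phi>(2)])
        (use K(3) set_integral_FTC_Ioo[OF less_imp_le[OF T] \<phi>(1,2)] in \<open>simp_all add: \<phi>(3)\<close>)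
    also have "(LINT z:?C|lborel. \<phi> (snd z) * \<rho>' (fst z)) = 0"
      by (subst integral_cylinder_prod[OF \<Omega> \<rho>c(2) K(1,2) _ \<phi>c])
        (use K(3,4) integral_C1c_deriv[OF K(1) _ _ \<rho>c(2) \<rho>d] in simp_all)
    finally show ?thesis by simp
  qed
  have i1: "set_integrable lborel ?C (g1 k)" for k
  proof (rule cylinder_dominated[OF \<Omega> u K(1,2)])
    show "\<bar>g1 k (x, t)\<bar> \<le> ((1 + \<bar>k\<bar>) * (B2 * R) + 2 * M * (B1 * R)) * (1 + \<bar>ac_density ?C u (x, t)\<bar>)"
      if "t \<in> {0<..<T}" for x t
      unfolding g1_def fst_conv snd_conv ur_def[symmetric]
      using M(1) by (intro dom[OF that] sgn_diff) (auto simp: algebra_simps intro: order_trans[OF abs_triangle_ineq4])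
    show "g1 k \<in> borel_measurable borel" unfolding g1_def by measurable
  qed (use K(3,4) in \<open>auto simp: g1_def\<close>)
  have i2: "set_integrable lborel ?C g2"
  proof (rule cylinder_dominated[OF \<Omega> u K(1,2)])
    show "\<bar>g2 (x, t)\<bar> \<le> (1 * (B2 * R) + M * (B1 * R)) * (1 + \<bar>ac_density ?C u (x, t)\<bar>)"
      if "t \<in> {0<..<T}" for x t
      unfolding g2_def fst_conv snd_conv ur_def[symmetric]
      using M by (intro dom[OF that]) auto
    show "g2 \<in> borel_measurable borel" unfolding g2_def by measurable
  qed (use K(3,4) in \<open>auto simp: g2_def\<close>)
  have i3: "set_integrable lborel ?C (g3 k)" for k
  proof (rule cylinder_dominated[OF \<Omega> u K(1,2)])
    show "\<bar>g3 k (x, t)\<bar> \<le> (\<bar>k\<bar> * (B2 * R) + M * (B1 * R)) * (1 + \<bar>ac_density ?C u (x, t)\<bar>)"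
      if "t \<in> {0<..<T}" for x t
      unfolding g3_def fst_conv snd_conv ur_def[symmetric]
      using M by (intro dom[OF that]) (auto simp: mult_le_cancel_left1)
    show "g3 k \<in> borel_measurable borel" unfolding g3_def by measurable
  qed (use K(3,4) in \<open>auto simp: g3_def\<close>)
  have Gint: "(LINT z:?C|lborel. G j z) = (LINT z:?C|lborel. g1 (s * j) z) + s * (LINT z:?C|lborel. g2 z) - s * (LINT z:?C|lborel. g3 (s * j) z)" for j
    unfolding G_eq using i1 i2 i3
    by (simp add: set_integral_diff set_integral_add set_integrable_mult_right)
  have Gm: "G j \<in> borel_measurable borel" for j unfolding G_def by measurable
  \<comment> \<open>The constant \<open>4 * M\<close> is the product of the bound 2 for the sum of
    signs and the bound \<open>2 * M\<close> for a difference of values of \<open>H\<close>; neither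
    depends on \<open>j\<close>.\<close>
  have Gbound: "\<bar>G j (x, t)\<bar> \<le> (2 * (B2 * R) + 4 * M * (B1 * R)) * (1 + \<bar>ur (x, t)\<bar>)"
    if t: "t \<in> {0<..<T}" and j: "0 \<le> j" for j x t
  proof -
    have "\<bar>sgn (ur (x, t) - s * j) + s\<bar> \<le> 2" using s by (auto simp: sgn_if)
    then have 2: "\<bar>(sgn (ur (x, t) - s * j) + s) * (H (ur (x, t)) - H (s * j))\<bar> \<le> 4 * M"
      using mult_mono[OF _ Hdiff[of "ur (x, t)" "s * j"], of "\<bar>sgn (ur (x, t) - s * j) + s\<bar>" 2] by (simp add: abs_mult)
    have "0 \<le> max 0 (s * ur (x, t) - j)" "max 0 (s * ur (x, t) - j) \<le> \<bar>ur (x, t)\<bar>" using s j by auto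
    then have 1: "\<bar>2 * max 0 (s * ur (x, t) - j)\<bar> \<le> 2 * (1 + \<bar>ur (x, t)\<bar>)"
      unfolding abs_mult distrib_left by (simp add: abs_of_nonneg add_increasing)
    show ?thesis unfolding G_def fst_conv snd_conv using M(1) by (intro dom[OF t 1 2]) auto
  qed
  \<comment> \<open>Pointwise the integrand is 0 as soon as \<open>j\<close> exceeds the absolute
    value of the density, so dominated convergence applies.\<close>
  have Glim: "(\<lambda>j. LINT z:?C|lborel. G (real j) z) \<longlonglongrightarrow> 0"
  proof -
    have "(\<lambda>j. LINT z|lborel. indicator ?C z *\<^sub>R G (real j) z) \<longlonglongrightarrow> (LINT z|(lborel :: (real \<times> real) measure). 0)"
    proof (rule integral_dominated_convergence)
      let ?w = "\<lambda>z. indicator (K \<times> {0<..<T}) z * ((2 * (B2 * R) + 4 * M * (B1 * R)) * (1 + \<bar>ur z\<bar>))"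
      show "integrable lborel ?w" unfolding ur_def by (rule cylinder_integrable[OF \<Omega> u K(1,2)])
      show "(\<lambda>z. indicator ?C z *\<^sub>R G (real j) z) \<in> borel_measurable lborel" for j
        using Gm[of "real j"] open_cylinder[OF \<Omega>, of T] by simp
      show "AE z in lborel. (\<lambda>j. indicator ?C z *\<^sub>R G (real j) z) \<longlonglongrightarrow> 0"
      proof (intro AE_I2)
        fix z :: "real \<times> real"
        obtain n where n: "\<bar>ur z\<bar> < real n" using reals_Archimedean2 by blast
        have "G (real j) z = 0" if j: "n \<le> j" for j
        proof -
          have "\<bar>ur z\<bar> < real j" using n j by linarith
          then have "s * ur z - real j < 0" "sgn (ur z - s * real j) = - s" using s by (auto simp: sgn_if)
          then show ?thesis by (simp add: G_def)
        qed
        then have "\<forall>\<^sub>F j in sequentially. indicator ?C z *\<^sub>R G (real j) z = 0"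
          by (auto simp: eventually_sequentially)
        then show "(\<lambda>j. indicator ?C z *\<^sub>R G (real j) z) \<longlonglongrightarrow> 0" by (rule tendsto_eventually)
      qed
      show "AE z in lborel. norm (indicator ?C z *\<^sub>R G (real j) z) \<le> ?w z" for j
      proof (intro AE_I2)
        fix z :: "real \<times> real"
        obtain x t where z: "z = (x, t)" by (cases z)
        have nn: "0 \<le> (2 * (B2 * R) + 4 * M * (B1 * R)) * (1 + \<bar>ur z\<bar>)"
          using B1(1) B2(1) R0 M(1) by (intro mult_nonneg_nonneg add_nonneg_nonneg) auto
        show "norm (indicator ?C z *\<^sub>R G (real j) z) \<le> ?w z"
        proof (cases "x \<in> K")
          case True
          then show ?thesis using Gbound[of t "real j" x] nn K(2) unfolding z by (auto simp: indicator_def)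
        next
          case False
          then have "G (real j) z = 0" using K(3,4) by (simp add: G_def z)
          then show ?thesis using nn by (simp add: indicator_def)
        qed
      qed
    qed simp
    then show ?thesis by (simp add: set_lebesgue_integral_def)
  qed
  interpret P: disintegration \<Omega> T "pos_part ?C us" mp unfolding us_def by (rule mp(1))
  interpret N: disintegration \<Omega> T "neg_part ?C us" mn unfolding us_def by (rule mn(1))
  obtain cp where cp: "AE t in time_measure T. measure (mp t) K \<le> cp" using mp(2)[OF K(1,2)] by blast
  obtain cn where cn: "AE t in time_measure T. measure (mn t) K \<le> cn" using mn(2)[OF K(1,2)] by blast
  have ft: "(\<lambda>z::real \<times> real. \<phi>' (snd z) * \<rho> (fst z)) \<in> borel_measurable borel" by measurable
  have intp: "integrable (time_measure T) (\<lambda>t. LINT x|mp t. \<phi>' t * \<rho> x)"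
    using P.fubini(2)[OF ft K(1,2) _ _ cp, of "B2 * R"] prod_bounds(1) K(3) by simp
  have intn: "integrable (time_measure T) (\<lambda>t. LINT x|mn t. \<phi>' t * \<rho> x)"
    using N.fubini(2)[OF ft K(1,2) _ _ cn, of "B2 * R"] prod_bounds(1) K(3) by simp
  define Ip In where "Ip = (LINT t|time_measure T. LINT x|mp t. \<phi>' t * \<rho> x)"
    and "In = (LINT t|time_measure T. LINT x|mn t. \<phi>' t * \<rho> x)"
  have tint: "integrable Q (\<lambda>x. c * \<rho> x)" if "Q \<in> radon \<Omega>" for Q c
    using K(3) by (intro radon_integrable_continuous[OF that \<Omega> _ K(1,2)] continuous_intros)
      (auto intro: continuous_on_subset[OF \<rho>c(1)])
  \<comment> \<open>For almost every \<open>t\<close> the total variation integrates to the sum of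
    the contributions of \<open>mp t\<close> and \<open>mn t\<close>, the pairing below to their
    difference; adding \<open>s\<close> times the latter leaves twice one of the two.\<close>
  have tv: "(LINT t|time_measure T. LINT x|total_variation \<Omega> (signed_slice \<Omega> T us t). \<phi>' t * \<rho> x) = Ip + In"
  proof -
    have "AE t in time_measure T. (LINT x|total_variation \<Omega> (signed_slice \<Omega> T us t). \<phi>' t * \<rho> x)
        = (LINT x|mp t. \<phi>' t * \<rho> x) + (LINT x|mn t. \<phi>' t * \<rho> x)"
      using ae unfolding us_def[symmetric]
    proof (rule AE_mp, intro AE_I2 impI)
      fix t assume t: "signed_slice \<Omega> T us t \<in> signed_radon \<Omega> \<and>
        pos_part \<Omega> (signed_slice \<Omega> T us t) = mp t \<and> neg_part \<Omega> (signed_slice \<Omega> T us t) = mn t"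
      then have "total_variation \<Omega> (signed_slice \<Omega> T us t) = add_measure (mp t) (mn t)"
        using total_variation_eq[OF _ \<Omega>] by metis
      then show "(LINT x|total_variation \<Omega> (signed_slice \<Omega> T us t). \<phi>' t * \<rho> x)
        = (LINT x|mp t. \<phi>' t * \<rho> x) + (LINT x|mn t. \<phi>' t * \<rho> x)"
        using integral_add_measure[OF _ tint[OF P.w] tint[OF N.w]] by (simp add: radon_sets[OF P.w] radon_sets[OF N.w])
    qed
    from time_integral_cong_AE(2)[OF Bochner_Integration.integrable_add[OF intp intn] this]
    show ?thesis unfolding Ip_def In_def using Bochner_Integration.integral_add[OF intp intn] by simp
  qed
  have pair: "(LINT t|time_measure T. pairing \<Omega> (signed_slice \<Omega> T us t) (\<lambda>x. \<phi>' t * \<rho> x)) = Ip - In"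
  proof -
    have "AE t in time_measure T. pairing \<Omega> (signed_slice \<Omega> T us t) (\<lambda>x. \<phi>' t * \<rho> x)
        = (LINT x|mp t. \<phi>' t * \<rho> x) - (LINT x|mn t. \<phi>' t * \<rho> x)"
      using ae unfolding us_def[symmetric] by (rule AE_mp) (auto simp: pairing_def)
    from time_integral_cong_AE(2)[OF Bochner_Integration.integrable_diff[OF intp intn] this]
    show ?thesis unfolding Ip_def In_def using Bochner_Integration.integral_diff[OF intp intn] by simp
  qed
  have u0s: "u0s \<in> signed_radon \<Omega>"
    using carries_sing_ex[OF u0 \<Omega>] sing_part_signed_radon[OF u0 \<Omega>] by (auto simp: u0s_def)
  define qp qn where "qp = (LINT x|pos_part \<Omega> u0s. \<phi> 0 * \<rho> x)" and "qn = (LINT x|neg_part \<Omega> u0s. \<phi> 0 * \<rho> x)"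
  have tv0: "(LINT x|total_variation \<Omega> u0s. \<phi> 0 * \<rho> x) = qp + qn"
    unfolding total_variation_eq[OF u0s \<Omega>] qp_def qn_def
    by (rule integral_add_measure[OF _ tint[OF pos_part_radon[OF u0s \<Omega>]] tint[OF neg_part_radon[OF u0s \<Omega>]]])
      (simp add: radon_sets[OF pos_part_radon[OF u0s \<Omega>]] radon_sets[OF neg_part_radon[OF u0s \<Omega>]])
  have cont0: "continuous_on UNIV (\<lambda>x. \<phi> 0 * \<rho> x)" using \<rho>c(1) by (intro continuous_intros)
  have pd: "set_integrable lborel \<Omega> (\<lambda>x. u0r x * (\<phi> 0 * \<rho> x))"
    "pairing \<Omega> u0 (\<lambda>x. \<phi> 0 * \<rho> x) = (LINT x:\<Omega>|lborel. u0r x * (\<phi> 0 * \<rho> x)) + (qp - qn)"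
    using pairing_decomp[OF u0 \<Omega> cont0 K(1,2)] K(3) by (auto simp: u0r_def u0s_def pairing_def qp_def qn_def)
  define f0 where "f0 x = \<phi> 0 * \<rho> x" for x
  have f0m [measurable]: "f0 \<in> borel_measurable borel"
    unfolding f0_def by (rule borel_measurable_continuous_onI[OF cont0])
  have u0rm [measurable]: "u0r \<in> borel_measurable borel"
  proof -
    obtain Z where "carries_sing \<Omega> u0 Z" using carries_sing_ex[OF u0 \<Omega>] by blast
    from ac_density_eq[OF u0 \<Omega> this] show ?thesis unfolding u0r_def by blast
  qed
  have f0i: "set_integrable lborel \<Omega> f0"
    using tint[OF lborel_on_radon[OF \<Omega>], of "\<phi> 0"] \<Omega>
    unfolding set_integrable_def f0_def by (subst integrable_restrict_space[symmetric]) auto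
  have W: "(LINT x:\<Omega>|lborel. f0 x) = \<phi> 0 * (LINT x|lborel. \<rho> x)"
  proof -
    have "indicat_real \<Omega> x *\<^sub>R f0 x = \<phi> 0 * \<rho> x" for x
      using K(2) K(3)[of x] by (cases "x \<in> K") (auto simp: f0_def indicator_def)
    then show ?thesis unfolding set_lebesgue_integral_def by simp
  qed
  \<comment> \<open>The counterpart at time 0 of the truncated regular part; it tends to 0 because
    \<open>u0r * f0\<close> is integrable.\<close>
  define r where "r j = (LINT x:\<Omega>|lborel. max 0 (s * u0r x - j) * f0 x)" for j
  have pdi: "set_integrable lborel \<Omega> (\<lambda>x. u0r x * f0 x)" using pd(1) by (simp add: f0_def)
  have rbound: "norm (indicat_real \<Omega> x *\<^sub>R (max 0 (s * u0r x - j) * f0 x)) \<le> norm (indicat_real \<Omega> x *\<^sub>R (u0r x * f0 x))"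
    if "0 \<le> j" for x j
  proof -
    have "\<bar>max 0 (s * u0r x - j)\<bar> \<le> \<bar>u0r x\<bar>" using s that by auto
    then show ?thesis by (simp add: abs_mult indicator_def mult_right_mono)
  qed
  have ri: "set_integrable lborel \<Omega> (\<lambda>x. max 0 (s * u0r x - j) * f0 x)" if "0 \<le> j" for j
    unfolding set_integrable_def
    by (rule Bochner_Integration.integrable_bound[OF pdi[unfolded set_integrable_def]])
      (use \<Omega> rbound[OF that] in \<open>auto intro!: AE_I2\<close>)
  have rlim: "(\<lambda>j. r (real j)) \<longlonglongrightarrow> 0"
  proof -
    have "(\<lambda>j. LINT x|lborel. indicat_real \<Omega> x *\<^sub>R (max 0 (s * u0r x - real j) * f0 x)) \<longlonglongrightarrow> (LINT x|(lborel :: real measure). 0)"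
    proof (rule integral_dominated_convergence)
      show "integrable lborel (\<lambda>x. norm (indicat_real \<Omega> x *\<^sub>R (u0r x * f0 x)))"
        using pdi unfolding set_integrable_def by (rule Bochner_Integration.integrable_norm)
      show "AE x in lborel. (\<lambda>j. indicat_real \<Omega> x *\<^sub>R (max 0 (s * u0r x - real j) * f0 x)) \<longlonglongrightarrow> 0"
      proof (intro AE_I2)
        fix x
        obtain n where n: "\<bar>u0r x\<bar> < real n" using reals_Archimedean2 by blast
        have "max 0 (s * u0r x - real j) = 0" if j: "n \<le> j" for j
        proof -
          have "\<bar>u0r x\<bar> < real j" using n j by linarith
          then show ?thesis using s by auto
        qed
        then have "\<forall>\<^sub>F j in sequentially. indicat_real \<Omega> x *\<^sub>R (max 0 (s * u0r x - real j) * f0 x) = 0"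
          by (auto simp: eventually_sequentially intro!: exI[of _ n])
        then show "(\<lambda>j. indicat_real \<Omega> x *\<^sub>R (max 0 (s * u0r x - real j) * f0 x)) \<longlonglongrightarrow> 0"
          by (rule tendsto_eventually)
      qed
    qed (use \<Omega> rbound in \<open>auto intro!: AE_I2\<close>)
    then show ?thesis by (simp add: r_def set_lebesgue_integral_def)
  qed
  define U where "U = (LINT x:\<Omega>|lborel. u0r x * f0 x)"
  \<comment> \<open>The identity behind \<open>G_eq\<close>, now at time 0: the part linear in
    \<open>j\<close> is the boundary term of the constant state, and \<open>s * U\<close> comes from
    the weak formulation.\<close>
  have A1: "(LINT x:\<Omega>|lborel. \<bar>u0r x - s * j\<bar> * f0 x) = 2 * r j - s * U + j * (\<phi> 0 * (LINT x|lborel. \<rho> x))"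
    if j: "0 \<le> j" for j
  proof -
    have e: "\<bar>u0r x - s * j\<bar> * f0 x = 2 * (max 0 (s * u0r x - j) * f0 x) - s * (u0r x * f0 x) + j * f0 x" for x
    proof -
      have "2 * max 0 (s * u0r x - j) = \<bar>u0r x - s * j\<bar> + s * (u0r x - s * j)"
        unfolding abs_s using ss by (simp add: algebra_simps mult.assoc[symmetric])
      also have "\<dots> = \<bar>u0r x - s * j\<bar> + s * u0r x - j"
        using ss by (simp add: algebra_simps mult.assoc[symmetric])
      finally have h: "\<bar>u0r x - s * j\<bar> = 2 * max 0 (s * u0r x - j) - s * u0r x + j" by simp
      show ?thesis unfolding h by (simp add: algebra_simps)
    qed
    show ?thesis
      unfolding e r_def U_def W[symmetric] using ri[OF j] pdi f0i
      by (simp add: set_integral_diff set_integral_add set_integrable_mult_right)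
  qed
  define q I where "q = (if s = 1 then qp else qn)" and "I = (if s = 1 then Ip else In)"
  \<comment> \<open>Both \<open>s * U\<close> and the terms linear in \<open>j\<close> cancel
    between the two sides, leaving only quantities that converge as \<open>j\<close> grows.\<close>
  have step: "- 2 * r (real j) - 2 * q \<le> (LINT z:?C|lborel. G (real j) z) + 2 * I" for j
  proof -
    have "- (LINT x:\<Omega>|lborel. \<bar>u0r x - s * real j\<bar> * f0 x) - (qp + qn) \<le> (LINT z:?C|lborel. g1 (s * real j) z) + (Ip + In)"
      using ent_k[of "s * real j"] unfolding tv tv0 f0_def .
    moreover have "(LINT z:?C|lborel. g2 z) + (Ip - In) = - (U + (qp - qn))"
      using sol unfolding pair pd(2) U_def f0_def .
    moreover have "s * (LINT z:?C|lborel. g3 (s * real j) z) = - real j * (\<phi> 0 * (LINT x|lborel. \<rho> x))"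
      unfolding const using ss by (simp add: mult.assoc[symmetric])
    ultimately show ?thesis
      using s Gint[of "real j"] A1[of "real j"] by (auto simp: q_def I_def)
  qed
  have "(\<lambda>j. - 2 * r (real j) - 2 * q) \<longlonglongrightarrow> - 2 * 0 - 2 * q"
    by (intro tendsto_intros rlim)
  moreover have "(\<lambda>j. (LINT z:?C|lborel. G (real j) z) + 2 * I) \<longlonglongrightarrow> 0 + 2 * I"
    by (intro tendsto_intros Glim)
  ultimately have "- 2 * 0 - 2 * q \<le> 0 + 2 * I"
    by (rule LIMSEQ_le) (use step in auto)
  then have "- q \<le> I" by simp
  then show ?thesis
    by (auto simp: q_def I_def qp_def qn_def Ip_def In_def u0s_def split: if_splits)
qed

section \<open>Monotonicity in time\<close>

lemma time_measure_AE_iff: "(AE t in time_measure T. P t) \<longleftrightarrow> (AE t in lborel. t \<in> {0<..<T} \<longrightarrow> P t)"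
  by (subst AE_restrict_space_iff) (auto simp: AE_completion_iff)

lemma integral_time_measure:
  fixes f :: "real \<Rightarrow> real"
  assumes "f \<in> borel_measurable borel"
  shows "(LINT t|time_measure T. f t) = (LINT t:{0<..<T}|lborel. f t)"
  using assms by (simp add: integral_restrict_space set_lebesgue_integral_def integral_completion)

lemma integrable_time_measure:
  fixes f :: "real \<Rightarrow> real"
  assumes "f \<in> borel_measurable borel"
  shows "integrable (time_measure T) f \<longleftrightarrow> set_integrable lborel {0<..<T} f"
  using assms by (simp add: integrable_restrict_space set_integrable_def integrable_completion)

text \<open>Densities against \<open>lborel\<close> need a Borel function, while slice integrals are
  only known to be Lebesgue measurable in \<open>t\<close>.\<close>

lemma time_borel_version:
  fixes h :: "real \<Rightarrow> real"
  assumes "h \<in> borel_measurable (time_measure T)"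
  obtains h' where "h' \<in> borel_measurable borel" "AE t in time_measure T. h t = h' t"
proof -
  have "(\<lambda>t. if t \<in> {0<..<T} then h t else 0) \<in> borel_measurable lebesgue"
    using assms by (subst (asm) borel_measurable_if_lebesgue_on[symmetric]) auto
  from completion_ex_borel_measurable_real[OF this] obtain h' where
    h': "h' \<in> borel_measurable lborel" "AE t in lborel. (if t \<in> {0<..<T} then h t else 0) = h' t" by auto
  have "AE t in time_measure T. h t = h' t"
    unfolding time_measure_AE_iff using h'(2) by (rule AE_mp) auto
  then show thesis using that h'(1) by simp
qed

lemma plateau_time_integrable:
  assumes \<psi>: "\<psi> \<in> C1c S" and m: "integrable (time_measure T) m"
  shows "integrable (time_measure T) (\<lambda>t. \<psi> t * m t)"
proof -
  obtain K \<psi>' B where B: "\<And>x. \<bar>\<psi> x\<bar> \<le> B" by (rule C1c_E[OF \<psi>]) blast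
  have [measurable]: "\<psi> \<in> borel_measurable (time_measure T)"
    by (rule borel_time_measurable[OF C1c_measurable[OF \<psi>]])
  have [measurable]: "m \<in> borel_measurable (time_measure T)" using m by auto
  have "integrable (time_measure T) (\<lambda>t. B * \<bar>m t\<bar>)" using m by (intro integrable_mult_right integrable_abs)
  then show ?thesis
  proof (rule Bochner_Integration.integrable_bound)
    show "AE t in time_measure T. norm (\<psi> t * m t) \<le> norm (B * \<bar>m t\<bar>)"
      using mult_right_mono[OF order_trans[OF B abs_ge_self]] by (intro AE_I2) (simp add: abs_mult)
  qed measurable
qed

lemma time_measure_finite: "integrable (time_measure T) (\<lambda>_. c :: real)"
proof -
  have "finite_measure (time_measure T)"
    by (rule finite_measure_lebesgue_on) (metis box_real(1) lmeasurable_box)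
  then show ?thesis by (simp add: finite_measure.integrable_const)
qed

text \<open>The spatial comparison argument reused in time: the hypothesis says that
  \<open>h^+ dt\<close> lies below \<open>h^- dt\<close> when tested with plateaus, hence on all
  relatively compact Borel sets. Where \<open>h > 0\<close> the second measure vanishes, so the
  first one does too.\<close>

lemma AE_nonpos_of_plateaus:
  assumes J: "J = {a<..<b}" "J \<subseteq> {0<..<T}" and h: "integrable (time_measure T) h"
    and le: "\<And>\<psi>. \<psi> \<in> plateaus J \<Longrightarrow> (LINT t|time_measure T. \<psi> t * h t) \<le> 0"
  shows "AE t in time_measure T. t \<in> J \<longrightarrow> h t \<le> 0"
proof -
  have oJ: "open J" using J by simp
  obtain h' where h'[measurable]: "h' \<in> borel_measurable borel" and ae: "AE t in time_measure T. h t = h' t"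
    using time_borel_version[OF borel_measurable_integrable[OF h]] by metis
  have h'i: "integrable (time_measure T) h'"
    using h by (subst integrable_cong_AE[of _ _ h]) (use ae borel_time_measurable[OF h'] in auto)
  then have si: "set_integrable lborel {0<..<T} h'" by (simp add: integrable_time_measure)
  \<comment> \<open>\<open>ennreal\<close> truncates negative values, so the measures obtained from
    \<open>h'\<close> and from its negative have the positive and the negative part of
    \<open>h'\<close> as densities.\<close>
  define D where "D k = density (lborel_on J) (\<lambda>t. ennreal (k t))" for k :: "real \<Rightarrow> real"
  have nnD: "(\<integral>\<^sup>+t. ennreal (g t) \<partial>D k) = (\<integral>\<^sup>+t. ennreal (max 0 (k t) * g t * indicator J t) \<partial>lborel)"
    if "k \<in> borel_measurable borel" "g \<in> borel_measurable borel" "\<And>t. 0 \<le> g t" for k g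
  proof -
    have "(\<integral>\<^sup>+t. ennreal (g t) \<partial>D k) = (\<integral>\<^sup>+t. ennreal (k t) * ennreal (g t) * indicator J t \<partial>lborel)"
      unfolding D_def using that by (intro nn_integral_density_on[OF oJ]) auto
    also have "\<dots> = (\<integral>\<^sup>+t. ennreal (max 0 (k t) * g t * indicator J t) \<partial>lborel)"
      using that(3) by (intro nn_integral_cong) (auto simp: indicator_def ennreal_mult' ennreal_max_0)
    finally show ?thesis .
  qed
  have radD: "D k \<in> radon J" if k: "k \<in> borel_measurable borel" "set_integrable lborel {0<..<T} k" for k
  proof (rule radonI)
    show sD: "sets (D k) = sets (borel_on J)" by (simp add: D_def sets_restrict_space)
    fix K assume K: "compact K" "K \<subseteq> J"
    have "emeasure (D k) K \<le> emeasure (D k) J"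
      using K oJ by (intro emeasure_mono) (auto simp: sD sets_borel_on)
    also have "\<dots> = (\<integral>\<^sup>+t. ennreal 1 \<partial>D k)"
      using sets_eq_imp_space_eq[OF sD] by (simp add: space_restrict_space)
    also have "\<dots> = (\<integral>\<^sup>+t. ennreal (max 0 (k t) * 1 * indicator J t) \<partial>lborel)"
      using k(1) by (intro nnD) auto
    also have "\<dots> \<le> (\<integral>\<^sup>+t. ennreal (norm (indicator {0<..<T} t *\<^sub>R k t)) \<partial>lborel)"
      using J(2) by (intro nn_integral_mono ennreal_leI) (auto simp: indicator_def)
    also have "\<dots> < \<infinity>" using k(2) unfolding set_integrable_def integrable_iff_bounded by simp
    finally show "emeasure (D k) K < \<infinity>" .
  qed
  have si': "set_integrable lborel {0<..<T} (\<lambda>t. - h' t)"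
    using si by (simp add: set_integrable_def)
  have hm: "(\<lambda>t. - h' t) \<in> borel_measurable borel" by measurable
  note R1 = radD[OF h' si] and R2 = radD[OF hm si']
  have comp: "emeasure (D h') A \<le> emeasure (D (\<lambda>t. - h' t)) A" if A: "A \<in> rc_borel J" for A
  proof (rule radon_le_of_plateaus[OF R1 R2 oJ _ A])
    fix \<psi> assume \<psi>: "\<psi> \<in> plateaus J"
    note \<psi>c = plateaus_C1c[OF \<psi>]
    have \<psi>r: "0 \<le> \<psi> t" "\<psi> t \<le> 1" for t using plateaus_range[OF \<psi>] by auto
    have [measurable]: "\<psi> \<in> borel_measurable borel" by (rule C1c_measurable[OF \<psi>c])
    note \<psi>0 = C1c_zero[OF \<psi>c]
    have ip: "integrable lborel (\<lambda>t. max 0 (k t) * \<psi> t * indicator J t)"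
      if "k \<in> borel_measurable borel" "set_integrable lborel {0<..<T} k" for k
      using that(2) unfolding set_integrable_def
    proof (rule Bochner_Integration.integrable_bound)
      show "(\<lambda>t. max 0 (k t) * \<psi> t * indicator J t) \<in> borel_measurable lborel"
        using that(1) oJ by simp
      have "max 0 (k t) * \<psi> t \<le> \<bar>k t\<bar>" for t
        using mult_left_le[OF \<psi>r(2), of "max 0 (k t)" t] by auto
      then show "AE t in lborel. norm (max 0 (k t) * \<psi> t * indicator J t) \<le> norm (indicator {0<..<T} t *\<^sub>R k t)"
        using \<psi>r J(2) by (intro AE_I2) (auto simp: indicator_def abs_mult)
    qed
    have "(LINT t|time_measure T. \<psi> t * h' t) = (LINT t|time_measure T. \<psi> t * h t)"
      using ae h h'i plateau_time_integrable[OF \<psi>c h] plateau_time_integrable[OF \<psi>c h'i]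
      by (intro integral_cong_AE) (auto elim: AE_mp)
    then have "(LINT t:{0<..<T}|lborel. \<psi> t * h' t) \<le> 0"
      using le[OF \<psi>] by (simp add: integral_time_measure)
    also have "(LINT t:{0<..<T}|lborel. \<psi> t * h' t) = (LINT t|lborel. max 0 (h' t) * \<psi> t * indicator J t - max 0 (- h' t) * \<psi> t * indicator J t)"
      unfolding set_lebesgue_integral_def
    proof (intro Bochner_Integration.integral_cong refl)
      fix t
      show "indicator {0<..<T} t *\<^sub>R (\<psi> t * h' t) = max 0 (h' t) * \<psi> t * indicator J t - max 0 (- h' t) * \<psi> t * indicator J t"
        using \<psi>0[of t] J(2) by (cases "t \<in> J") (auto simp: indicator_def max_def)
    qed
    also have "\<dots> = (LINT t|lborel. max 0 (h' t) * \<psi> t * indicator J t) - (LINT t|lborel. max 0 (- h' t) * \<psi> t * indicator J t)"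
      by (rule Bochner_Integration.integral_diff[OF ip[OF h' si] ip[OF hm si']])
    finally have fin: "(LINT t|lborel. max 0 (h' t) * \<psi> t * indicator J t) \<le> (LINT t|lborel. max 0 (- h' t) * \<psi> t * indicator J t)" by simp
    have eqI: "(\<integral>\<^sup>+t. ennreal (\<psi> t) \<partial>D k) = ennreal (LINT t|lborel. max 0 (k t) * \<psi> t * indicator J t)"
      if "k \<in> borel_measurable borel" "set_integrable lborel {0<..<T} k" for k
    proof -
      have "(\<integral>\<^sup>+t. ennreal (\<psi> t) \<partial>D k) = (\<integral>\<^sup>+t. ennreal (max 0 (k t) * \<psi> t * indicator J t) \<partial>lborel)"
        using \<psi>r by (intro nnD that) auto
      also have "\<dots> = ennreal (LINT t|lborel. max 0 (k t) * \<psi> t * indicator J t)"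
        using \<psi>r by (intro nn_integral_eq_integral ip that) auto
      finally show ?thesis .
    qed
    show "(\<integral>\<^sup>+t. ennreal (\<psi> t) \<partial>D h') \<le> (\<integral>\<^sup>+t. ennreal (\<psi> t) \<partial>D (\<lambda>t. - h' t))"
      unfolding eqI[OF h' si] eqI[OF hm si'] by (rule ennreal_leI[OF fin])
  qed
  obtain C where C: "\<And>n. compact (C n)" "\<And>n. C n \<subseteq> J" "incseq C" "(\<Union>n. C n) = J"
    using compact_exhaustion[OF oJ] by metis
  have "AE t in lborel. \<not> (t \<in> C n \<and> 0 < h' t)" for n
  proof -
    let ?A = "C n \<inter> {t. 0 < h' t}"
    have "{t \<in> space borel. 0 < h' t} \<in> sets borel" by measurable
    then have A: "?A \<in> rc_borel J" using compact_rc_borel[OF C(1,2)] by (intro rc_borel_Int) auto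
    then have Ab: "?A \<in> sets borel" "?A \<subseteq> J" using rc_borel_sets by auto
    have em: "emeasure (D k) ?A = (\<integral>\<^sup>+t. ennreal (max 0 (k t) * indicator ?A t * indicator J t) \<partial>lborel)"
      if "k \<in> borel_measurable borel" for k
    proof -
      have "emeasure (D k) ?A = (\<integral>\<^sup>+t. ennreal (indicator ?A t) \<partial>D k)"
        using Ab oJ by (subst ennreal_indicator, subst nn_integral_indicator)
          (auto simp: D_def sets_restrict_space_iff)
      also have "\<dots> = (\<integral>\<^sup>+t. ennreal (max 0 (k t) * indicator ?A t * indicator J t) \<partial>lborel)"
        using Ab by (intro nnD that) auto
      finally show ?thesis .
    qed
    have "emeasure (D (\<lambda>t. - h' t)) ?A = (\<integral>\<^sup>+t. 0 \<partial>(lborel :: real measure))"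
      unfolding em[OF hm] by (intro nn_integral_cong) (auto simp: indicator_def)
    then have "(\<integral>\<^sup>+t. ennreal (max 0 (h' t) * indicator ?A t * indicator J t) \<partial>lborel) = 0"
      using comp[OF A] unfolding em[OF h'] by simp
    then have "AE t in lborel. ennreal (max 0 (h' t) * indicator ?A t * indicator J t) = 0"
      using Ab oJ by (subst (asm) nn_integral_0_iff_AE) auto
    then show ?thesis
      by (rule AE_mp) (use C(2)[of n] in \<open>auto intro!: AE_I2 simp: indicator_def\<close>)
  qed
  then have "AE t in lborel. \<forall>n. \<not> (t \<in> C n \<and> 0 < h' t)" unfolding AE_all_countable ..
  then have "AE t in time_measure T. t \<in> J \<longrightarrow> h' t \<le> 0"
    unfolding time_measure_AE_iff by (rule AE_mp) (use C(4) in \<open>auto intro!: AE_I2 simp: not_less\<close>)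
  then show ?thesis using ae by eventually_elim simp
qed

text \<open>The integrals of the approximating plateaus increase to the length of \<open>J\<close>,
  so one of them is positive. Such functions provide the denominators of averages.\<close>

lemma plateau_positive_integral:
  assumes J: "J = {a<..<b}" "a < b"
  obtains \<psi> where "\<psi> \<in> plateaus J" "0 < (LINT t|lborel. \<psi> t)"
proof -
  have oJ: "open J" using J by simp
  note L = lborel_on_radon[OF oJ]
  obtain f where f: "\<And>n. f n \<in> plateaus J" "\<And>x. incseq (\<lambda>n. f n x)" "\<And>x. (\<lambda>n. f n x) \<longlonglongrightarrow> indicator J x"
    using open_plateau_approx[OF oJ] by metis
  have "0 < emeasure (lborel_on J) J" using J by (simp add: emeasure_restrict_space)
  then have "0 < (SUP n. \<integral>\<^sup>+x. ennreal (f n x) \<partial>lborel_on J)"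
    unfolding emeasure_open_plateau[OF L oJ order_refl oJ f] .
  then obtain n where n: "0 < (\<integral>\<^sup>+x. ennreal (f n x) \<partial>lborel_on J)" by (auto simp: less_SUP_iff)
  note c = plateaus_C1c[OF f(1)[of n]]
  have r: "0 \<le> f n x" for x using plateaus_range[OF f(1)] by auto
  have "0 < (LINT x|lborel_on J. f n x)"
    using n r by (simp add: nn_integral_eq_integral C1c_integrable[OF L oJ c])
  also have "(LINT x|lborel_on J. f n x) = (LINT x|lborel. indicator J x *\<^sub>R f n x)"
    using oJ by (intro integral_restrict_space) simp
  also have "\<dots> = (LINT x|lborel. f n x)"
    using C1c_zero[OF c] by (intro Bochner_Integration.integral_cong) (auto simp: indicator_def)
  finally show thesis using that f(1) by blast
qed

text \<open>The test functions are combinations of primitives of plateaus, so \<open>test\<close>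
  becomes a statement about averages of \<open>m\<close>, which \<open>AE_nonpos_of_plateaus\<close>
  turns into pointwise inequalities.\<close>

lemma time_monotone:
  fixes T c0 :: real and m :: "real \<Rightarrow> real"
  assumes T: "0 < T" and m: "integrable (time_measure T) m"
    and test: "\<And>\<phi> \<phi>'. (\<And>t. (\<phi> has_real_derivative \<phi>' t) (at t)) \<Longrightarrow> continuous_on UNIV \<phi>' \<Longrightarrow> \<phi> T = 0 \<Longrightarrow>
      (\<And>t. t \<in> {0..T} \<Longrightarrow> 0 \<le> \<phi> t) \<Longrightarrow> - \<phi> 0 * c0 \<le> (LINT t|time_measure T. \<phi>' t * m t)"
  obtains N where "N \<in> null_sets lborel"
    "\<And>t. t \<in> {0<..<T} - N \<Longrightarrow> m t \<le> c0"
    "\<And>t1 t2. t1 \<in> {0<..<T} - N \<Longrightarrow> t2 \<in> {0<..<T} - N \<Longrightarrow> t1 < t2 \<Longrightarrow> m t2 \<le> m t1"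
proof -
  let ?J = "{0<..<T}"
  define I where "I \<psi> = (LINT t|time_measure T. \<psi> t)" for \<psi> :: "real \<Rightarrow> real"
  have lin: "(LINT t|time_measure T. \<psi> t * (m t - c)) = (LINT t|time_measure T. \<psi> t * m t) - c * I \<psi>"
    if \<psi>: "\<psi> \<in> plateaus S" for \<psi> S c
  proof -
    note i1 = plateau_time_integrable[OF plateaus_C1c[OF \<psi>] m]
      and i2 = plateau_time_integrable[OF plateaus_C1c[OF \<psi>] time_measure_finite[of T c]]
    have "(LINT t|time_measure T. \<psi> t * (m t - c)) = (LINT t|time_measure T. \<psi> t * m t - \<psi> t * c)"
      by (simp add: right_diff_distrib)
    also have "\<dots> = (LINT t|time_measure T. \<psi> t * m t) - (LINT t|time_measure T. \<psi> t * c)"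
      using i1 i2 by (rule Bochner_Integration.integral_diff)
    finally show ?thesis by (simp add: I_def)
  qed
  have prim: "\<exists>\<Phi>. (\<forall>t. (\<Phi> has_real_derivative \<psi> t) (at t)) \<and> I \<psi> = \<Phi> T - \<Phi> 0" if \<psi>: "\<psi> \<in> plateaus S" for \<psi> S
  proof -
    note c = C1c_continuous[OF plateaus_C1c[OF \<psi>]]
    obtain \<Phi> where \<Phi>: "\<And>t. (\<Phi> has_real_derivative \<psi> t) (at t)" by (rule real_antiderivative[OF c]) blast
    have "I \<psi> = \<Phi> T - \<Phi> 0"
      unfolding I_def integral_time_measure[OF borel_measurable_continuous_onI[OF c]]
      by (rule set_integral_FTC_Ioo[OF less_imp_le[OF T] \<Phi> c])
    then show ?thesis using \<Phi> by blast
  qed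
  have mono: "\<Phi> x \<le> \<Phi> y" if "\<forall>t. (\<Phi> has_real_derivative \<psi> t) (at t)" "\<psi> \<in> plateaus S" "x \<le> y" for \<Phi> \<psi> S x y
    using that plateaus_range[OF that(2)] by (intro DERIV_nonneg_imp_nondecreasing[OF that(3)]) blast
  have const: "\<Phi> x = \<Phi> y" if d: "\<forall>t. (\<Phi> has_real_derivative \<psi> t) (at t)" and "\<And>t. x \<le> t \<Longrightarrow> t \<le> y \<Longrightarrow> \<psi> t = 0" "x \<le> y" for \<Phi> \<psi> :: "real \<Rightarrow> real" and x y
  proof (rule antisym)
    show "\<Phi> x \<le> \<Phi> y" using d that(2) by (intro DERIV_nonneg_imp_nondecreasing[OF that(3)]) force
    show "\<Phi> y \<le> \<Phi> x" using d that(2) by (intro DERIV_nonpos_imp_nonincreasing[OF that(3)]) force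
  qed
  have upper: "AE t in time_measure T. t \<in> ?J \<longrightarrow> m t - c0 \<le> 0"
  proof (rule AE_nonpos_of_plateaus[OF refl order_refl])
    show "integrable (time_measure T) (\<lambda>t. m t - c0)"
      using m time_measure_finite by (rule Bochner_Integration.integrable_diff)
    fix \<psi> assume \<psi>: "\<psi> \<in> plateaus ?J"
    note c = C1c_continuous[OF plateaus_C1c[OF \<psi>]]
    obtain \<Phi> where \<Phi>: "\<forall>t. (\<Phi> has_real_derivative \<psi> t) (at t)" "I \<psi> = \<Phi> T - \<Phi> 0" using prim[OF \<psi>] by blast
    \<comment> \<open>The test function decreases from \<open>I \<psi>\<close> at time 0 to 0 at
      time \<open>T\<close>.\<close>
    have "- (\<Phi> T - \<Phi> 0) * c0 \<le> (LINT t|time_measure T. - \<psi> t * m t)"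
    proof (rule test[of "\<lambda>t. \<Phi> T - \<Phi> t"])
      show "((\<lambda>t. \<Phi> T - \<Phi> t) has_real_derivative - \<psi> t) (at t)" for t
        using \<Phi>(1) by (auto intro!: derivative_eq_intros)
      show "continuous_on UNIV (\<lambda>t. - \<psi> t)" using c by (intro continuous_intros)
    qed (use mono[OF \<Phi>(1) \<psi>] in auto)
    then show "(LINT t|time_measure T. \<psi> t * (m t - c0)) \<le> 0"
      unfolding lin[OF \<psi>] \<Phi>(2) by (simp add: algebra_simps)
  qed
  have sep: "\<exists>c. AE t in time_measure T. (t \<in> {0<..<q} \<longrightarrow> c \<le> m t) \<and> (t \<in> {q<..<T} \<longrightarrow> m t \<le> c)"
    if q: "0 < q" "q < T" for q
  proof -
    let ?A = "{0<..<q}" and ?B = "{q<..<T}"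
    define E where "E \<psi> = (LINT t|time_measure T. \<psi> t * m t)" for \<psi>
    \<comment> \<open>The mean of \<open>m\<close> against any \<beta> living after \<open>q\<close>
      does not exceed the mean against any \<alpha> living before \<open>q\<close>. The
      cross-multiplied form also covers vanishing denominators.\<close>
    have cross: "I \<alpha> * E \<beta> \<le> I \<beta> * E \<alpha>" if \<alpha>: "\<alpha> \<in> plateaus ?A" and \<beta>: "\<beta> \<in> plateaus ?B" for \<alpha> \<beta>
    proof -
      obtain A where A: "\<forall>t. (A has_real_derivative \<alpha> t) (at t)" "I \<alpha> = A T - A 0" using prim[OF \<alpha>] by blast
      obtain B where B: "\<forall>t. (B has_real_derivative \<beta> t) (at t)" "I \<beta> = B T - B 0" using prim[OF \<beta>] by blast
      have \<alpha>0: "\<alpha> t = 0" if "q \<le> t" for t using C1c_zero[OF plateaus_C1c[OF \<alpha>], of t] that by simp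
      have \<beta>0: "\<beta> t = 0" if "t \<le> q" for t using C1c_zero[OF plateaus_C1c[OF \<beta>], of t] that by simp
      have I0: "0 \<le> I \<alpha>" "0 \<le> I \<beta>" using mono[OF A(1) \<alpha>, of 0 T] mono[OF B(1) \<beta>, of 0 T] T A(2) B(2) by auto
      \<comment> \<open>The weights make the increase before \<open>q\<close> and the decrease after
        \<open>q\<close> both equal to \<open>I \<alpha> * I \<beta>\<close>. So the function
        vanishes at 0 and at \<open>T\<close>, and no term with \<open>c0\<close> survives.\<close>
      let ?\<phi> = "\<lambda>t. I \<alpha> * (B T - B t) - I \<beta> * (A T - A t)"
      have "- ?\<phi> 0 * c0 \<le> (LINT t|time_measure T. (I \<beta> * \<alpha> t - I \<alpha> * \<beta> t) * m t)"
      proof (rule test)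
        show "(?\<phi> has_real_derivative (I \<beta> * \<alpha> t - I \<alpha> * \<beta> t)) (at t)" for t
          using A(1) B(1) by (auto intro!: derivative_eq_intros)
        show "continuous_on UNIV (\<lambda>t. I \<beta> * \<alpha> t - I \<alpha> * \<beta> t)"
          by (intro continuous_intros C1c_continuous[OF plateaus_C1c[OF \<alpha>]] C1c_continuous[OF plateaus_C1c[OF \<beta>]])
        fix t assume t: "t \<in> {0..T}"
        show "0 \<le> ?\<phi> t"
        proof (cases "q \<le> t")
          case True
          then have "A t = A T" using t \<alpha>0 by (intro const[OF A(1)]) auto
          moreover have "B t \<le> B T" using t by (intro mono[OF B(1) \<beta>]) auto
          ultimately show ?thesis using I0 by simp
        next
          case False
          then have "B 0 = B t" using t \<beta>0 by (intro const[OF B(1)]) auto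
          then have e: "B T - B t = I \<beta>" "A T - A t = I \<alpha> - (A t - A 0)" using A(2) B(2) by auto
          have "?\<phi> t = I \<beta> * (A t - A 0)" unfolding e by (simp add: algebra_simps)
          moreover have "A 0 \<le> A t" using t by (intro mono[OF A(1) \<alpha>]) auto
          ultimately show ?thesis using I0 by simp
        qed
      qed simp
      moreover have "?\<phi> 0 = 0" using A(2) B(2) by simp
      moreover have "(LINT t|time_measure T. (I \<beta> * \<alpha> t - I \<alpha> * \<beta> t) * m t) = I \<beta> * E \<alpha> - I \<alpha> * E \<beta>"
      proof -
        note i1 = plateau_time_integrable[OF plateaus_C1c[OF \<alpha>] m] and i2 = plateau_time_integrable[OF plateaus_C1c[OF \<beta>] m]
        have "(LINT t|time_measure T. (I \<beta> * \<alpha> t - I \<alpha> * \<beta> t) * m t) = (LINT t|time_measure T. I \<beta> * (\<alpha> t * m t) - I \<alpha> * (\<beta> t * m t))"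
          by (simp add: algebra_simps)
        also have "\<dots> = (LINT t|time_measure T. I \<beta> * (\<alpha> t * m t)) - (LINT t|time_measure T. I \<alpha> * (\<beta> t * m t))"
          using i1 i2 by (intro Bochner_Integration.integral_diff integrable_mult_right)
        finally show ?thesis by (simp add: E_def)
      qed
      ultimately show ?thesis by simp
    qed
    have Ipos: "\<exists>\<psi>\<in>plateaus J. 0 < I \<psi>" if J: "J = {a<..<b}" "a < b" "J \<subseteq> ?J" for a b J
    proof -
      obtain \<psi> where \<psi>: "\<psi> \<in> plateaus J" "0 < (LINT t|lborel. \<psi> t)" by (rule plateau_positive_integral[OF J(1,2)])
      note c = plateaus_C1c[OF \<psi>(1)]
      have e: "indicat_real ?J x *\<^sub>R \<psi> x = \<psi> x" for x
      proof (cases "x \<in> ?J")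
        case False
        then have "x \<notin> J" using J(3) by blast
        then show ?thesis using C1c_zero[OF c, of x] by simp
      qed simp
      have "I \<psi> = (LINT t|lborel. \<psi> t)"
        unfolding I_def integral_time_measure[OF C1c_measurable[OF c]] set_lebesgue_integral_def e ..
      then show ?thesis using \<psi> by (intro bexI[of _ \<psi>]) simp_all
    qed
    have I_nonneg: "0 \<le> I \<psi>" if "\<psi> \<in> plateaus S" for \<psi> S
      unfolding I_def using plateaus_range[OF that] by (intro integral_nonneg_AE) auto
    have sub: "?A \<subseteq> ?J" "?B \<subseteq> ?J" using q by auto
    obtain \<alpha>0 where \<alpha>0: "\<alpha>0 \<in> plateaus ?A" "0 < I \<alpha>0" using Ipos[OF refl q(1) sub(1)] by blast
    obtain \<beta>0 where \<beta>0: "\<beta>0 \<in> plateaus ?B" "0 < I \<beta>0" using Ipos[OF refl q(2) sub(2)] by blast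
    \<comment> \<open>Any number between the means after \<open>q\<close> and the means before
      \<open>q\<close> would separate; the supremum of the former is taken.\<close>
    define X where "X = (\<lambda>\<beta>. E \<beta> / I \<beta>) ` {\<beta> \<in> plateaus ?B. 0 < I \<beta>}"
    define c where "c = Sup X"
    have Xb: "x \<le> E \<alpha> / I \<alpha>" if "\<alpha> \<in> plateaus ?A" "0 < I \<alpha>" "x \<in> X" for x \<alpha>
      using that cross[OF that(1)] by (auto simp: X_def field_simps)
    have Xne: "X \<noteq> {}" using \<beta>0 by (auto simp: X_def)
    have bdd: "bdd_above X" by (rule bdd_aboveI) (rule Xb[OF \<alpha>0])
    have up: "x \<le> c" if "x \<in> X" for x unfolding c_def by (rule cSup_upper[OF that bdd])
    have lo: "c \<le> E \<alpha> / I \<alpha>" if "\<alpha> \<in> plateaus ?A" "0 < I \<alpha>" for \<alpha>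
      unfolding c_def by (rule cSup_least[OF Xne]) (rule Xb[OF that])
    have lower: "AE t in time_measure T. t \<in> ?A \<longrightarrow> c - m t \<le> 0"
    proof (rule AE_nonpos_of_plateaus[OF refl])
      show "integrable (time_measure T) (\<lambda>t. c - m t)"
        using time_measure_finite m by (rule Bochner_Integration.integrable_diff)
      fix \<alpha> assume \<alpha>: "\<alpha> \<in> plateaus ?A"
      \<comment> \<open>With zero weight there is no mean to compare; \<open>cross\<close> against
        the fixed \<open>\<beta>0\<close> then gives \<open>0 \<le> E \<alpha>\<close>.\<close>
      have "c * I \<alpha> \<le> E \<alpha>"
      proof (cases "I \<alpha> = 0")
        case True
        then show ?thesis using cross[OF \<alpha> \<beta>0(1)] \<beta>0(2) by (simp add: zero_le_mult_iff)
      next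
        case False
        then show ?thesis using lo[OF \<alpha>] I_nonneg[OF \<alpha>] by (simp add: field_simps)
      qed
      moreover have "(LINT t|time_measure T. \<alpha> t * (c - m t)) = - (LINT t|time_measure T. \<alpha> t * (m t - c))"
        by (subst integral_minus[symmetric]) (simp add: algebra_simps)
      ultimately show "(LINT t|time_measure T. \<alpha> t * (c - m t)) \<le> 0"
        unfolding lin[OF \<alpha>] E_def by simp
    qed (use q in auto)
    have upper: "AE t in time_measure T. t \<in> ?B \<longrightarrow> m t - c \<le> 0"
    proof (rule AE_nonpos_of_plateaus[OF refl])
      show "integrable (time_measure T) (\<lambda>t. m t - c)"
        using m time_measure_finite by (rule Bochner_Integration.integrable_diff)
      fix \<beta> assume \<beta>: "\<beta> \<in> plateaus ?B"
      have "E \<beta> \<le> c * I \<beta>"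
      proof (cases "I \<beta> = 0")
        case True
        then show ?thesis using cross[OF \<alpha>0(1) \<beta>] \<alpha>0(2) by (simp add: mult_le_0_iff)
      next
        case False
        then have "E \<beta> / I \<beta> \<le> c" using \<beta> I_nonneg[OF \<beta>] by (intro up) (auto simp: X_def)
        then show ?thesis using False I_nonneg[OF \<beta>] by (simp add: field_simps)
      qed
      then show "(LINT t|time_measure T. \<beta> t * (m t - c)) \<le> 0"
        unfolding lin[OF \<beta>] E_def by simp
    qed (use q in auto)
    have "AE t in time_measure T. (t \<in> ?A \<longrightarrow> c \<le> m t) \<and> (t \<in> ?B \<longrightarrow> m t \<le> c)"
      using lower upper by eventually_elim auto
    then show ?thesis by blast
  qed
  \<comment> \<open>Rational separating times suffice, since one lies between any two given times,
    and they cost only countably many null sets.\<close>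
  define Q where "Q = {q \<in> \<rat>. 0 < q \<and> q < T}"
  have "countable Q" unfolding Q_def by (rule countable_subset[OF _ countable_rat]) auto
  have "\<forall>q\<in>Q. \<exists>c. AE t in time_measure T. (t \<in> {0<..<q} \<longrightarrow> c \<le> m t) \<and> (t \<in> {q<..<T} \<longrightarrow> m t \<le> c)"
    unfolding Q_def by (intro ballI sep) auto
  from bchoice[OF this] obtain c where c: "\<forall>q\<in>Q. AE t in time_measure T. (t \<in> {0<..<q} \<longrightarrow> c q \<le> m t) \<and> (t \<in> {q<..<T} \<longrightarrow> m t \<le> c q)"
    ..
  have "AE t in time_measure T. \<forall>q\<in>Q. (t \<in> {0<..<q} \<longrightarrow> c q \<le> m t) \<and> (t \<in> {q<..<T} \<longrightarrow> m t \<le> c q)"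
    unfolding AE_ball_countable[OF \<open>countable Q\<close>] by (rule c)
  with upper have "AE t in time_measure T. m t \<le> c0 \<and> (\<forall>q\<in>Q. (t \<in> {0<..<q} \<longrightarrow> c q \<le> m t) \<and> (t \<in> {q<..<T} \<longrightarrow> m t \<le> c q))"
    unfolding time_measure_AE_iff by eventually_elim auto
  then obtain N where N: "N \<in> null_sets lborel"
    "\<And>t. t \<in> ?J - N \<Longrightarrow> m t \<le> c0 \<and> (\<forall>q\<in>Q. (t \<in> {0<..<q} \<longrightarrow> c q \<le> m t) \<and> (t \<in> {q<..<T} \<longrightarrow> m t \<le> c q))"
    unfolding time_measure_AE_iff by (elim AE_E3) auto
  show thesis
  proof (rule that[OF N(1)])
    show "m t \<le> c0" if "t \<in> ?J - N" for t using N(2)[OF that] by blast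
    fix t1 t2 assume t: "t1 \<in> ?J - N" "t2 \<in> ?J - N" "t1 < t2"
    obtain q where q: "q \<in> \<rat>" "t1 < q" "q < t2" using Rats_dense_in_real[OF t(3)] by auto
    then have "q \<in> Q" using t by (auto simp: Q_def)
    then have "c q \<le> m t1" "m t2 \<le> c q" using N(2)[OF t(1)] N(2)[OF t(2)] q t by auto
    then show "m t2 \<le> m t1" by linarith
  qed
qed

text \<open>Each plateau \<rho> brings its own null set of times. The family is countable, so the
  union is null, and off it all plateaus compare the slices at once.\<close>

lemma singular_monotone:
  assumes T: "0 < T" and \<Omega>: "open \<Omega>" and M: "disintegration \<Omega> T M w"
    and bound: "\<And>K. compact K \<Longrightarrow> K \<subseteq> \<Omega> \<Longrightarrow> \<exists>C. AE t in time_measure T. measure (w t) K \<le> C"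
    and M0: "M0 \<in> radon \<Omega>"
    and test: "\<And>\<rho> \<phi> \<phi>'. \<rho> \<in> C1c \<Omega> \<Longrightarrow> (\<And>x. 0 \<le> \<rho> x) \<Longrightarrow> (\<And>t. (\<phi> has_real_derivative \<phi>' t) (at t)) \<Longrightarrow>
      continuous_on UNIV \<phi>' \<Longrightarrow> \<phi> T = 0 \<Longrightarrow> (\<And>t. t \<in> {0..T} \<Longrightarrow> 0 \<le> \<phi> t) \<Longrightarrow>
      - \<phi> 0 * (LINT x|M0. \<rho> x) \<le> (LINT t|time_measure T. \<phi>' t * (LINT x|w t. \<rho> x))"
  obtains N where "N \<in> null_sets lborel"
    "\<And>t1 t2. t1 \<in> {0<..<T} - N \<Longrightarrow> t2 \<in> {0<..<T} - N \<Longrightarrow> t1 < t2 \<Longrightarrow>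
      radon_le \<Omega> (measure (w t2)) (measure (w t1)) \<and> radon_le \<Omega> (measure (w t1)) (measure M0)"
proof -
  interpret disintegration \<Omega> T M w by (rule M)
  have "\<exists>N. N \<in> null_sets lborel \<and> (\<forall>t\<in>{0<..<T} - N. (LINT x|w t. \<rho> x) \<le> (LINT x|M0. \<rho> x)) \<and>
      (\<forall>t1\<in>{0<..<T} - N. \<forall>t2\<in>{0<..<T} - N. t1 < t2 \<longrightarrow> (LINT x|w t2. \<rho> x) \<le> (LINT x|w t1. \<rho> x))"
    if \<rho>: "\<rho> \<in> plateaus \<Omega>" for \<rho>
  proof -
    note c = plateaus_C1c[OF \<rho>]
    have r: "0 \<le> \<rho> x" "\<rho> x \<le> 1" for x using plateaus_range[OF \<rho>] by auto
    obtain K where K: "compact K" "K \<subseteq> \<Omega>" "\<And>x. x \<notin> K \<Longrightarrow> \<rho> x = 0" using c by (auto simp: C1c_def)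
    obtain C where C: "AE t in time_measure T. measure (w t) K \<le> C" using bound[OF K(1,2)] by blast
    have "integrable (time_measure T) (\<lambda>t. LINT x|w t. \<rho> (fst (x, t)))"
      by (rule fubini(2)[OF borel_compose_fst[OF C1c_measurable[OF c]] K(1,2) _ _ C, of 1]) (use r K(3) in auto)
    then have int: "integrable (time_measure T) (\<lambda>t. LINT x|w t. \<rho> x)" by simp
    show ?thesis
    proof (rule time_monotone[OF T int, of "LINT x|M0. \<rho> x"])
      show "- \<phi> 0 * (LINT x|M0. \<rho> x) \<le> (LINT t|time_measure T. \<phi>' t * (LINT x|w t. \<rho> x))"
        if "\<And>t. (\<phi> has_real_derivative \<phi>' t) (at t)" "continuous_on UNIV \<phi>'" "\<phi> T = 0"
          "\<And>t. t \<in> {0..T} \<Longrightarrow> 0 \<le> \<phi> t" for \<phi> \<phi>'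
        by (rule test) (fact c r(1) that)+
    qed blast
  qed
  then obtain N where N: "\<And>\<rho>. \<rho> \<in> plateaus \<Omega> \<Longrightarrow> N \<rho> \<in> null_sets lborel \<and> (\<forall>t\<in>{0<..<T} - N \<rho>. (LINT x|w t. \<rho> x) \<le> (LINT x|M0. \<rho> x)) \<and>
      (\<forall>t1\<in>{0<..<T} - N \<rho>. \<forall>t2\<in>{0<..<T} - N \<rho>. t1 < t2 \<longrightarrow> (LINT x|w t2. \<rho> x) \<le> (LINT x|w t1. \<rho> x))"
    by metis
  define E where "E = (\<Union>\<rho>\<in>plateaus \<Omega>. N \<rho>)"
  have le: "radon_le \<Omega> (measure A) (measure B)"
    if A: "A \<in> radon \<Omega>" and B: "B \<in> radon \<Omega>" and AB: "\<And>\<rho>. \<rho> \<in> plateaus \<Omega> \<Longrightarrow> (LINT x|A. \<rho> x) \<le> (LINT x|B. \<rho> x)" for A B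
  proof (rule radon_le_measureI[OF A B \<Omega>])
    fix X assume X: "X \<in> rc_borel \<Omega>"
    have "emeasure A X \<le> emeasure B X"
    proof (rule radon_le_of_plateaus[OF A B \<Omega> _ X])
      fix \<rho> assume \<rho>: "\<rho> \<in> plateaus \<Omega>"
      note c = plateaus_C1c[OF \<rho>]
      have r: "0 \<le> \<rho> x" for x using plateaus_range[OF \<rho>] by auto
      show "(\<integral>\<^sup>+x. ennreal (\<rho> x) \<partial>A) \<le> (\<integral>\<^sup>+x. ennreal (\<rho> x) \<partial>B)"
        using AB[OF \<rho>] r by (simp add: nn_integral_eq_integral C1c_integrable[OF A \<Omega> c] C1c_integrable[OF B \<Omega> c] ennreal_leI)
    qed
    then show "measure A X \<le> measure B X"
      by (simp add: radon_emeasure_eq[OF A \<Omega> X] radon_emeasure_eq[OF B \<Omega> X])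
  qed
  show thesis
  proof (rule that[of E])
    show "E \<in> null_sets lborel" unfolding E_def using N by (intro null_sets_UN' countable_plateaus) auto
    fix t1 t2 assume t: "t1 \<in> {0<..<T} - E" "t2 \<in> {0<..<T} - E" "t1 < t2"
    have t': "t1 \<in> {0<..<T} - N \<rho>" "t2 \<in> {0<..<T} - N \<rho>" if "\<rho> \<in> plateaus \<Omega>" for \<rho>
      using t that by (auto simp: E_def)
    show "radon_le \<Omega> (measure (w t2)) (measure (w t1)) \<and> radon_le \<Omega> (measure (w t1)) (measure M0)"
      using N t' t(3) by (intro conjI le w M0) blast+
  qed
qed

theorem theorem3p1:
  fixes T :: real and H :: "real \<Rightarrow> real" and \<Omega> :: "real set"
    and u0 :: "real set \<Rightarrow> real" and u :: "(real \<times> real) set \<Rightarrow> real"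
  assumes "T > 0"
    and "H \<in> W1inf" and "H 0 = 0"
    and "open \<Omega>"
    and "u0 \<in> signed_radon \<Omega>"
    and "is_entropy_solution \<Omega> T H u0 u"
  shows "\<exists>E\<in>null_sets lborel. \<forall>t1 t2.
    0 < t1 \<and> t1 < t2 \<and> t2 < T \<and> t1 \<notin> E \<and> t2 \<notin> E \<longrightarrow>
      radon_le \<Omega> (measure (pos_part \<Omega> (sing_part \<Omega> (signed_slice \<Omega> T u t2))))
                 (measure (pos_part \<Omega> (sing_part \<Omega> (signed_slice \<Omega> T u t1)))) \<and>
      radon_le \<Omega> (measure (pos_part \<Omega> (sing_part \<Omega> (signed_slice \<Omega> T u t1))))
                 (measure (pos_part \<Omega> (sing_part \<Omega> u0))) \<and>
      radon_le \<Omega> (measure (neg_part \<Omega> (sing_part \<Omega> (signed_slice \<Omega> T u t2))))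
                 (measure (neg_part \<Omega> (sing_part \<Omega> (signed_slice \<Omega> T u t1)))) \<and>
      radon_le \<Omega> (measure (neg_part \<Omega> (sing_part \<Omega> (signed_slice \<Omega> T u t1))))
                 (measure (neg_part \<Omega> (sing_part \<Omega> u0)))"
proof -
  note T = assms(1) and H = assms(2) and \<Omega> = assms(4) and u0 = assms(5) and ent = assms(6)
  have u: "u \<in> Linf_signed_radon \<Omega> T" using ent by (simp add: is_entropy_solution_def is_solution_def)
  obtain mp mn where
    mp: "disintegration \<Omega> T (pos_part (cylinder \<Omega> T) (sing_part (cylinder \<Omega> T) u)) mp" and
    mn: "disintegration \<Omega> T (neg_part (cylinder \<Omega> T) (sing_part (cylinder \<Omega> T) u)) mn" and
    bp: "\<And>K. compact K \<Longrightarrow> K \<subseteq> \<Omega> \<Longrightarrow> \<exists>C. AE t in time_measure T. measure (mp t) K \<le> C" and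
    bn: "\<And>K. compact K \<Longrightarrow> K \<subseteq> \<Omega> \<Longrightarrow> \<exists>C. AE t in time_measure T. measure (mn t) K \<le> C" and
    ae: "AE t in time_measure T.
       signed_slice \<Omega> T (sing_part (cylinder \<Omega> T) u) t \<in> signed_radon \<Omega> \<and>
       pos_part \<Omega> (signed_slice \<Omega> T (sing_part (cylinder \<Omega> T) u) t) = mp t \<and>
       neg_part \<Omega> (signed_slice \<Omega> T (sing_part (cylinder \<Omega> T) u) t) = mn t \<and>
       pos_part \<Omega> (sing_part \<Omega> (signed_slice \<Omega> T u t)) = mp t \<and>
       neg_part \<Omega> (sing_part \<Omega> (signed_slice \<Omega> T u t)) = mn t"
    by (rule slice_structure[OF \<Omega> u]) blast
  have ae1: "AE t in time_measure T.
       signed_slice \<Omega> T (sing_part (cylinder \<Omega> T) u) t \<in> signed_radon \<Omega> \<and>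
       pos_part \<Omega> (signed_slice \<Omega> T (sing_part (cylinder \<Omega> T) u) t) = mp t \<and>
       neg_part \<Omega> (signed_slice \<Omega> T (sing_part (cylinder \<Omega> T) u) t) = mn t"
    using ae by (rule AE_mp) (intro AE_I2 impI, blast)
  \<comment> \<open>Off \<open>E0\<close> the singular parts of the chosen slices are
    \<open>mp t\<close> and \<open>mn t\<close>; the order is first established for these explicit
    families and transferred at the end.\<close>
  obtain E0 where E0: "E0 \<in> null_sets lborel" "\<And>t. t \<in> {0<..<T} - E0 \<Longrightarrow>
       pos_part \<Omega> (sing_part \<Omega> (signed_slice \<Omega> T u t)) = mp t \<and>
       neg_part \<Omega> (sing_part \<Omega> (signed_slice \<Omega> T u t)) = mn t"
    using ae unfolding time_measure_AE_iff by (elim AE_E3) auto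
  obtain Z where Z: "carries_sing \<Omega> u0 Z" using carries_sing_ex[OF u0 \<Omega>] by blast
  note u0s = sing_part_signed_radon[OF u0 \<Omega> Z]
  have test: "- \<phi> 0 * (LINT x|(if s = 1 then pos_part else neg_part) \<Omega> (sing_part \<Omega> u0). \<rho> x)
      \<le> (LINT t|time_measure T. \<phi>' t * (LINT x|(if s = 1 then mp else mn) t. \<rho> x))"
    if "s = 1 \<or> s = -1" "\<rho> \<in> C1c \<Omega>" "\<And>x. 0 \<le> \<rho> x" "\<And>t. (\<phi> has_real_derivative \<phi>' t) (at t)"
      "continuous_on UNIV \<phi>'" "\<phi> T = 0" "\<And>t. t \<in> {0..T} \<Longrightarrow> 0 \<le> \<phi> t" for s :: real and \<rho> \<phi> \<phi>'
    by (rule entropy_singular_ineq[OF T H \<Omega> u0 ent that(1) mp _ mn _ ae1]) (fact bp bn that)+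
  have p: "\<exists>N. N \<in> null_sets lborel \<and> (\<forall>t1\<in>{0<..<T} - N. \<forall>t2\<in>{0<..<T} - N. t1 < t2 \<longrightarrow>
      radon_le \<Omega> (measure (mp t2)) (measure (mp t1)) \<and>
      radon_le \<Omega> (measure (mp t1)) (measure (pos_part \<Omega> (sing_part \<Omega> u0))))"
  proof (rule singular_monotone[OF T \<Omega> mp _ pos_part_radon[OF u0s \<Omega>]])
    show "- \<phi> 0 * (LINT x|pos_part \<Omega> (sing_part \<Omega> u0). \<rho> x) \<le> (LINT t|time_measure T. \<phi>' t * (LINT x|mp t. \<rho> x))"
      if "\<rho> \<in> C1c \<Omega>" "\<And>x. 0 \<le> \<rho> x" "\<And>t. (\<phi> has_real_derivative \<phi>' t) (at t)"
        "continuous_on UNIV \<phi>'" "\<phi> T = 0" "\<And>t. t \<in> {0..T} \<Longrightarrow> 0 \<le> \<phi> t" for \<rho> \<phi> \<phi>'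
      using test[of 1 \<rho> \<phi> \<phi>'] that by simp
  qed (fact bp, blast)
  have n: "\<exists>N. N \<in> null_sets lborel \<and> (\<forall>t1\<in>{0<..<T} - N. \<forall>t2\<in>{0<..<T} - N. t1 < t2 \<longrightarrow>
      radon_le \<Omega> (measure (mn t2)) (measure (mn t1)) \<and>
      radon_le \<Omega> (measure (mn t1)) (measure (neg_part \<Omega> (sing_part \<Omega> u0))))"
  proof (rule singular_monotone[OF T \<Omega> mn _ neg_part_radon[OF u0s \<Omega>]])
    show "- \<phi> 0 * (LINT x|neg_part \<Omega> (sing_part \<Omega> u0). \<rho> x) \<le> (LINT t|time_measure T. \<phi>' t * (LINT x|mn t. \<rho> x))"
      if "\<rho> \<in> C1c \<Omega>" "\<And>x. 0 \<le> \<rho> x" "\<And>t. (\<phi> has_real_derivative \<phi>' t) (at t)"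
        "continuous_on UNIV \<phi>'" "\<phi> T = 0" "\<And>t. t \<in> {0..T} \<Longrightarrow> 0 \<le> \<phi> t" for \<rho> \<phi> \<phi>'
      using test[of "-1" \<rho> \<phi> \<phi>'] that by simp
  qed (fact bn, blast)
  obtain Ep where Ep: "Ep \<in> null_sets lborel"
    "\<And>t1 t2. t1 \<in> {0<..<T} - Ep \<Longrightarrow> t2 \<in> {0<..<T} - Ep \<Longrightarrow> t1 < t2 \<Longrightarrow>
      radon_le \<Omega> (measure (mp t2)) (measure (mp t1)) \<and>
      radon_le \<Omega> (measure (mp t1)) (measure (pos_part \<Omega> (sing_part \<Omega> u0)))"
    using p by blast
  obtain En where En: "En \<in> null_sets lborel"
    "\<And>t1 t2. t1 \<in> {0<..<T} - En \<Longrightarrow> t2 \<in> {0<..<T} - En \<Longrightarrow> t1 < t2 \<Longrightarrow>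
      radon_le \<Omega> (measure (mn t2)) (measure (mn t1)) \<and>
      radon_le \<Omega> (measure (mn t1)) (measure (neg_part \<Omega> (sing_part \<Omega> u0)))"
    using n by blast
  show ?thesis
  proof (intro bexI[of _ "E0 \<union> Ep \<union> En"] allI impI)
    show "E0 \<union> Ep \<union> En \<in> null_sets lborel" using E0 Ep En by auto
    fix t1 t2 assume "0 < t1 \<and> t1 < t2 \<and> t2 < T \<and> t1 \<notin> E0 \<union> Ep \<union> En \<and> t2 \<notin> E0 \<union> Ep \<union> En"
    then have t: "t1 \<in> {0<..<T} - E0" "t2 \<in> {0<..<T} - E0" "t1 \<in> {0<..<T} - Ep" "t2 \<in> {0<..<T} - Ep"
      "t1 \<in> {0<..<T} - En" "t2 \<in> {0<..<T} - En" "t1 < t2" by auto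
    show "radon_le \<Omega> (measure (pos_part \<Omega> (sing_part \<Omega> (signed_slice \<Omega> T u t2))))
                 (measure (pos_part \<Omega> (sing_part \<Omega> (signed_slice \<Omega> T u t1)))) \<and>
      radon_le \<Omega> (measure (pos_part \<Omega> (sing_part \<Omega> (signed_slice \<Omega> T u t1))))
                 (measure (pos_part \<Omega> (sing_part \<Omega> u0))) \<and>
      radon_le \<Omega> (measure (neg_part \<Omega> (sing_part \<Omega> (signed_slice \<Omega> T u t2))))
                 (measure (neg_part \<Omega> (sing_part \<Omega> (signed_slice \<Omega> T u t1)))) \<and>
      radon_le \<Omega> (measure (neg_part \<Omega> (sing_part \<Omega> (signed_slice \<Omega> T u t1))))
                 (measure (neg_part \<Omega> (sing_part \<Omega> u0)))"
      using E0(2)[OF t(1)] E0(2)[OF t(2)] Ep(2)[OF t(3,4,7)] En(2)[OF t(5,6,7)] by simp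
  qed
qed

end
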